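(* Let either $r=1$ and $k=0$, or $r=2$ and $k\in\{0,1\}$. For $N\geqslant M$ and $t\in[-1,1]$, let $\lambda_{N,t}\geqslant0$ be the number such that $\left\|u^{(r)}_{\lambda_{N,t},t}\right\|_2=N$; in particular $\lambda_{N,-1}=\lambda_{N,1}=\lambda_N$, where $\left\|u_{\lambda_N}^{(r)}\right\|_2=N$. Define the operator $S_N:L_2\to L_\infty$ by \[ S_Nf(t)=\int_{-1}^1u^{(r)}_{\lambda_{N,t},t}(x)f(x)\,dx,\qquad f\in L_2,\ t\in[-1,1]. \] Then, for $N\in(0,M)$, $E_N\left(D^k;W^r_2\right)=+\infty$, and, for $N\geqslant M=M_{-1}$, \[ E_N\left(D^k;W^r_2\right)=U\left(D^k;S_N;W^r_2\right)=\left\|u_{\lambda_N}\right\|_2=E_N\left(D^k_{-1};W^r_2\right). \]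
   Context: Let $\mathbb{I}=[-1,1]$, $L_2=L_2(\mathbb{I})$ and $L_\infty=L_\infty(\mathbb{I})$ (real-valued functions) with the usual norms $\|\cdot\|_2$, $\|\cdot\|_\infty$. For $m\in\mathbb{N}$, $L_2^m$ is the space of functions $f:\mathbb{I}\to\mathbb{R}$ having absolutely continuous derivative $f^{(m-1)}$ and such that $f^{(m)}\in L_2$; $L_2^m((a,b))$ is the analogous space on $(a,b)$. Let $W^r_2=\{f\in L_2^r:\|f^{(r)}\|_2\leqslant 1\}$. Let $\mathcal{P}_{r-1}$ be the set of real algebraic polynomials of degree at most $r-1$, and let $\delta_{i,j}$ be the Kronecker symbol. For $\lambda\geqslant 0$, $u_\lambda\in L_2^{2r}$ denotes the unique solution of \[ \begin{cases}(-1)^ru^{(2r)}(x)+\lambda u(x)=0,& x\in(-1,1),\\ u^{(s)}(-1)=(-1)^{k-1}\delta_{r-k-1,s},& s=0,1,\ldots,r-1,\\ u^{(s)}(1)=0,& s=0,1,\ldots,r-1.\end{cases} \] For $\lambda\geqslant 0$ and $t\in(-1,1)$, $u_{\lambda,t}$ denotes the unique function whose restrictions to $(-1,t)$ and $(t,1)$ belong to $L_2^{2r}((-1,t))$ and $L_2^{2r}((t,1))$ and which satisfies \[ \begin{cases}(-1)^ru^{(2r)}(x)+\lambda u(x)=0,& x\in(-1,t)\cup(t,1),\\ u^{(s)}(-1)=u^{(s)}(1)=0,& s=0,1,\ldots,r-1,\\ u^{(s)}(t+0)-u^{(s)}(t-0)=(-1)^{k-1}\delta_{r-k-1,s},& s=0,1,\ldots,2r-1.\end{cases}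 \] Derivatives of $u_{\lambda,t}$ are taken on $(-1,t)\cup(t,1)$; $u_{\lambda,t}^{(r)}$ extends continuously to $\mathbb{I}$. At the endpoints put $u_{\lambda,-1}=u_\lambda$ and $u_{\lambda,1}(x)=(-1)^{r-k}u_\lambda(-x)$. $M$ is the smallest constant such that $\|Q^{(k)}\|_\infty\leqslant M\|Q\|_2$ for all $Q\in\mathcal{P}_{r-1}$, and $M_{-1}$ is the smallest constant such that $|Q^{(k)}(-1)|\leqslant M_{-1}\|Q\|_2$ for all $Q\in\mathcal{P}_{r-1}$. $D^k$ is the operator $f\mapsto f^{(k)}$ (from $L_2$ to $L_\infty$, domain $L_2^r$) and $D^k_{-1}$ is the functional $f\mapsto f^{(k)}(-1)$ (domain $L_2^r$). For a linear operator $S:L_2\to L_\infty$, \[ U(D^k;S;W^r_2)=\sup_{f\in W^r_2}\|f^{(k)}-Sf\|_\infty, \] and $E_N(D^k;W^r_2)$ is the infimum of $U(D^k;S;W^r_2)$ over all bounded linear operators $S:L_2\to L_\infty$ with norm $\|S\|\leqslant N$. Similarly, $E_N(D^k_{-1};W^r_2)=\inf_S\sup_{f\in W^r_2}|f^{(k)}(-1)-Sf|$, the infimum being over bounded linear functionals $S:L_2\to\mathbb{R}$ with $\|S\|\leqslant N$. *)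

theory Defs
  imports
    "HOL-Probability.Essential_Supremum"
    "HOL-Computational_Algebra.Polynomial"
begin

text \<open>
  Functions on a subset of the line are represented by total functions of type real to real, whose
  values off that subset are irrelevant. Elements of $L_2$ and $L_\infty$ are represented by
  functions rather than by classes of functions equal almost everywhere.
\<close>

abbreviation II :: "real set" where
  "II \<equiv> {-1..1}"

definition L2 :: "real set \<Rightarrow> (real \<Rightarrow> real) set" where
  "L2 S = {f. f \<in> borel_measurable (lebesgue_on S) \<and> integrable (lebesgue_on S) (\<lambda>x. (f x)\<^sup>2)}"

text \<open>Only meaningful for members of \<^term>\<open>L2 II\<close>, since the Bochner integral of a
  non-integrable function is 0.\<close>
definition norm2 :: "(real \<Rightarrow> real) \<Rightarrow> real" where
  "norm2 f = sqrt (LINT x|lebesgue_on II. (f x)\<^sup>2)"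

text \<open>This is \<open>\<infinity>\<close> for functions that are not measurable.\<close>
definition norm_inf :: "(real \<Rightarrow> real) \<Rightarrow> ereal" where
  "norm_inf f = esssup (lebesgue_on II) (\<lambda>x. ereal \<bar>f x\<bar>)"

definition Linf :: "(real \<Rightarrow> real) set" where
  "Linf = {f. f \<in> borel_measurable (lebesgue_on II) \<and> norm_inf f < \<infinity>}"

definition abs_cont_on :: "real set \<Rightarrow> (real \<Rightarrow> real) \<Rightarrow> bool" where
  "abs_cont_on S f \<longleftrightarrow>
     (\<forall>\<epsilon>>0. \<exists>\<delta>>0. \<forall>(n::nat) a b.
        (\<forall>i<n. a i \<le> b i \<and> {a i..b i} \<subseteq> S) \<longrightarrow>
        disjoint_family_on (\<lambda>i. {a i<..<b i}) {..<n} \<longrightarrow>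
        (\<Sum>i<n. b i - a i) < \<delta> \<longrightarrow>
        (\<Sum>i<n. \<bar>f (b i) - f (a i)\<bar>) < \<epsilon>)"

text \<open>The \<open>n\<close>-th derivative of a function with domain \<open>S\<close>; it is one-sided at the endpoints of
  a closed interval.\<close>
definition nderiv :: "real set \<Rightarrow> nat \<Rightarrow> (real \<Rightarrow> real) \<Rightarrow> real \<Rightarrow> real" where
  "nderiv S n f = ((\<lambda>g x. vector_derivative g (at x within S)) ^^ n) f"

text \<open>The space $L_2^m$ on an interval \<open>S\<close>, for \<open>m \<ge> 1\<close>. The \<open>m\<close>-th derivative exists almost
  everywhere only; its values on the exceptional null set do not matter.\<close>
definition L2m :: "nat \<Rightarrow> real set \<Rightarrow> (real \<Rightarrow> real) set" where
  "L2m m S = {f. (\<forall>j<m - 1. nderiv S j f differentiable_on S) \<and>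
                 abs_cont_on S (nderiv S (m - 1) f) \<and>
                 nderiv S m f \<in> L2 S}"

definition W2 :: "nat \<Rightarrow> (real \<Rightarrow> real) set" where
  "W2 r = {f \<in> L2m r II. norm2 (nderiv II r f) \<le> 1}"

definition u_problem :: "nat \<Rightarrow> nat \<Rightarrow> real \<Rightarrow> (real \<Rightarrow> real) \<Rightarrow> bool" where
  "u_problem r k l u \<longleftrightarrow>
     u \<in> L2m (2 * r) II \<and>
     (\<forall>x\<in>{-1<..<1}. (-1) ^ r * nderiv II (2 * r) u x + l * u x = 0) \<and>
     (\<forall>s\<le>r - 1. nderiv II s u (-1) = (-1) powi (int k - 1) * of_bool (r - k - 1 = s)) \<and>
     (\<forall>s\<le>r - 1. nderiv II s u 1 = 0)"

abbreviation punctured :: "real \<Rightarrow> real set" where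
  "punctured t \<equiv> {-1<..<t} \<union> {t<..<1}"

text \<open>A function in the space $L_2^{2r}$ on a bounded open interval, and its derivatives of order
  less than \<open>2 * r\<close>, extend continuously to the closed interval, so that the boundary values
  are one-sided limits.\<close>
definition ut_problem :: "nat \<Rightarrow> nat \<Rightarrow> real \<Rightarrow> real \<Rightarrow> (real \<Rightarrow> real) \<Rightarrow> bool" where
  "ut_problem r k l t u \<longleftrightarrow>
     u \<in> L2m (2 * r) {-1<..<t} \<and> u \<in> L2m (2 * r) {t<..<1} \<and>
     (\<forall>x\<in>punctured t. (-1) ^ r * nderiv (punctured t) (2 * r) u x + l * u x = 0) \<and>
     (\<forall>s\<le>r - 1. (nderiv (punctured t) s u \<longlongrightarrow> 0) (at_right (-1)) \<and>
                (nderiv (punctured t) s u \<longlongrightarrow> 0) (at_left 1)) \<and>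
     (\<forall>s\<le>2 * r - 1. \<exists>p q.
        (nderiv (punctured t) s u \<longlongrightarrow> p) (at_right t) \<and>
        (nderiv (punctured t) s u \<longlongrightarrow> q) (at_left t) \<and>
        p - q = (-1) powi (int k - 1) * of_bool (r - k - 1 = s))"

text \<open>The two problems determine \<open>u\<close> on $[-1,1]$ and on $(-1,t)\cup(t,1)$, respectively, but not
  elsewhere; hence SOME and not THE in the next two definitions.\<close>
definition u_end :: "nat \<Rightarrow> nat \<Rightarrow> real \<Rightarrow> real \<Rightarrow> real" where
  "u_end r k l = (SOME u. u_problem r k l u)"

definition u_sol :: "nat \<Rightarrow> nat \<Rightarrow> real \<Rightarrow> real \<Rightarrow> real \<Rightarrow> real" where
  "u_sol r k l t =
     (if t = -1 then u_end r k l
      else if t = 1 then (\<lambda>x. (-1) ^ (r - k) * u_end r k l (-x))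
      else (SOME u. ut_problem r k l t u))"

text \<open>For \<open>t = -1\<close> and \<open>t = 1\<close> the set \<^term>\<open>punctured t\<close> is the open interval $(-1,1)$.\<close>
definition u_sol_deriv :: "nat \<Rightarrow> nat \<Rightarrow> real \<Rightarrow> real \<Rightarrow> real \<Rightarrow> real" where
  "u_sol_deriv r k l t = nderiv (punctured t) r (u_sol r k l t)"

definition lam_end :: "nat \<Rightarrow> nat \<Rightarrow> real \<Rightarrow> real" where
  "lam_end r k N = (THE l. 0 \<le> l \<and> norm2 (nderiv II r (u_end r k l)) = N)"

definition lam :: "nat \<Rightarrow> nat \<Rightarrow> real \<Rightarrow> real \<Rightarrow> real" where
  "lam r k N t = (THE l. 0 \<le> l \<and> norm2 (u_sol_deriv r k l t) = N)"

definition S_op :: "nat \<Rightarrow> nat \<Rightarrow> real \<Rightarrow> (real \<Rightarrow> real) \<Rightarrow> real \<Rightarrow> real" where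
  "S_op r k N f t = (LINT x|lebesgue_on II. u_sol_deriv r k (lam r k N t) t x * f x)"

definition M_const :: "nat \<Rightarrow> nat \<Rightarrow> real" where
  "M_const r k = (LEAST c. \<forall>Q::real poly. degree Q \<le> r - 1 \<longrightarrow>
     norm_inf (poly ((pderiv ^^ k) Q)) \<le> ereal (c * norm2 (poly Q)))"

definition M_end :: "nat \<Rightarrow> nat \<Rightarrow> real" where
  "M_end r k = (LEAST c. \<forall>Q::real poly. degree Q \<le> r - 1 \<longrightarrow>
     \<bar>poly ((pderiv ^^ k) Q) (-1)\<bar> \<le> c * norm2 (poly Q))"

text \<open>Linear operators from $L_2$ to $L_\infty$ and linear functionals on $L_2$, both compatible
  with equality almost everywhere.\<close>
definition linear_operator :: "((real \<Rightarrow> real) \<Rightarrow> real \<Rightarrow> real) \<Rightarrow> bool" where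
  "linear_operator S \<longleftrightarrow>
     (\<forall>f\<in>L2 II. S f \<in> Linf) \<and>
     (\<forall>f\<in>L2 II. \<forall>g\<in>L2 II. (AE x in lebesgue_on II. f x = g x) \<longrightarrow>
        (AE x in lebesgue_on II. S f x = S g x)) \<and>
     (\<forall>f\<in>L2 II. \<forall>g\<in>L2 II. \<forall>a b. AE x in lebesgue_on II.
        S (\<lambda>y. a * f y + b * g y) x = a * S f x + b * S g x)"

definition operator_norm :: "((real \<Rightarrow> real) \<Rightarrow> real \<Rightarrow> real) \<Rightarrow> ereal" where
  "operator_norm S = (SUP f\<in>{f \<in> L2 II. norm2 f \<le> 1}. norm_inf (S f))"

definition linear_functional :: "((real \<Rightarrow> real) \<Rightarrow> real) \<Rightarrow> bool" where
  "linear_functional S \<longleftrightarrow>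
     (\<forall>f\<in>L2 II. \<forall>g\<in>L2 II. (AE x in lebesgue_on II. f x = g x) \<longrightarrow> S f = S g) \<and>
     (\<forall>f\<in>L2 II. \<forall>g\<in>L2 II. \<forall>a b. S (\<lambda>y. a * f y + b * g y) = a * S f + b * S g)"

definition functional_norm :: "((real \<Rightarrow> real) \<Rightarrow> real) \<Rightarrow> ereal" where
  "functional_norm S = (SUP f\<in>{f \<in> L2 II. norm2 f \<le> 1}. ereal \<bar>S f\<bar>)"

definition U_dev :: "nat \<Rightarrow> nat \<Rightarrow> ((real \<Rightarrow> real) \<Rightarrow> real \<Rightarrow> real) \<Rightarrow> ereal" where
  "U_dev r k S = (SUP f\<in>W2 r. norm_inf (\<lambda>x. nderiv II k f x - S f x))"

definition E_best :: "nat \<Rightarrow> nat \<Rightarrow> real \<Rightarrow> ereal" where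
  "E_best r k N = (INF S\<in>{S. linear_operator S \<and> operator_norm S \<le> ereal N}. U_dev r k S)"

definition E_best_end :: "nat \<Rightarrow> nat \<Rightarrow> real \<Rightarrow> ereal" where
  "E_best_end r k N =
     (INF S\<in>{S. linear_functional S \<and> functional_norm S \<le> ereal N}.
        SUP f\<in>W2 r. ereal \<bar>nderiv II k f (-1) - S f\<bar>)"

end

theory Submission
  imports Defs
begin

text \<open>
  Integration by parts shows that $f^{(k)}(t) = \int u^{(r)} f + \sigma \int u f^{(r)}$ for
  $u = u_{\lambda,t}$ and $\sigma = -(-1)^r$, and that, among all such representations of $f^{(k)}(t)$ by a
  pair $(v,w)$, the pair $(u^{(r)},u)$ minimises $\|v\|_2^2 + \lambda \|w\|_2^2$. The minimum is
  $G_\lambda(t) = u^{(r+k)}(t)$. Minimality makes $\|u^{(r)}\|_2$ strictly increasing and $\|u\|_2$ decreasing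
  in $\lambda$. The function $u^{(r)}_{\lambda,-1}$ is extremal, which gives the lower bounds, and the operator
  $S_N$ deviates at \<open>t\<close> by at most $\|u_{\lambda_{N,t},t}\|_2$.

  It remains to compare \<open>t\<close> with the endpoint. If $G_\lambda(t) \le G_\lambda(-1)$ for all $\lambda > 0$, then
  $N^2 + \lambda \|u_{\lambda,t}\|_2^2 \le G_\lambda(t) \le G_\lambda(-1) \le N^2 + \lambda \|u_{\lambda_N}\|_2^2$ for
  $\lambda \ge \lambda_{N,t}$. For \<open>r = 1\<close> and \<open>r = 2\<close> the function $G_\lambda$ is explicit, and the inequality is
  a consequence of the addition formulas for $\cosh$ and for $(\cosh \pm \cos)/2$, $(\sinh \pm \sin)/2$.
\<close>

section \<open>Absolutely continuous functions\<close>

text \<open>Membership in \<open>L2m\<close> gives only absolute continuity of the derivative of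
  order \<open>r - 1\<close>, so every integration by parts rests on the fundamental theorem for
  absolutely continuous functions. This is why Vitali coverings and Lebesgue's differentiation
  theorem for monotone functions are needed at all. Three obstacles shape the rest. The lower bound
  uses a multiple of u^(r) whose derivative of order \<open>r\<close> has norm 1; that derivative is
  \<sigma> \<lambda> u, which vanishes for \<lambda> = 0, the critical parameter of the endpoint
  when \<open>N\<close> equals \<open>M\<close>. Estimates are therefore made at parameters to the
  right of the critical one, followed by a limit. Next, the kernel of \<open>S_op\<close> depends on
  \<open>t\<close> also through its parameter, so even measurability of \<open>S_op r k N f\<close>
  needs an argument: both the kernel (in the 2-norm) and the parameter are shown to be continuous in
  \<open>t\<close>. Finally, the solutions are chosen by SOME from a class of low regularity, so
  explicit formulas become available only after a uniqueness theorem, which is an energy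
  argument.\<close>

lemma Vitali_covering_intervals:
  fixes K :: "(real \<times> real) set"
  assumes cov: "\<And>x d. x \<in> S \<Longrightarrow> 0 < d \<Longrightarrow> \<exists>u v. (u, v) \<in> K \<and> u \<le> x \<and> x \<le> v \<and> u < v \<and> v - u < d"
  obtains C where "countable C" "C \<subseteq> K" "\<And>p. p \<in> C \<Longrightarrow> fst p < snd p"
    "pairwise (\<lambda>p q. disjnt {fst p..snd p} {fst q..snd q}) C"
    "negligible (S - (\<Union>p\<in>C. {fst p<..<snd p}))"
proof -
  let ?K = "{p \<in> K. fst p < snd p}"
  let ?a = "\<lambda>p. (fst p + snd p) / 2" and ?r = "\<lambda>p. (snd p - fst p) / (2::real)"
  have cb: "cball (?a p) (?r p) = {fst p..snd p}" for p :: "real \<times> real"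
    by (simp add: cball_eq_atLeastAtMost field_simps)
  obtain C where C: "countable C" "C \<subseteq> ?K"
    "pairwise (\<lambda>i j. disjnt (cball (?a i) (?r i)) (cball (?a j) (?r j))) C"
    "negligible (S - (\<Union>i \<in> C. cball (?a i) (?r i)))"
  proof (rule Vitali_covering_theorem_cballs[of ?K ?r S ?a])
    fix x d :: real assume "x \<in> S" "0 < d"
    then obtain u v where "(u, v) \<in> K" "u \<le> x" "x \<le> v" "u < v" "v - u < d"
      using cov by blast
    then show "\<exists>i. i \<in> ?K \<and> x \<in> cball (?a i) (?r i) \<and> ?r i < d"
      by (intro exI[of _ "(u, v)"]) (auto simp: dist_real_def abs_if field_simps)
  qed auto
  \<comment> \<open>The covering theorem yields closed balls. Their countably many endpoints form a
    null set, so the open intervals still cover almost everything.\<close>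
  have "negligible (fst ` C \<union> snd ` C)"
    using C(1) by (simp add: negligible_iff_null_sets countable_imp_null_set_lborel null_sets_completionI)
  then have "negligible ((S - (\<Union>i \<in> C. cball (?a i) (?r i))) \<union> (fst ` C \<union> snd ` C))"
    using C(4) by (rule negligible_Un[rotated])
  then have "negligible (S - (\<Union>p\<in>C. {fst p<..<snd p}))"
  proof (rule negligible_subset, intro subsetI)
    fix x assume x: "x \<in> S - (\<Union>p\<in>C. {fst p<..<snd p})"
    show "x \<in> (S - (\<Union>i \<in> C. cball (?a i) (?r i))) \<union> (fst ` C \<union> snd ` C)"
    proof (cases "\<exists>p\<in>C. x \<in> {fst p..snd p}")
      case True
      then obtain p where "p \<in> C" "x = fst p \<or> x = snd p" using x by fastforce
      then show ?thesis by blast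
    next
      case False
      then show ?thesis using x unfolding cb by blast
    qed
  qed
  then show thesis
    using C(1-3) by (intro that[of C]) (auto simp: cb)
qed

text \<open>Two disjoint closed intervals are separated by a gap, so monotonicity alone keeps the
  open image intervals disjoint, even where \<open>F\<close> jumps. With the identity for
  \<open>F\<close> this is the total length of the family itself.\<close>

lemma emeasure_UN_mono_intervals:
  fixes F :: "real \<Rightarrow> real"
  assumes F: "mono F" and C: "countable C" "\<And>p. p \<in> C \<Longrightarrow> fst p < snd p"
    and disj: "pairwise (\<lambda>p q. disjnt {fst p..snd p} {fst q..snd q}) C"
  shows "emeasure lborel (\<Union>p\<in>C. {F (fst p)<..<F (snd p)}) =
         (\<integral>\<^sup>+ p. ennreal (F (snd p) - F (fst p)) \<partial>count_space C)"
proof -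
  have "disjoint_family_on (\<lambda>p. {F (fst p)<..<F (snd p)}) C"
  proof (clarsimp simp: disjoint_family_on_def set_eq_iff)
    fix a b c d y
    assume *: "(a, b) \<in> C" "(c, d) \<in> C" "a = c \<longrightarrow> b \<noteq> d"
      and y: "F a < y" "y < F b" "F c < y" "y < F d"
    have "a < b" "c < d" using C(2)[OF *(1)] C(2)[OF *(2)] by auto
    moreover have "disjnt {a..b} {c..d}"
      using * disj by (force simp: pairwise_def)
    ultimately have "b < c \<or> d < a"
      by (force simp: disjnt_def)
    then show False
      using y monoD[OF F, of b c] monoD[OF F, of d a] by auto
  qed
  then have "emeasure lborel (\<Union>p\<in>C. {F (fst p)<..<F (snd p)}) =
        (\<integral>\<^sup>+ p. emeasure lborel {F (fst p)<..<F (snd p)} \<partial>count_space C)"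
    using C by (intro emeasure_UN_countable) auto
  also have "\<dots> = (\<integral>\<^sup>+ p. ennreal (F (snd p) - F (fst p)) \<partial>count_space C)"
    using C(2) by (intro nn_integral_cong) (simp add: monoD[OF F] less_imp_le)
  finally show ?thesis .
qed

text \<open>The intersection of covers of measure 1/(n+1) is a null set, and the countably many
  uncovered remainders are null as well.\<close>

lemma negligible_if_small_cover:
  fixes E :: "real set"
  assumes "\<And>e. e > 0 \<Longrightarrow> \<exists>G. open G \<and> negligible (E - G) \<and> emeasure lborel G \<le> ennreal e"
  shows "negligible E"
proof -
  have "\<exists>G. open G \<and> negligible (E - G) \<and> emeasure lborel G \<le> ennreal (1 / Suc n)" for n
    using assms[of "1 / Suc n"] by simp
  then obtain G where G: "\<And>n. open (G n)" "\<And>n. negligible (E - G n)"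
    "\<And>n. emeasure lborel (G n) \<le> ennreal (1 / Suc n)" by metis
  have "emeasure lborel (\<Inter>n. G n) \<le> ennreal (1 / Suc n)" for n
    using G(1) by (intro order_trans[OF emeasure_mono G(3)[of n]]) auto
  moreover have "(\<lambda>n. ennreal (1 / Suc n)) \<longlonglongrightarrow> ennreal 0"
    using LIMSEQ_inverse_real_of_nat by (intro tendsto_ennrealI) (simp add: inverse_eq_divide)
  ultimately have "emeasure lborel (\<Inter>n. G n) \<le> ennreal 0"
    by (intro LIMSEQ_le_const) auto
  then have "(\<Inter>n. G n) \<in> null_sets lborel"
    using G(1) by (auto intro!: null_setsI sets.countable_INT'' simp: borel_open)
  then have "negligible (\<Inter>n. G n)"
    using negligible_iff_null_sets null_sets_completionI by blast
  moreover have "negligible (\<Union>n. E - G n)"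
    using G(2) by (intro negligible_countable_Union) auto
  ultimately have "negligible ((\<Inter>n. G n) \<union> (\<Union>n. E - G n))"
    by (rule negligible_Un)
  then show ?thesis
    by (rule negligible_subset) auto
qed

text \<open>Derivates are taken over intervals that contain \<open>x\<close>, possibly as an
  endpoint. Failure of steepness or flatness therefore bounds both one-sided difference quotients at
  once.\<close>

definition steep :: "(real \<Rightarrow> real) \<Rightarrow> real \<Rightarrow> real set" where
  "steep F q = {x. \<forall>d>0. \<exists>u v. u \<le> x \<and> x \<le> v \<and> u < v \<and> v - u < d \<and> q * (v - u) < F v - F u}"

definition flat :: "(real \<Rightarrow> real) \<Rightarrow> real \<Rightarrow> real set" where
  "flat F p = {x. \<forall>d>0. \<exists>u v. u \<le> x \<and> x \<le> v \<and> u < v \<and> v - u < d \<and> F v - F u < p * (v - u)}"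

lemma small_interval_subset_open:
  fixes x :: real
  assumes "open G" "x \<in> G"
  obtains e where "e > 0" "\<And>u v. u \<le> x \<Longrightarrow> x \<le> v \<Longrightarrow> v - u < e \<Longrightarrow> {u..v} \<subseteq> G"
proof -
  obtain e where e: "e > 0" "ball x e \<subseteq> G"
    using assms open_contains_ball by blast
  show thesis
    by (rule that[OF e(1)]) (use e(2) in \<open>force simp: dist_real_def\<close>)
qed

text \<open>Two nested Vitali coverings: flat intervals inside \<open>G\<close>, and steep intervals
  inside those. The image intervals of the steep ones have measure at least \<open>q\<close> times
  their length and lie within the image intervals of the flat ones, whose measure is at most
  \<open>p\<close> times that of \<open>G\<close>.\<close>

lemma steep_flat_step:
  fixes F :: "real \<Rightarrow> real"
  assumes F: "mono F" and pq: "0 < p" "p < q" and G: "open G" "negligible (E - G)"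
    and E: "E \<subseteq> steep F q \<inter> flat F p"
  obtains G' where "open G'" "negligible (E - G')"
    "ennreal q * emeasure lborel G' \<le> ennreal p * emeasure lborel G"
proof -
  let ?K1 = "{(u, v). {u..v} \<subseteq> G \<and> F v - F u < p * (v - u)}"
  obtain C1 where C1: "countable C1" "C1 \<subseteq> ?K1" "\<And>p. p \<in> C1 \<Longrightarrow> fst p < snd p"
    "pairwise (\<lambda>p q. disjnt {fst p..snd p} {fst q..snd q}) C1"
    "negligible (E \<inter> G - (\<Union>p\<in>C1. {fst p<..<snd p}))"
  proof (rule Vitali_covering_intervals[of "E \<inter> G" ?K1])
    fix x d :: real assume x: "x \<in> E \<inter> G" "0 < d"
    obtain e where e: "e > 0" "\<And>u v. u \<le> x \<Longrightarrow> x \<le> v \<Longrightarrow> v - u < e \<Longrightarrow> {u..v} \<subseteq> G"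
      using small_interval_subset_open G(1) x by blast
    obtain u v where "u \<le> x" "x \<le> v" "u < v" "v - u < min d e" "F v - F u < p * (v - u)"
      using x E e(1) unfolding flat_def by (blast dest: spec[of _ "min d e"] intro: min_less_iff_conj[THEN iffD2])
    then show "\<exists>u v. (u, v) \<in> ?K1 \<and> u \<le> x \<and> x \<le> v \<and> u < v \<and> v - u < d"
      using e(2)[of u v] by (intro exI[of _ u] exI[of _ v]) auto
  qed auto
  let ?G1 = "\<Union>p\<in>C1. {fst p<..<snd p}"
  let ?K2 = "{(u, v). (\<exists>p\<in>C1. fst p < u \<and> v < snd p) \<and> q * (v - u) < F v - F u}"
  obtain C2 where C2: "countable C2" "C2 \<subseteq> ?K2" "\<And>p. p \<in> C2 \<Longrightarrow> fst p < snd p"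
    "pairwise (\<lambda>p q. disjnt {fst p..snd p} {fst q..snd q}) C2"
    "negligible (E \<inter> ?G1 - (\<Union>p\<in>C2. {fst p<..<snd p}))"
  proof (rule Vitali_covering_intervals[of "E \<inter> ?G1" ?K2])
    fix x d :: real assume x: "x \<in> E \<inter> ?G1" "0 < d"
    then obtain p where p: "p \<in> C1" "fst p < x" "x < snd p" by auto
    obtain u v where "u \<le> x" "x \<le> v" "u < v" "v - u < min d (min (x - fst p) (snd p - x))"
        "q * (v - u) < F v - F u"
      using x E p unfolding steep_def
      by (blast dest: spec[of _ "min d (min (x - fst p) (snd p - x))"]
                intro: min_less_iff_conj[THEN iffD2] diff_gt_0_iff_gt[THEN iffD2])
    then show "\<exists>u v. (u, v) \<in> ?K2 \<and> u \<le> x \<and> x \<le> v \<and> u < v \<and> v - u < d"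
      using p(1) by (intro exI[of _ u] exI[of _ v]) (auto intro!: bexI[of _ p])
  qed auto
  let ?G2 = "\<Union>p\<in>C2. {fst p<..<snd p}"
  have id: "emeasure lborel (\<Union>p\<in>C. {fst p<..<snd p}) = (\<integral>\<^sup>+ p. ennreal (snd p - fst p) \<partial>count_space C)"
    if "countable C" "\<And>p. p \<in> C \<Longrightarrow> fst p < snd p"
      "pairwise (\<lambda>p q. disjnt {fst p..snd p} {fst q..snd q}) C" for C :: "(real \<times> real) set"
    using emeasure_UN_mono_intervals[of "\<lambda>x. x", OF _ that] by (simp add: mono_def)
  have "ennreal q * emeasure lborel ?G2 = (\<integral>\<^sup>+ p. ennreal q * ennreal (snd p - fst p) \<partial>count_space C2)"
    by (simp add: id[OF C2(1,3,4)] nn_integral_cmult)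
  also have "\<dots> \<le> (\<integral>\<^sup>+ p. ennreal (F (snd p) - F (fst p)) \<partial>count_space C2)"
    using C2(2,3) pq by (intro nn_integral_mono) (force simp: ennreal_mult[symmetric] intro!: ennreal_leI)
  also have "\<dots> = emeasure lborel (\<Union>p\<in>C2. {F (fst p)<..<F (snd p)})"
    by (rule emeasure_UN_mono_intervals[OF F C2(1,3,4), symmetric])
  also have "\<dots> \<le> emeasure lborel (\<Union>p\<in>C1. {F (fst p)<..<F (snd p)})"
  proof (intro emeasure_mono UN_least)
    fix p assume "p \<in> C2"
    then obtain p' where "p' \<in> C1" "fst p' < fst p" "snd p < snd p'" using C2(2) by auto
    then show "{F (fst p)<..<F (snd p)} \<subseteq> (\<Union>p\<in>C1. {F (fst p)<..<F (snd p)})"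
      using monoD[OF F, of "fst p'" "fst p"] monoD[OF F, of "snd p" "snd p'"]
      by (intro subset_trans[OF _ UN_upper[of p']]) auto
  qed (auto intro!: borel_open)
  also have "\<dots> = (\<integral>\<^sup>+ p. ennreal (F (snd p) - F (fst p)) \<partial>count_space C1)"
    by (rule emeasure_UN_mono_intervals[OF F C1(1,3,4)])
  also have "\<dots> \<le> (\<integral>\<^sup>+ x. ennreal p * ennreal (snd x - fst x) \<partial>count_space C1)"
    using C1(2,3) pq by (intro nn_integral_mono) (force simp: ennreal_mult[symmetric] intro!: ennreal_leI)
  also have "\<dots> = ennreal p * emeasure lborel ?G1"
    by (simp add: id[OF C1(1,3,4)] nn_integral_cmult)
  also have "\<dots> \<le> ennreal p * emeasure lborel G"
    using C1(2,3) G(1) by (intro mult_left_mono emeasure_mono) force+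
  finally have meas: "ennreal q * emeasure lborel ?G2 \<le> ennreal p * emeasure lborel G" .
  have "negligible ((E - G) \<union> (E \<inter> G - ?G1) \<union> (E \<inter> ?G1 - ?G2))"
    using G(2) C1(5) C2(5) by (intro negligible_Un)
  then have "negligible (E - ?G2)"
    by (rule negligible_subset) auto
  then show thesis
    by (intro that[OF _ _ meas]) auto
qed

text \<open>Each application of the step multiplies the measure of the cover by
  \<open>p / q\<close>, starting from the bounded interval itself.\<close>

lemma negligible_steep_flat:
  fixes F :: "real \<Rightarrow> real"
  assumes F: "mono F" and pq: "0 < p" "p < q"
  shows "negligible (steep F q \<inter> flat F p \<inter> {-c<..<c})" (is "negligible ?E")
proof (cases "c > 0")
  case c: True
  have "\<exists>G. open G \<and> negligible (?E - G) \<and> emeasure lborel G \<le> ennreal ((p / q) ^ n * (2 * c))" for n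
  proof (induction n)
    case 0
    show ?case using c by (intro exI[of _ "{-c<..<c}"]) auto
  next
    case (Suc n)
    then obtain G where G: "open G" "negligible (?E - G)" "emeasure lborel G \<le> ennreal ((p / q) ^ n * (2 * c))"
      by blast
    obtain G' where G': "open G'" "negligible (?E - G')" "ennreal q * emeasure lborel G' \<le> ennreal p * emeasure lborel G"
      using steep_flat_step[OF F pq G(1,2)] by blast
    have "ennreal q * emeasure lborel G' \<le> ennreal p * ennreal ((p / q) ^ n * (2 * c))"
      using G'(3) G(3) by (meson mult_left_mono order_trans zero_le)
    then have "ennreal (1 / q) * (ennreal q * emeasure lborel G') \<le> ennreal (1 / q) * (ennreal p * ennreal ((p / q) ^ n * (2 * c)))"
      by (rule mult_left_mono) simp
    moreover have "ennreal (1 / q) * (ennreal q * emeasure lborel G') = emeasure lborel G'"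
      using pq by (simp add: mult.assoc[symmetric] ennreal_mult[symmetric])
    moreover have "ennreal (1 / q) * (ennreal p * ennreal ((p / q) ^ n * (2 * c))) = ennreal ((p / q) ^ Suc n * (2 * c))"
      using pq c by (simp add: ennreal_mult[symmetric] field_simps)
    ultimately show ?case using G' by auto
  qed
  note * = this
  show ?thesis
  proof (rule negligible_if_small_cover)
    fix e :: real assume "e > 0"
    have "(\<lambda>n. (p / q) ^ n * (2 * c)) \<longlonglongrightarrow> 0 * (2 * c)"
      using pq by (intro tendsto_intros LIMSEQ_realpow_zero) auto
    then obtain n where "(p / q) ^ n * (2 * c) < e"
      using \<open>e > 0\<close> by (auto dest!: order_tendstoD(2)[of _ _ _ e] eventually_happens)
    then show "\<exists>G. open G \<and> negligible (?E - G) \<and> emeasure lborel G \<le> ennreal e"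
      using *[of n] by (meson ennreal_leI less_imp_le order_trans)
  qed
qed simp

text \<open>For a disjoint covering by intervals of slope above \<open>n\<close>, the image
  intervals fit into \<open>{F (-c)..F c}\<close>, so the covering has total length at most (F c - F
  (-c)) / n.\<close>

lemma negligible_infinitely_steep:
  fixes F :: "real \<Rightarrow> real"
  assumes F: "mono F"
  shows "negligible ((\<Inter>n::nat. steep F (real n)) \<inter> {-c<..<c})" (is "negligible ?E")
proof (rule negligible_if_small_cover)
  fix e :: real assume "e > 0"
  define D where "D = F c - F (-c)"
  obtain n :: nat where n: "n > 0" "D / e < real n"
    using reals_Archimedean2[of "max 0 (D / e)"] by (metis less_max_iff_disj max_less_iff_conj of_nat_0_less_iff)
  let ?K = "{(u, v). -c < u \<and> v < c \<and> real n * (v - u) < F v - F u}"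
  obtain C where C: "countable C" "C \<subseteq> ?K" "\<And>p. p \<in> C \<Longrightarrow> fst p < snd p"
    "pairwise (\<lambda>p q. disjnt {fst p..snd p} {fst q..snd q}) C"
    "negligible (?E - (\<Union>p\<in>C. {fst p<..<snd p}))"
  proof (rule Vitali_covering_intervals[of ?E ?K])
    fix x d :: real assume x: "x \<in> ?E" "0 < d"
    then have "x \<in> steep F (real n)" "0 < min d (min (x + c) (c - x))" by auto
    then obtain u v where "u \<le> x" "x \<le> v" "u < v" "v - u < min d (min (x + c) (c - x))"
        "real n * (v - u) < F v - F u"
      unfolding steep_def by blast
    then show "\<exists>u v. (u, v) \<in> ?K \<and> u \<le> x \<and> x \<le> v \<and> u < v \<and> v - u < d"
      by (intro exI[of _ u] exI[of _ v]) auto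
  qed auto
  let ?G = "\<Union>p\<in>C. {fst p<..<snd p}"
  have "ennreal n * emeasure lborel ?G = (\<integral>\<^sup>+ p. ennreal n * ennreal (snd p - fst p) \<partial>count_space C)"
    using emeasure_UN_mono_intervals[of "\<lambda>x. x", OF _ C(1,3,4)] by (simp add: mono_def nn_integral_cmult)
  also have "\<dots> \<le> (\<integral>\<^sup>+ p. ennreal (F (snd p) - F (fst p)) \<partial>count_space C)"
    using C(2,3) by (intro nn_integral_mono) (force simp: ennreal_mult[symmetric] intro!: ennreal_leI)
  also have "\<dots> = emeasure lborel (\<Union>p\<in>C. {F (fst p)<..<F (snd p)})"
    by (rule emeasure_UN_mono_intervals[OF F C(1,3,4), symmetric])
  also have "\<dots> \<le> emeasure lborel {F (-c)..F c}"
  proof (intro emeasure_mono UN_least)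
    fix p assume "p \<in> C"
    then have "-c < fst p" "snd p < c" using C(2) by auto
    then show "{F (fst p)<..<F (snd p)} \<subseteq> {F (-c)..F c}"
      using monoD[OF F, of "-c" "fst p"] monoD[OF F, of "snd p" c] by auto
  qed auto
  also have "\<dots> \<le> ennreal D"
    by (simp add: D_def emeasure_lborel_Icc_eq)
  also have "\<dots> \<le> ennreal (n * e)"
    using n \<open>e > 0\<close> by (intro ennreal_leI) (simp add: field_simps)
  finally have "ennreal (1 / n) * (ennreal n * emeasure lborel ?G) \<le> ennreal (1 / n) * ennreal (n * e)"
    by (rule mult_left_mono) simp
  then have "emeasure lborel ?G \<le> ennreal e"
    using n \<open>e > 0\<close> by (simp add: mult.assoc[symmetric] ennreal_mult[symmetric])
  then show "\<exists>G. open G \<and> negligible (?E - G) \<and> emeasure lborel G \<le> ennreal e"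
    using C(5) by (intro exI[of _ ?G]) auto
qed


text \<open>Lebesgue's theorem. Off the exceptional set, the infimum \<open>m\<close> of the slopes
  at which \<open>x\<close> is not steep is the derivative. Rational slopes keep the exceptional set
  a countable union.\<close>

lemma negligible_not_differentiable_mono:
  fixes F :: "real \<Rightarrow> real"
  assumes F: "mono F"
  shows "negligible {x. \<not> F differentiable (at x)}"
proof -
  define N where "N = (\<Union>c::nat. (\<Inter>n::nat. steep F (real n)) \<inter> {- real c<..<real c}) \<union>
     (\<Union>p\<in>{p\<in>\<rat>. 0 < p}. \<Union>q\<in>{q\<in>\<rat>. p < q}. \<Union>c::nat. steep F q \<inter> flat F p \<inter> {- real c<..<real c})"
  have "countable {p\<in>\<rat>. 0 < (p::real)}" "countable {q\<in>\<rat>. p < q}" for p :: real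
    by (auto intro: countable_subset[OF _ countable_rat])
  then have N: "negligible N"
    unfolding N_def
    by (intro negligible_Un negligible_countable_Union countable_image)
       (auto simp del: UN_simps Int_UN_distrib intro!: negligible_countable_Union
          countable_image negligible_infinitely_steep[OF F] negligible_steep_flat[OF F])
  have "F differentiable (at x)" if x: "x \<notin> N" for x
  proof -
    obtain c :: nat where c: "\<bar>x\<bar> < real c" using reals_Archimedean2 by blast
    obtain n :: nat where n: "x \<notin> steep F (real n)"
      using x c unfolding N_def by (auto simp: abs_less_iff)
    have sf: "\<not> (x \<in> steep F q \<and> x \<in> flat F p)" if "p \<in> \<rat>" "q \<in> \<rat>" "0 < p" "p < q" for p q
      using x c that unfolding N_def by (force simp: abs_less_iff)
    define A where "A = {q. 0 \<le> q \<and> x \<notin> steep F q}"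
    define m where "m = Inf A"
    have A: "A \<noteq> {}" "bdd_below A" using n by (auto simp: A_def intro!: exI[of _ "real n"])
    have "\<exists>d>0. \<forall>h. h \<noteq> 0 \<and> \<bar>h\<bar> < d \<longrightarrow> \<bar>(F (x + h) - F x) / h - m\<bar> < 2 * e" if e: "e > 0" for e
    proof -
      obtain q where q: "q \<in> A" "q < m + e"
        using cInf_lessD[OF A(1), of "m + e"] e by (auto simp: m_def)
      then obtain d1 where d1: "d1 > 0"
          "\<And>u v. u \<le> x \<Longrightarrow> x \<le> v \<Longrightarrow> u < v \<Longrightarrow> v - u < d1 \<Longrightarrow> F v - F u \<le> q * (v - u)"
        unfolding A_def steep_def mem_Collect_eq by (meson not_less)
      obtain d2 p where d2: "d2 > 0" "m - e \<le> p"
          "\<And>u v. u \<le> x \<Longrightarrow> x \<le> v \<Longrightarrow> u < v \<Longrightarrow> v - u < d2 \<Longrightarrow> p * (v - u) \<le> F v - F u"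
      \<comment> \<open>If \<open>m - e\<close> is not positive, monotonicity supplies the lower
        slope 0. Otherwise take rationals p < q' between \<open>m - e\<close> and \<open>m\<close>:
        below the infimum \<open>x\<close> is steep for q', hence not flat for
        \<open>p\<close>.\<close>
      proof (cases "m - e \<le> 0")
        case True
        then show ?thesis using monoD[OF F] by (intro that[of 1 0]) auto
      next
        case False
        obtain p where p: "p \<in> \<rat>" "m - e < p" "p < m" using Rats_dense_in_real[of "m - e" m] e by auto
        obtain q' where q': "q' \<in> \<rat>" "p < q'" "q' < m" using Rats_dense_in_real[of p m] p by auto
        have "x \<in> steep F q'"
          using cInf_lower[OF _ A(2), of q'] q' p False by (force simp: A_def m_def)
        then have "x \<notin> flat F p" using sf[of p q'] p q' False by auto
        then obtain d2 where "d2 > 0"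
          "\<And>u v. u \<le> x \<Longrightarrow> x \<le> v \<Longrightarrow> u < v \<Longrightarrow> v - u < d2 \<Longrightarrow> p * (v - u) \<le> F v - F u"
          unfolding flat_def mem_Collect_eq by (meson not_less)
        then show ?thesis using p by (intro that[of d2 p]) auto
      qed
      show ?thesis
      proof (intro exI[of _ "min d1 d2"] conjI allI impI)
        fix h assume h: "h \<noteq> 0 \<and> \<bar>h\<bar> < min d1 d2"
        show "\<bar>(F (x + h) - F x) / h - m\<bar> < 2 * e"
        proof (cases "h > 0")
          case True
          then have "F (x + h) - F x \<le> q * h" "p * h \<le> F (x + h) - F x"
            using d1(2)[of x "x + h"] d2(3)[of x "x + h"] h by auto
          then have "(F (x + h) - F x) / h \<le> q" "p \<le> (F (x + h) - F x) / h"
            using True by (simp_all add: field_simps)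
          then show ?thesis using q d2(2) e by linarith
        next
          case False
          then have "F x - F (x + h) \<le> q * - h" "p * - h \<le> F x - F (x + h)"
            using d1(2)[of "x + h" x] d2(3)[of "x + h" x] h by auto
          then have "(F (x + h) - F x) / h \<le> q" "p \<le> (F (x + h) - F x) / h"
            using False h by (simp_all add: field_simps)
          then show ?thesis using q d2(2) e by linarith
        qed
      qed (use d1 d2 in auto)
    qed
    note * = this
    have "(\<lambda>h. (F (x + h) - F x) / h) \<midarrow>0\<rightarrow> m"
    proof (rule LIM_I)
      fix e :: real assume "e > 0"
      then show "\<exists>s>0. \<forall>h. h \<noteq> 0 \<and> norm (h - 0) < s \<longrightarrow> norm ((F (x + h) - F x) / h - m) < e"
        using *[of "e / 2"] by simp
    qed
    then have "(F has_real_derivative m) (at x)"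
      by (simp add: DERIV_def)
    then show ?thesis unfolding real_differentiable_def by blast
  qed
  then show ?thesis
    by (intro negligible_subset[OF N]) auto
qed

section \<open>Almost everywhere differentiability of absolutely continuous functions\<close>

lemma sum_disjoint_intervals_le:
  fixes a b :: "nat \<Rightarrow> real"
  assumes "\<And>i. i < n \<Longrightarrow> a i \<le> b i" "\<And>i. i < n \<Longrightarrow> {a i<..<b i} \<subseteq> A" "A \<in> sets lebesgue"
    and "disjoint_family_on (\<lambda>i. {a i<..<b i}) {..<n}"
  shows "ennreal (\<Sum>i<n. b i - a i) \<le> emeasure lebesgue A"
proof -
  have "ennreal (\<Sum>i<n. b i - a i) = (\<Sum>i<n. emeasure lebesgue {a i<..<b i})"
    using assms(1) by (subst sum_ennreal[symmetric]) (auto intro!: sum.cong)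
  also have "\<dots> = emeasure lebesgue (\<Union>i<n. {a i<..<b i})"
    using assms(4) by (intro sum_emeasure) auto
  also have "\<dots> \<le> emeasure lebesgue A"
    using assms by (intro emeasure_mono) auto
  finally show ?thesis .
qed

lemma abs_cont_onD:
  assumes "abs_cont_on S f" "\<epsilon> > 0"
  obtains \<delta> where "\<delta> > 0"
    "\<And>(n::nat) a b. (\<And>i. i < n \<Longrightarrow> a i \<le> b i \<and> {a i..b i} \<subseteq> S) \<Longrightarrow>
        disjoint_family_on (\<lambda>i. {a i<..<b i}) {..<n} \<Longrightarrow> (\<Sum>i<n. b i - a i) < \<delta> \<Longrightarrow>
        (\<Sum>i<n. \<bar>f (b i) - f (a i)\<bar>) < \<epsilon>"
proof -
  obtain \<delta> where "\<delta> > 0" "\<forall>(n::nat) a b. (\<forall>i<n. a i \<le> b i \<and> {a i..b i} \<subseteq> S) \<longrightarrow>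
        disjoint_family_on (\<lambda>i. {a i<..<b i}) {..<n} \<longrightarrow> (\<Sum>i<n. b i - a i) < \<delta> \<longrightarrow>
        (\<Sum>i<n. \<bar>f (b i) - f (a i)\<bar>) < \<epsilon>"
    using assms unfolding abs_cont_on_def by auto
  then show thesis by (intro that) auto
qed

lemma abs_cont_on_subset:
  assumes f: "abs_cont_on S f" and S: "S' \<subseteq> S"
  shows "abs_cont_on S' f"
  unfolding abs_cont_on_def
proof (intro allI impI)
  fix \<epsilon> :: real assume "\<epsilon> > 0"
  obtain \<delta> where \<delta>: "\<delta> > 0"
    "\<And>(n::nat) a b. (\<And>i. i < n \<Longrightarrow> a i \<le> b i \<and> {a i..b i} \<subseteq> S) \<Longrightarrow>
        disjoint_family_on (\<lambda>i. {a i<..<b i}) {..<n} \<Longrightarrow> (\<Sum>i<n. b i - a i) < \<delta> \<Longrightarrow>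
        (\<Sum>i<n. \<bar>f (b i) - f (a i)\<bar>) < \<epsilon>"
    using abs_cont_onD[OF f \<open>\<epsilon> > 0\<close>] by blast
  show "\<exists>\<delta>>0. \<forall>(n::nat) a b. (\<forall>i<n. a i \<le> b i \<and> {a i..b i} \<subseteq> S') \<longrightarrow>
        disjoint_family_on (\<lambda>i. {a i<..<b i}) {..<n} \<longrightarrow> (\<Sum>i<n. b i - a i) < \<delta> \<longrightarrow>
        (\<Sum>i<n. \<bar>f (b i) - f (a i)\<bar>) < \<epsilon>"
    using S by (intro exI[of _ \<delta>] conjI \<delta>(1) allI impI \<delta>(2)) auto
qed

text \<open>Jordan decomposition: with \<open>T\<close> the variation accumulated from
  \<open>c\<close>, both \<open>T\<close> and \<open>T - f\<close> are increasing, so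
  \<open>f\<close> is a difference of two monotone functions.\<close>

lemma negligible_not_differentiable_short:
  fixes f :: "real \<Rightarrow> real"
  assumes bd: "\<And>(n::nat) a b. (\<And>i. i < n \<Longrightarrow> a i \<le> b i \<and> {a i..b i} \<subseteq> {c..d}) \<Longrightarrow>
        disjoint_family_on (\<lambda>i. {a i<..<b i}) {..<n} \<Longrightarrow> (\<Sum>i<n. \<bar>f (b i) - f (a i)\<bar>) \<le> B"
  shows "negligible {x \<in> {c<..<d}. \<not> f differentiable (at x)}"
proof (cases "c < d")
  case cd: True
  define Vs where "Vs y = {\<Sum>i<n. \<bar>f (b i) - f (a i)\<bar> | (n::nat) a b. 
      (\<forall>i<n. a i \<le> b i \<and> {a i..b i} \<subseteq> {c..y}) \<and> disjoint_family_on (\<lambda>i. {a i<..<b i}) {..<n}}" for y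
  define T where "T y = Sup (Vs y)" for y
  have ne: "0 \<in> Vs y" for y
    unfolding Vs_def by (intro CollectI exI[of _ "0::nat"]) (auto simp: disjoint_family_on_def)
  have bdd: "bdd_above (Vs y)" if "y \<le> d" for y
    unfolding Vs_def bdd_above_def
  proof (intro exI[of _ B] ballI, clarify)
    fix n :: nat and a b :: "nat \<Rightarrow> real"
    assume *: "\<forall>i<n. a i \<le> b i \<and> {a i..b i} \<subseteq> {c..y}" "disjoint_family_on (\<lambda>i. {a i<..<b i}) {..<n}"
    have "a i \<le> b i \<and> {a i..b i} \<subseteq> {c..d}" if "i < n" for i
      using *(1) that \<open>y \<le> d\<close> by (meson atLeastatMost_subset_iff order_trans)
    then show "(\<Sum>i<n. \<bar>f (b i) - f (a i)\<bar>) \<le> B"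
      using bd *(2) by blast
  qed
  have T: "T x + \<bar>f y - f x\<bar> \<le> T y" if xy: "c \<le> x" "x \<le> y" "y \<le> d" for x y
  proof -
    have "s + \<bar>f y - f x\<bar> \<le> T y" if s: "s \<in> Vs x" for s
    proof -
      obtain n :: nat and a b where s: "s = (\<Sum>i<n. \<bar>f (b i) - f (a i)\<bar>)"
          "\<And>i. i < n \<Longrightarrow> a i \<le> b i \<and> {a i..b i} \<subseteq> {c..x}"
          "disjoint_family_on (\<lambda>i. {a i<..<b i}) {..<n}"
        using s unfolding Vs_def by blast
      have bx: "b i \<le> x" if "i < n" for i
        using s(2)[OF that] by auto
      have "s + \<bar>f y - f x\<bar> = (\<Sum>i<Suc n. \<bar>f ((b(n := y)) i) - f ((a(n := x)) i)\<bar>)"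
        by (simp add: s(1))
      moreover have "(a(n := x)) i \<le> (b(n := y)) i \<and> {(a(n := x)) i..(b(n := y)) i} \<subseteq> {c..y}" if "i < Suc n" for i
        using s(2)[of i] that xy by (auto simp: less_Suc_eq split: if_splits)
      moreover have "disjoint_family_on (\<lambda>i. {(a(n := x)) i<..<(b(n := y)) i}) {..<Suc n}"
        unfolding disjoint_family_on_def
      proof (intro ballI impI)
        fix i j assume ij: "i \<in> {..<Suc n}" "j \<in> {..<Suc n}" "i \<noteq> j"
        then consider "i < n" "j < n" | "i < n" "j = n" | "i = n" "j < n" by fastforce
        then show "{(a(n := x)) i<..<(b(n := y)) i} \<inter> {(a(n := x)) j<..<(b(n := y)) j} = {}"
        proof cases
          case 1
          then show ?thesis using s(3) ij unfolding disjoint_family_on_def by simp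
        next
          case 2
          then show ?thesis using bx[of i] by auto
        next
          case 3
          then show ?thesis using bx[of j] by auto
        qed
      qed
      ultimately have "s + \<bar>f y - f x\<bar> \<in> Vs y"
        unfolding Vs_def by blast
      then show ?thesis
        unfolding T_def using bdd[OF xy(3)] by (rule cSup_upper)
    qed
    then have "Sup (Vs x) \<le> T y - \<bar>f y - f x\<bar>"
      using ne[of x] by (intro cSup_least) (auto simp: le_diff_eq)
    then show ?thesis by (simp add: T_def le_diff_eq)
  qed
  \<comment> \<open>Clamping to [c, d] extends \<open>T\<close> and \<open>f\<close> to the whole
    line, where the theorem on monotone functions lives, without changing them on the
    interval.\<close>
  define cl where "cl x = max c (min d x)" for x
  have cl: "c \<le> cl x" "cl x \<le> d" "x \<le> y \<Longrightarrow> cl x \<le> cl y" for x y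
    using cd by (auto simp: cl_def)
  have "mono (\<lambda>x. T (cl x))" "mono (\<lambda>x. T (cl x) - f (cl x))"
    using T[OF cl(1) cl(3) cl(2)] by (fastforce simp: mono_def)+
  then have "negligible ({x. \<not> (\<lambda>x. T (cl x)) differentiable (at x)} \<union> {x. \<not> (\<lambda>x. T (cl x) - f (cl x)) differentiable (at x)})"
    by (intro negligible_Un negligible_not_differentiable_mono)
  then show ?thesis
  proof (rule negligible_subset, safe)
    fix x assume x: "x \<in> {c<..<d}" "(\<lambda>x. T (cl x)) differentiable (at x)" "(\<lambda>x. T (cl x) - f (cl x)) differentiable (at x)"
      "\<not> f differentiable (at x)"
    have "(\<lambda>x. T (cl x) - (T (cl x) - f (cl x))) differentiable (at x)"
      using x(2,3) by (rule differentiable_diff)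
    then obtain D where "((\<lambda>x. T (cl x) - (T (cl x) - f (cl x))) has_derivative D) (at x)"
      unfolding differentiable_def by blast
    then have "(f has_derivative D) (at x)"
      by (rule has_derivative_transform_within_open[of _ _ _ _ "{c<..<d}"]) (use x in \<open>auto simp: cl_def\<close>)
    then have "f differentiable (at x)"
      unfolding differentiable_def by blast
    with x show False by simp
  qed
qed auto

text \<open>Absolute continuity for \<epsilon> = 1 bounds the variation by 1 on every interval
  shorter than \<delta>. Countably many such intervals with rational endpoints cover the
  interior.\<close>

lemma negligible_not_differentiable_abs_cont:
  fixes f :: "real \<Rightarrow> real"
  assumes f: "abs_cont_on {a..b} f"
  shows "negligible {x \<in> {a<..<b}. \<not> f differentiable (at x)}"
proof -
  obtain \<delta> where \<delta>: "\<delta> > 0" "\<And>(n::nat) s t. (\<forall>i<n. s i \<le> t i \<and> {s i..t i} \<subseteq> {a..b}) \<Longrightarrow>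
        disjoint_family_on (\<lambda>i. {s i<..<t i}) {..<n} \<Longrightarrow> (\<Sum>i<n. t i - s i) < \<delta> \<Longrightarrow>
        (\<Sum>i<n. \<bar>f (t i) - f (s i)\<bar>) < 1"
    using f[unfolded abs_cont_on_def, rule_format, of 1] by auto
  let ?I = "{(c, d). c \<in> \<rat> \<and> d \<in> \<rat> \<and> a \<le> c \<and> c < d \<and> d \<le> b \<and> d - c < \<delta>}"
  have short: "negligible {x \<in> {c<..<d}. \<not> f differentiable (at x)}" if "(c, d) \<in> ?I" for c d
  proof (rule negligible_not_differentiable_short[where B = 1])
    fix n :: nat and s t :: "nat \<Rightarrow> real"
    assume *: "\<And>i. i < n \<Longrightarrow> s i \<le> t i \<and> {s i..t i} \<subseteq> {c..d}" "disjoint_family_on (\<lambda>i. {s i<..<t i}) {..<n}"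
    have "ennreal (\<Sum>i<n. t i - s i) \<le> emeasure lebesgue {c..d}"
      using * by (intro sum_disjoint_intervals_le) force+
    also have "\<dots> = ennreal (d - c)" using that by auto
    finally have "(\<Sum>i<n. t i - s i) < \<delta>" using that by (auto simp: ennreal_le_iff)
    moreover have "\<forall>i<n. s i \<le> t i \<and> {s i..t i} \<subseteq> {a..b}"
      using * that by (force simp: subset_iff)
    ultimately show "(\<Sum>i<n. \<bar>f (t i) - f (s i)\<bar>) \<le> 1"
      using \<delta>(2)[OF _ *(2)] by fastforce
  qed
  have "countable ?I"
    by (rule countable_subset[of _ "\<rat> \<times> \<rat>"]) (auto intro: countable_rat)
  then have "negligible (\<Union>p\<in>?I. {x \<in> {fst p<..<snd p}. \<not> f differentiable (at x)})"
    using short by (intro negligible_countable_Union countable_image) auto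
  then show ?thesis
  proof (rule negligible_subset, safe)
    fix x assume x: "x \<in> {a<..<b}" "\<not> f differentiable (at x)"
    obtain c where c: "c \<in> \<rat>" "max a (x - \<delta> / 2) < c" "c < x"
      using Rats_dense_in_real[of "max a (x - \<delta> / 2)" x] x \<delta>(1) by auto
    obtain d where d: "d \<in> \<rat>" "x < d" "d < min b (x + \<delta> / 2)"
      using Rats_dense_in_real[of x "min b (x + \<delta> / 2)"] x \<delta>(1) by auto
    show "x \<in> (\<Union>p\<in>?I. {x \<in> {fst p<..<snd p}. \<not> f differentiable (at x)})"
      using c d x by (intro UN_I[of "(c, d)"]) (auto simp: field_simps)
  qed
qed


section \<open>Uniform continuity, the Lipschitz criterion and products\<close>

lemma abs_cont_on_imp_uniformly_continuous_on:
  assumes f: "abs_cont_on S f" and S: "is_interval S"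
  shows "uniformly_continuous_on S f"
  unfolding uniformly_continuous_on_def
proof (intro allI impI)
  fix e :: real assume "e > 0"
  obtain \<delta> where \<delta>: "\<delta> > 0"
    "\<And>(n::nat) a b. (\<And>i. i < n \<Longrightarrow> a i \<le> b i \<and> {a i..b i} \<subseteq> S) \<Longrightarrow>
        disjoint_family_on (\<lambda>i. {a i<..<b i}) {..<n} \<Longrightarrow> (\<Sum>i<n. b i - a i) < \<delta> \<Longrightarrow>
        (\<Sum>i<n. \<bar>f (b i) - f (a i)\<bar>) < e"
    using abs_cont_onD[OF f \<open>e > 0\<close>] by blast
  have *: "\<bar>f y - f x\<bar> < e" if "x \<in> S" "y \<in> S" "x \<le> y" "y - x < \<delta>" for x y
  proof -
    have "{x..y} \<subseteq> S"
      using that S unfolding is_interval_1 by (meson atLeastAtMost_iff subsetI)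
    moreover have "disjoint_family_on (\<lambda>_. {x<..<y}) {..<1::nat}"
      unfolding disjoint_family_on_def by simp
    ultimately have "(\<Sum>i<1::nat. \<bar>f y - f x\<bar>) < e"
      using that by (intro \<delta>(2)[of 1 "\<lambda>_. x" "\<lambda>_. y"]) auto
    then show ?thesis by simp
  qed
  show "\<exists>d>0. \<forall>x\<in>S. \<forall>x'\<in>S. dist x' x < d \<longrightarrow> dist (f x') (f x) < e"
  proof (intro exI[of _ \<delta>] conjI \<delta>(1) ballI impI)
    fix x x' assume "x \<in> S" "x' \<in> S" "dist x' x < \<delta>"
    then show "dist (f x') (f x) < e"
      using *[of x x'] *[of x' x] by (cases "x \<le> x'") (auto simp: dist_real_def abs_minus_commute)
  qed
qed

lemma lipschitz_imp_abs_cont_on: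
  assumes "\<And>x y. x \<in> S \<Longrightarrow> y \<in> S \<Longrightarrow> \<bar>f y - f x\<bar> \<le> L * \<bar>y - x\<bar>"
  shows "abs_cont_on S f"
  unfolding abs_cont_on_def
proof (intro allI impI)
  fix \<epsilon> :: real assume "\<epsilon> > 0"
  show "\<exists>\<delta>>0. \<forall>(n::nat) a b. (\<forall>i<n. a i \<le> b i \<and> {a i..b i} \<subseteq> S) \<longrightarrow>
        disjoint_family_on (\<lambda>i. {a i<..<b i}) {..<n} \<longrightarrow> (\<Sum>i<n. b i - a i) < \<delta> \<longrightarrow>
        (\<Sum>i<n. \<bar>f (b i) - f (a i)\<bar>) < \<epsilon>"
  proof (intro exI[of _ "\<epsilon> / (\<bar>L\<bar> + 1)"] conjI allI impI)
    fix n :: nat and a b :: "nat \<Rightarrow> real"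
    assume ab: "\<forall>i<n. a i \<le> b i \<and> {a i..b i} \<subseteq> S" and lt: "(\<Sum>i<n. b i - a i) < \<epsilon> / (\<bar>L\<bar> + 1)"
    have "(\<Sum>i<n. \<bar>f (b i) - f (a i)\<bar>) \<le> (\<Sum>i<n. (\<bar>L\<bar> + 1) * (b i - a i))"
    proof (rule sum_mono)
      fix i assume "i \<in> {..<n}"
      then have i: "a i \<le> b i" "a i \<in> S" "b i \<in> S" using ab by force+
      have "\<bar>f (b i) - f (a i)\<bar> \<le> L * \<bar>b i - a i\<bar>" using assms i by blast
      also have "\<dots> \<le> (\<bar>L\<bar> + 1) * \<bar>b i - a i\<bar>" by (intro mult_right_mono) auto
      finally show "\<bar>f (b i) - f (a i)\<bar> \<le> (\<bar>L\<bar> + 1) * (b i - a i)" using i by simp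
    qed
    also have "\<dots> < \<epsilon>"
      using lt unfolding sum_distrib_left[symmetric]
      by (simp add: pos_less_divide_eq add_nonneg_pos mult.commute)
    finally show "(\<Sum>i<n. \<bar>f (b i) - f (a i)\<bar>) < \<epsilon>" .
  qed (use \<open>\<epsilon> > 0\<close> in \<open>auto intro!: divide_pos_pos add_nonneg_pos\<close>)
qed

text \<open>The increment of the product splits into g(b) (h(b) - h(a)) and (g(b) - g(a)) h(a), and
  each part receives half of \<epsilon>. The Lipschitz factor will be a smooth branch of the
  kernel.\<close>

lemma abs_cont_on_mult:
  assumes g: "\<And>x y. x \<in> S \<Longrightarrow> y \<in> S \<Longrightarrow> \<bar>g y - g x\<bar> \<le> L * \<bar>y - x\<bar>" and L: "L \<ge> 0"
    and gB: "\<And>x. x \<in> S \<Longrightarrow> \<bar>g x\<bar> \<le> B" and hB: "\<And>x. x \<in> S \<Longrightarrow> \<bar>h x\<bar> \<le> B" and B: "B > 0"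
    and h: "abs_cont_on S h"
  shows "abs_cont_on S (\<lambda>x. g x * h x)"
  unfolding abs_cont_on_def
proof (intro allI impI)
  fix \<epsilon> :: real assume "\<epsilon> > 0"
  have "\<epsilon> / (2 * B) > 0" using \<open>\<epsilon> > 0\<close> B by simp
  then obtain \<delta> where \<delta>: "\<delta> > 0"
    "\<And>(n::nat) a b. (\<And>i. i < n \<Longrightarrow> a i \<le> b i \<and> {a i..b i} \<subseteq> S) \<Longrightarrow>
        disjoint_family_on (\<lambda>i. {a i<..<b i}) {..<n} \<Longrightarrow> (\<Sum>i<n. b i - a i) < \<delta> \<Longrightarrow>
        (\<Sum>i<n. \<bar>h (b i) - h (a i)\<bar>) < \<epsilon> / (2 * B)"
    using abs_cont_onD[OF h] by blast
  have pos: "0 < 2 * B * (L + 1)" using B L by simp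
  show "\<exists>\<delta>>0. \<forall>(n::nat) a b. (\<forall>i<n. a i \<le> b i \<and> {a i..b i} \<subseteq> S) \<longrightarrow>
        disjoint_family_on (\<lambda>i. {a i<..<b i}) {..<n} \<longrightarrow> (\<Sum>i<n. b i - a i) < \<delta> \<longrightarrow>
        (\<Sum>i<n. \<bar>g (b i) * h (b i) - g (a i) * h (a i)\<bar>) < \<epsilon>"
  proof (intro exI[of _ "min \<delta> (\<epsilon> / (2 * B * (L + 1)))"] conjI allI impI)
    fix n :: nat and a b :: "nat \<Rightarrow> real"
    assume ab: "\<forall>i<n. a i \<le> b i \<and> {a i..b i} \<subseteq> S" and dj: "disjoint_family_on (\<lambda>i. {a i<..<b i}) {..<n}"
      and lt: "(\<Sum>i<n. b i - a i) < min \<delta> (\<epsilon> / (2 * B * (L + 1)))"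
    have "(\<Sum>i<n. \<bar>g (b i) * h (b i) - g (a i) * h (a i)\<bar>) \<le> (\<Sum>i<n. B * \<bar>h (b i) - h (a i)\<bar> + B * (L + 1) * (b i - a i))"
    proof (rule sum_mono)
      fix i assume "i \<in> {..<n}"
      then have i: "a i \<le> b i" "a i \<in> S" "b i \<in> S" using ab by force+
      have "g (b i) * h (b i) - g (a i) * h (a i) = g (b i) * (h (b i) - h (a i)) + (g (b i) - g (a i)) * h (a i)"
        by (simp add: algebra_simps)
      then have "\<bar>g (b i) * h (b i) - g (a i) * h (a i)\<bar> \<le> \<bar>g (b i)\<bar> * \<bar>h (b i) - h (a i)\<bar> + \<bar>g (b i) - g (a i)\<bar> * \<bar>h (a i)\<bar>"
        by (metis abs_mult abs_triangle_ineq)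
      also have "\<dots> \<le> B * \<bar>h (b i) - h (a i)\<bar> + (L * \<bar>b i - a i\<bar>) * B"
        using i gB hB g[OF i(2,3)] B L by (intro add_mono mult_mono) auto
      also have "\<dots> \<le> B * \<bar>h (b i) - h (a i)\<bar> + B * (L + 1) * (b i - a i)"
        using i B L by (simp add: algebra_simps)
      finally show "\<bar>g (b i) * h (b i) - g (a i) * h (a i)\<bar> \<le> B * \<bar>h (b i) - h (a i)\<bar> + B * (L + 1) * (b i - a i)" .
    qed
    also have "\<dots> = B * (\<Sum>i<n. \<bar>h (b i) - h (a i)\<bar>) + B * (L + 1) * (\<Sum>i<n. b i - a i)"
      by (simp add: sum.distrib sum_distrib_left)
    also have "\<dots> < B * (\<epsilon> / (2 * B)) + B * (L + 1) * (\<epsilon> / (2 * B * (L + 1)))"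
    proof (intro add_strict_mono mult_strict_left_mono)
      show "(\<Sum>i<n. \<bar>h (b i) - h (a i)\<bar>) < \<epsilon> / (2 * B)"
        using \<delta>(2)[OF _ dj] ab lt by auto
    qed (use B L lt in auto)
    also have "\<dots> = \<epsilon>"
    proof -
      have "B * (\<epsilon> / (2 * B)) + B * C * (\<epsilon> / (2 * B * C)) = \<epsilon>" if "C > 0" for C
        using B that by (simp add: field_simps)
      then show ?thesis using L by simp
    qed
    finally show "(\<Sum>i<n. \<bar>g (b i) * h (b i) - g (a i) * h (a i)\<bar>) < \<epsilon>" .
  qed (use \<delta>(1) \<open>\<epsilon> > 0\<close> pos in auto)
qed

text \<open>Part of a tagged division, enumerated by natural numbers, is a disjoint family as in the
  definition of absolute continuity. It will be the part with tags in a null set.\<close>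

lemma abs_cont_on_division_sum_less:
  fixes f :: "real \<Rightarrow> real"
  assumes D: "D tagged_division_of {a..b}" and P: "P \<subseteq> D" and A: "A \<in> sets lebesgue"
    and sub: "\<And>x K. (x, K) \<in> P \<Longrightarrow> K \<subseteq> A" and meas: "emeasure lebesgue A < ennreal \<delta>"
    and \<delta>: "\<delta> > 0"
    "\<And>(n::nat) s t. (\<And>i. i < n \<Longrightarrow> s i \<le> t i \<and> {s i..t i} \<subseteq> {a..b}) \<Longrightarrow>
        disjoint_family_on (\<lambda>i. {s i<..<t i}) {..<n} \<Longrightarrow> (\<Sum>i<n. t i - s i) < \<delta> \<Longrightarrow>
        (\<Sum>i<n. \<bar>f (t i) - f (s i)\<bar>) < \<epsilon>"
  shows "(\<Sum>(x, K)\<in>P. \<bar>f (Sup K) - f (Inf K)\<bar>) < \<epsilon>"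
proof -
  have fin: "finite P" using D P finite_subset by blast
  then obtain h where h: "bij_betw h {0..<card P} P" using ex_bij_betw_nat_finite by blast
  define n where "n = card P"
  define s where "s i = Inf (snd (h i))" for i
  define t where "t i = Sup (snd (h i))" for i
  have hP: "h i \<in> P" if "i < n" for i using h that by (auto simp: bij_betw_def n_def)
  have st: "snd (h i) = {s i..t i}" "s i \<le> t i" "{s i..t i} \<subseteq> {a..b}" if "i < n" for i
  proof -
    obtain x K where xK: "h i = (x, K)" by fastforce
    then have "(x, K) \<in> D" using hP[OF that] P by auto
    then obtain c d where K: "K = {c..d}" "x \<in> K" "K \<subseteq> {a..b}"
      using tagged_division_ofD(2-4)[OF D] by (metis box_real(2))
    then show "snd (h i) = {s i..t i}" "s i \<le> t i" "{s i..t i} \<subseteq> {a..b}"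
      by (auto simp: s_def t_def xK)
  qed
  have dj: "disjoint_family_on (\<lambda>i. {s i<..<t i}) {..<n}"
    unfolding disjoint_family_on_def
  proof (intro ballI impI)
    fix i j assume ij: "i \<in> {..<n}" "j \<in> {..<n}" "i \<noteq> j"
    then have "h i \<noteq> h j" using h by (auto simp: bij_betw_def inj_on_def n_def)
    moreover have "h i \<in> D" "h j \<in> D" using hP ij P by auto
    ultimately have "interior (snd (h i)) \<inter> interior (snd (h j)) = {}"
      using tagged_division_ofD(5)[OF D] by (metis prod.collapse)
    then show "{s i<..<t i} \<inter> {s j<..<t j} = {}"
      using st ij by simp
  qed
  have "{s i<..<t i} \<subseteq> A" if "i < n" for i
  proof -
    have "(fst (h i), snd (h i)) \<in> P" using hP[OF that] by simp
    from sub[OF this] show ?thesis unfolding st(1)[OF that] by (force simp: subset_iff)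
  qed
  then have "ennreal (\<Sum>i<n. t i - s i) \<le> emeasure lebesgue A"
    using st(2) dj A by (intro sum_disjoint_intervals_le) auto
  then have "ennreal (\<Sum>i<n. t i - s i) < ennreal \<delta>" using meas by simp
  then have "(\<Sum>i<n. t i - s i) < \<delta>"
    using st(2) by (subst (asm) ennreal_less_iff) (auto intro!: sum_nonneg)
  then have "(\<Sum>i<n. \<bar>f (t i) - f (s i)\<bar>) < \<epsilon>"
    using \<delta>(2) st(2,3) dj by blast
  also have "(\<Sum>i<n. \<bar>f (t i) - f (s i)\<bar>) = (\<Sum>i\<in>{0..<card P}. (\<lambda>(x, K). \<bar>f (Sup K) - f (Inf K)\<bar>) (h i))"
    by (intro sum.cong) (auto simp: n_def s_def t_def split: prod.splits)
  also have "\<dots> = (\<Sum>(x, K)\<in>P. \<bar>f (Sup K) - f (Inf K)\<bar>)"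
    by (rule sum.reindex_bij_betw[OF h])
  finally show ?thesis .
qed

text \<open>Direct estimate of Henstock-Kurzweil sums. At tags in the null set \<open>N\<close> the
  gauge stays inside an open set of measure below \<delta>, where absolute continuity makes the
  increments small and the integrand is set to 0. At the other tags the increment is linear up to e'
  times the length of the interval.\<close>

theorem fundamental_theorem_of_calculus_abs_cont:
  fixes f :: "real \<Rightarrow> real"
  assumes f: "abs_cont_on {a..b} f" and ab: "a \<le> b"
  shows "((\<lambda>x. vector_derivative f (at x)) has_integral (f b - f a)) {a..b}"
proof -
  define N where "N = {x \<in> {a<..<b}. \<not> f differentiable (at x)} \<union> {a, b}"
  have N: "negligible N"
    unfolding N_def using negligible_not_differentiable_abs_cont[OF f] by (auto intro: negligible_Un)
  define g where "g x = (if x \<in> N then 0 else vector_derivative f (at x))" for x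
  have "(g has_integral (f b - f a)) (cbox a b)"
    unfolding has_integral
  proof (intro allI impI)
    fix e :: real assume e: "e > 0"
    obtain \<delta> where \<delta>: "\<delta> > 0"
      "\<And>(n::nat) s t. (\<And>i. i < n \<Longrightarrow> s i \<le> t i \<and> {s i..t i} \<subseteq> {a..b}) \<Longrightarrow>
        disjoint_family_on (\<lambda>i. {s i<..<t i}) {..<n} \<Longrightarrow> (\<Sum>i<n. t i - s i) < \<delta> \<Longrightarrow>
        (\<Sum>i<n. \<bar>f (t i) - f (s i)\<bar>) < e / 2"
      using abs_cont_onD[OF f, of "e / 2"] e by auto
    obtain W where W: "open W" "N \<subseteq> W" "W - N \<in> lmeasurable" "emeasure lebesgue (W - N) < ennreal \<delta>"
      using sets_lebesgue_outer_open[OF negligible_imp_sets[OF N] \<delta>(1)] by blast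
    have "emeasure lebesgue W = emeasure lebesgue ((W - N) \<union> N)" using W by (simp add: Un_absorb2)
    also have "\<dots> = emeasure lebesgue (W - N)"
      using W N by (intro emeasure_Un_null_set) (auto simp: negligible_iff_null_sets)
    finally have Wm: "emeasure lebesgue W < ennreal \<delta>" using W(4) by simp
    \<comment> \<open>The summand 1 keeps the denominator positive when
      \<open>a = b\<close>.\<close>
    define e' where "e' = e / (2 * (b - a + 1))"
    have e': "e' > 0" "e' * (b - a) < e / 2" using e ab by (auto simp: e'_def field_simps)
    have "\<exists>d>0. \<forall>y. \<bar>y - x\<bar> < d \<longrightarrow> \<bar>f y - f x - (y - x) * g x\<bar> \<le> e' * \<bar>y - x\<bar>" if "x \<in> {a..b} - N" for x
    proof -
      have "f differentiable (at x)" using that by (auto simp: N_def)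
      then have "(f has_vector_derivative g x) (at x)"
        using that by (simp add: g_def vector_derivative_works)
      then show ?thesis
        using e'(1) unfolding has_vector_derivative_def has_derivative_within_alt by auto
    qed
    then obtain d where d: "\<And>x. x \<in> {a..b} - N \<Longrightarrow> d x > 0"
      "\<And>x y. x \<in> {a..b} - N \<Longrightarrow> \<bar>y - x\<bar> < d x \<Longrightarrow> \<bar>f y - f x - (y - x) * g x\<bar> \<le> e' * \<bar>y - x\<bar>"
      by metis
    \<comment> \<open>Tags in \<open>N\<close> are confined to \<open>W\<close>, so that the
      intervals they carry have small total length.\<close>
    define \<gamma> where "\<gamma> x = (if x \<in> N then W else if x \<in> {a..b} then ball x (d x) else ball x 1)" for x
    have "gauge \<gamma>"
      unfolding gauge_def \<gamma>_def using W d(1) by auto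
    moreover have "norm ((\<Sum>(x, K)\<in>D. measure lborel K *\<^sub>R g x) - (f b - f a)) < e"
      if D: "D tagged_division_of (cbox a b)" "\<gamma> fine D" for D
    proof -
      have D': "D tagged_division_of {a..b}" using D by simp
      have fin: "finite D" using D by blast
      have tele: "(\<Sum>(x, K)\<in>D. f (Sup K) - f (Inf K)) = f b - f a"
        by (rule additive_tagged_division_1[OF ab D'])
      let ?B = "{(x, K) \<in> D. x \<in> N}" and ?G = "{(x, K) \<in> D. x \<notin> N}"
      let ?h = "\<lambda>(x, K). measure lborel K *\<^sub>R g x - (f (Sup K) - f (Inf K))"
      have "(\<Sum>(x, K)\<in>D. measure lborel K *\<^sub>R g x) - (f b - f a) = sum ?h D"
        unfolding tele[symmetric] by (simp add: sum_subtractf[symmetric] case_prod_unfold)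
      also have "\<dots> = sum ?h (?B \<union> ?G)" by (intro sum.cong) auto
      also have "\<dots> = sum ?h ?B + sum ?h ?G"
        using fin by (intro sum.union_disjoint) (auto intro: finite_subset[OF _ fin])
      finally have split: "(\<Sum>(x, K)\<in>D. measure lborel K *\<^sub>R g x) - (f b - f a) = sum ?h ?B + sum ?h ?G" .
      have "\<bar>sum ?h ?B\<bar> \<le> (\<Sum>(x, K)\<in>?B. \<bar>f (Sup K) - f (Inf K)\<bar>)"
        by (rule order_trans[OF sum_abs], rule sum_mono) (auto simp: g_def)
      also have "\<dots> < e / 2"
      proof (rule abs_cont_on_division_sum_less[OF D' _ _ _ Wm \<delta>])
        fix x K assume "(x, K) \<in> ?B"
        then have "K \<subseteq> \<gamma> x" "x \<in> N" using D(2) unfolding fine_def by auto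
        then show "K \<subseteq> W" by (simp add: \<gamma>_def)
      qed (use W(1) in \<open>auto intro: borel_open\<close>)
      finally have 1: "\<bar>sum ?h ?B\<bar> < e / 2" .
      have "\<bar>sum ?h ?G\<bar> \<le> (\<Sum>(x, K)\<in>?G. e' * measure lborel K)"
      proof (rule order_trans[OF sum_abs], rule sum_mono, clarify)
        fix x K assume xK: "(x, K) \<in> D" "x \<notin> N"
        then obtain u v where K: "K = {u..v}" "x \<in> K" "K \<subseteq> {a..b}"
          using tagged_division_ofD(2-4)[OF D'] by (metis box_real(2))
        have "K \<subseteq> \<gamma> x" using D(2) xK unfolding fine_def by auto
        then have "K \<subseteq> ball x (d x)" using xK K by (auto simp: \<gamma>_def)
        moreover have "u \<in> K" "v \<in> K" using K by auto
        ultimately have "u \<in> ball x (d x)" "v \<in> ball x (d x)" by blast+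
        then have "\<bar>u - x\<bar> < d x" "\<bar>v - x\<bar> < d x" by (auto simp: dist_real_def)
        then have "\<bar>f u - f x - (u - x) * g x\<bar> \<le> e' * \<bar>u - x\<bar>" "\<bar>f v - f x - (v - x) * g x\<bar> \<le> e' * \<bar>v - x\<bar>"
          using d(2)[of x u] d(2)[of x v] xK K by blast+
        moreover have "measure lborel K *\<^sub>R g x - (f (Sup K) - f (Inf K)) =
             (f u - f x - (u - x) * g x) - (f v - f x - (v - x) * g x)"
          using K by (simp add: algebra_simps)
        moreover have "e' * \<bar>u - x\<bar> + e' * \<bar>v - x\<bar> = e' * measure lborel K"
          using K by (simp add: algebra_simps)
        ultimately show "\<bar>measure lborel K *\<^sub>R g x - (f (Sup K) - f (Inf K))\<bar> \<le> e' * measure lborel K"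
          by linarith
      qed
      also have "\<dots> \<le> (\<Sum>(x, K)\<in>D. e' * measure lborel K)"
        using fin e'(1) by (intro sum_mono2) (auto intro!: mult_nonneg_nonneg)
      also have "\<dots> = e' * (b - a)"
        using additive_content_tagged_division[OF D(1)] ab by (simp add: sum_distrib_left[symmetric] case_prod_unfold)
      finally have "\<bar>sum ?h ?G\<bar> < e / 2" using e'(2) by simp
      then show ?thesis using 1 split by simp
    qed
    ultimately show "\<exists>\<gamma>. gauge \<gamma> \<and> (\<forall>D. D tagged_division_of cbox a b \<and> \<gamma> fine D \<longrightarrow>
        norm ((\<Sum>(x, K)\<in>D. measure lborel K *\<^sub>R g x) - (f b - f a)) < e)"
      by (intro exI[of _ \<gamma>]) simp
  qed
  then have "(g has_integral (f b - f a)) {a..b}" by simp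
  then show ?thesis
    by (rule has_integral_spike[OF N, rotated]) (auto simp: g_def)
qed


lemma abs_cont_on_imp_continuous_on: "abs_cont_on {a..b} f \<Longrightarrow> continuous_on {a..b} f"
  by (rule uniformly_continuous_imp_continuous[OF abs_cont_on_imp_uniformly_continuous_on])
     (simp_all add: is_interval_cc)

lemma continuous_on_Icc_bounded:
  fixes f :: "real \<Rightarrow> real"
  assumes "continuous_on {a..b} f"
  obtains B where "B > 0" "\<And>x. x \<in> {a..b} \<Longrightarrow> \<bar>f x\<bar> \<le> B"
proof -
  have "bounded (f ` {a..b})"
    using assms by (intro compact_imp_bounded compact_continuous_image) auto
  then show thesis
    using that unfolding bounded_pos by auto
qed

lemma abs_cont_on_integration_by_parts:
  fixes g h :: "real \<Rightarrow> real"
  assumes h: "abs_cont_on {a..b} h" and ab: "a \<le> b"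
    and g: "\<And>x. x \<in> {a..b} \<Longrightarrow> (g has_real_derivative g' x) (at x within {a..b})"
    and g': "continuous_on {a..b} g'"
  shows "((\<lambda>x. g x * vector_derivative h (at x) + g' x * h x) has_integral g b * h b - g a * h a) {a..b}"
proof -
  have "continuous_on {a..b} g"
    using g DERIV_continuous continuous_on_eq_continuous_within by blast
  then obtain Bg where Bg: "Bg > 0" "\<And>x. x \<in> {a..b} \<Longrightarrow> \<bar>g x\<bar> \<le> Bg"
    using continuous_on_Icc_bounded by blast
  obtain Bh where Bh: "Bh > 0" "\<And>x. x \<in> {a..b} \<Longrightarrow> \<bar>h x\<bar> \<le> Bh"
    using continuous_on_Icc_bounded[OF abs_cont_on_imp_continuous_on[OF h]] by blast
  obtain L where L: "L > 0" "\<And>x. x \<in> {a..b} \<Longrightarrow> \<bar>g' x\<bar> \<le> L"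
    using continuous_on_Icc_bounded[OF g'] by blast
  have lip: "\<bar>g y - g x\<bar> \<le> L * \<bar>y - x\<bar>" if "x \<in> {a..b}" "y \<in> {a..b}" for x y
    using field_differentiable_bound[of "{a..b}" g g' L y x] g L(2) that by simp
  have "abs_cont_on {a..b} (\<lambda>x. g x * h x)"
    using Bg(1) Bh(1) L(1)
    by (intro abs_cont_on_mult[OF lip, of _ "max Bg Bh"] h)
       (auto simp: max.coboundedI1[OF Bg(2)] max.coboundedI2[OF Bh(2)])
  then have ftc: "((\<lambda>x. vector_derivative (\<lambda>x. g x * h x) (at x)) has_integral (g b * h b - g a * h a)) {a..b}"
    using ab by (rule fundamental_theorem_of_calculus_abs_cont)
  have N: "negligible ({x \<in> {a<..<b}. \<not> h differentiable (at x)} \<union> {a, b})"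
    using negligible_not_differentiable_abs_cont[OF h] by (auto intro: negligible_Un)
  show ?thesis
  proof (rule has_integral_spike[OF N _ ftc])
    fix x assume x: "x \<in> {a..b} - ({x \<in> {a<..<b}. \<not> h differentiable (at x)} \<union> {a, b})"
    then have x': "x \<in> {a<..<b}" "h differentiable (at x)" by auto
    have "(g has_real_derivative g' x) (at x)"
      using g[of x] x' at_within_interior[of x "{a..b}"] by simp
    moreover have "(h has_real_derivative vector_derivative h (at x)) (at x)"
      using x'(2) by (simp add: vector_derivative_works has_real_derivative_iff_has_vector_derivative)
    ultimately have "((\<lambda>x. g x * h x) has_real_derivative g x * vector_derivative h (at x) + g' x * h x) (at x)"
      by (auto intro!: derivative_eq_intros)
    then show "g x * vector_derivative h (at x) + g' x * h x = vector_derivative (\<lambda>x. g x * h x) (at x)"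
      by (simp add: has_real_derivative_iff_has_vector_derivative vector_derivative_at)
  qed
qed

section \<open>The space $L_2$ and iterated derivatives\<close>

lemma AE_II_except_finite:
  assumes "finite A" "\<And>x. x \<in> {-1..1} - A \<Longrightarrow> P x"
  shows "AE x in lebesgue_on {-1..1::real}. P x"
proof -
  have "A \<in> null_sets lebesgue"
    using assms(1) by (simp add: finite_imp_null_set_lborel null_sets_completionI)
  then have "AE x in lebesgue. x \<notin> A"
    by (rule AE_not_in)
  then have "AE x in lebesgue. x \<in> {-1..1} \<longrightarrow> P x"
    by (rule AE_mp) (use assms(2) in auto)
  then show ?thesis
    by (subst AE_restrict_space_iff) auto
qed

lemma L2_bounded:
  assumes S: "S \<in> lmeasurable" and f: "f \<in> borel_measurable (lebesgue_on S)" and B: "\<And>x. x \<in> S \<Longrightarrow> \<bar>f x\<bar> \<le> B"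
  shows "f \<in> L2 S"
proof -
  have "integrable (lebesgue_on S) (\<lambda>x. B\<^sup>2)"
    using S by (simp add: finite_measure.integrable_const finite_measure_lebesgue_on)
  then have "integrable (lebesgue_on S) (\<lambda>x. (f x)\<^sup>2)"
  proof (rule Bochner_Integration.integrable_bound)
    show "AE x in lebesgue_on S. norm ((f x)\<^sup>2) \<le> norm (B\<^sup>2)"
    proof (rule AE_I2)
      fix x assume "x \<in> space (lebesgue_on S)"
      then have "\<bar>f x\<bar> \<le> B" using B by auto
      then have "\<bar>f x\<bar>\<^sup>2 \<le> B\<^sup>2" by (intro power_mono) auto
      then show "norm ((f x)\<^sup>2) \<le> norm (B\<^sup>2)" by simp
    qed
  qed (use f in measurable)
  then show ?thesis using f by (simp add: L2_def)
qed

lemma L2_continuous_on: "continuous_on II f \<Longrightarrow> f \<in> L2 II"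
proof -
  assume f: "continuous_on II f"
  obtain B where "\<And>x. x \<in> II \<Longrightarrow> \<bar>f x\<bar> \<le> B"
    using continuous_on_Icc_bounded[OF f] by blast
  with f show ?thesis
    by (intro L2_bounded[of _ _ B] continuous_imp_measurable_on_sets_lebesgue) auto
qed

lemma L2_measurable: "f \<in> L2 S \<Longrightarrow> f \<in> borel_measurable (lebesgue_on S)"
  by (simp add: L2_def)

lemma L2_mult_integrable:
  assumes "f \<in> L2 S" "g \<in> L2 S"
  shows "integrable (lebesgue_on S) (\<lambda>x. f x * g x)"
proof -
  have "integrable (lebesgue_on S) (\<lambda>x. (f x)\<^sup>2 + (g x)\<^sup>2)"
    using assms by (auto simp: L2_def)
  then show ?thesis
  proof (rule Bochner_Integration.integrable_bound)
    show "AE x in lebesgue_on S. norm (f x * g x) \<le> norm ((f x)\<^sup>2 + (g x)\<^sup>2)"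
    proof (rule AE_I2)
      fix x
      have "0 \<le> (\<bar>f x\<bar> - \<bar>g x\<bar>)\<^sup>2" by simp
      then have "2 * (\<bar>f x\<bar> * \<bar>g x\<bar>) \<le> (f x)\<^sup>2 + (g x)\<^sup>2" by (simp add: power2_diff algebra_simps)
      moreover have "\<bar>f x\<bar> * \<bar>g x\<bar> \<le> 2 * (\<bar>f x\<bar> * \<bar>g x\<bar>)" by simp
      ultimately have "\<bar>f x\<bar> * \<bar>g x\<bar> \<le> (f x)\<^sup>2 + (g x)\<^sup>2" by linarith
      then show "norm (f x * g x) \<le> norm ((f x)\<^sup>2 + (g x)\<^sup>2)" by (simp add: abs_mult)
    qed
  qed (use assms in \<open>auto simp: L2_def\<close>)
qed

lemma L2_lincomb:
  assumes "f \<in> L2 S" "g \<in> L2 S"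
  shows "(\<lambda>x. a * f x + b * g x) \<in> L2 S"
proof -
  have "integrable (lebesgue_on S) (\<lambda>x. a\<^sup>2 * (f x)\<^sup>2 + 2 * a * b * (f x * g x) + b\<^sup>2 * (g x)\<^sup>2)"
    using assms L2_mult_integrable[OF assms] by (auto simp: L2_def)
  then show ?thesis
    using assms by (auto simp: L2_def power2_eq_square algebra_simps)
qed

lemma L2_cmult: "f \<in> L2 S \<Longrightarrow> (\<lambda>x. a * f x) \<in> L2 S"
  using L2_lincomb[of f S f a 0] by simp

lemma L2_diff: "f \<in> L2 S \<Longrightarrow> g \<in> L2 S \<Longrightarrow> (\<lambda>x. f x - g x) \<in> L2 S"
  using L2_lincomb[of f S g 1 "-1"] by simp

definition ip :: "(real \<Rightarrow> real) \<Rightarrow> (real \<Rightarrow> real) \<Rightarrow> real" where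
  "ip f g = (LINT x|lebesgue_on II. f x * g x)"

lemma ip_commute: "ip f g = ip g f"
  by (simp add: ip_def mult.commute)

lemma ip_lincomb_right:
  assumes "h \<in> L2 II" "f \<in> L2 II" "g \<in> L2 II"
  shows "ip h (\<lambda>x. a * f x + b * g x) = a * ip h f + b * ip h g"
proof -
  have "ip h (\<lambda>x. a * f x + b * g x) = (LINT x|lebesgue_on II. a * (h x * f x) + b * (h x * g x))"
    by (simp add: ip_def algebra_simps)
  also have "\<dots> = a * ip h f + b * ip h g"
    unfolding ip_def using assms by (subst Bochner_Integration.integral_add) (auto intro!: L2_mult_integrable)
  finally show ?thesis .
qed

lemma ip_diff_right: "h \<in> L2 II \<Longrightarrow> f \<in> L2 II \<Longrightarrow> g \<in> L2 II \<Longrightarrow> ip h (\<lambda>x. f x - g x) = ip h f - ip h g"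
  using ip_lincomb_right[of h f g 1 "-1"] by simp

lemma ip_diff_left: "h \<in> L2 II \<Longrightarrow> f \<in> L2 II \<Longrightarrow> g \<in> L2 II \<Longrightarrow> ip (\<lambda>x. f x - g x) h = ip f h - ip g h"
  using ip_diff_right[of h f g] by (simp add: ip_commute)

lemma ip_cmult_right: "ip h (\<lambda>x. a * f x) = a * ip h f"
  by (simp add: ip_def mult.left_commute[of _ a])

lemma ip_cong_AE:
  assumes "f \<in> L2 II" "f' \<in> L2 II" "g \<in> L2 II" "g' \<in> L2 II"
    "AE x in lebesgue_on II. f x = f' x" "AE x in lebesgue_on II. g x = g' x"
  shows "ip f g = ip f' g'"
  unfolding ip_def
proof (rule integral_cong_AE)
  show "AE x in lebesgue_on II. f x * g x = f' x * g' x"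
    using assms(5,6) by eventually_elim simp
qed (use assms in \<open>auto simp: L2_def\<close>)

lemma norm2_nonneg: "0 \<le> norm2 f"
  by (simp add: norm2_def)

lemma norm2_sq: "(norm2 f)\<^sup>2 = ip f f"
  by (simp add: norm2_def ip_def power2_eq_square)

lemma norm2_cmult: "norm2 (\<lambda>x. c * f x) = \<bar>c\<bar> * norm2 f"
  by (simp add: norm2_def power_mult_distrib real_sqrt_mult)

lemma norm2_zero: "norm2 (\<lambda>x. 0) = 0"
  by (simp add: norm2_def)

lemma norm2_diff_sq:
  assumes "f \<in> L2 II" "g \<in> L2 II"
  shows "(norm2 (\<lambda>x. f x - g x))\<^sup>2 = (norm2 f)\<^sup>2 - 2 * ip f g + (norm2 g)\<^sup>2"
  using assms by (simp add: norm2_sq ip_diff_left ip_diff_right L2_diff ip_commute)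

lemma ip_Cauchy_Schwarz:
  assumes f: "f \<in> L2 II" and g: "g \<in> L2 II"
  shows "\<bar>ip f g\<bar> \<le> norm2 f * norm2 g"
proof -
  have q: "0 \<le> a\<^sup>2 * (norm2 f)\<^sup>2 - 2 * a * b * ip f g + b\<^sup>2 * (norm2 g)\<^sup>2" for a b
  proof -
    have "0 \<le> (norm2 (\<lambda>x. a * f x - b * g x))\<^sup>2" by simp
    also have "\<dots> = a\<^sup>2 * (norm2 f)\<^sup>2 - 2 * a * b * ip f g + b\<^sup>2 * (norm2 g)\<^sup>2"
      using f g by (subst norm2_diff_sq) (auto simp: L2_cmult norm2_cmult power_mult_distrib ip_cmult_right
         ip_commute[of "\<lambda>x. a * f x"] ip_commute[of g f] mult.assoc)
    finally show ?thesis .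
  qed
  have "(ip f g)\<^sup>2 \<le> (norm2 f)\<^sup>2 * (norm2 g)\<^sup>2"
  proof (cases "norm2 g = 0")
    case True
    have "ip f g = 0"
    proof (rule ccontr)
      assume "ip f g \<noteq> 0"
      \<comment> \<open>With \<open>norm2 g = 0\<close> this choice of the second coefficient makes
        the quadratic form equal to -1.\<close>
      then show False
        using q[of 1 "((norm2 f)\<^sup>2 + 1) / (2 * ip f g)"] True by (simp add: field_simps)
    qed
    then show ?thesis by simp
  next
    case False
    have "0 \<le> (norm2 g)\<^sup>2 * ((norm2 f)\<^sup>2 * (norm2 g)\<^sup>2 - (ip f g)\<^sup>2)"
      using q[of "(norm2 g)\<^sup>2" "ip f g"] by (simp add: power2_eq_square algebra_simps)
    then show ?thesis using False by (simp add: zero_le_mult_iff)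
  qed
  then have "\<bar>ip f g\<bar> \<le> \<bar>norm2 f * norm2 g\<bar>"
    by (intro power2_le_iff_abs_le[THEN iffD1]) (auto simp: power_mult_distrib abs_mult)
  then show ?thesis by (simp add: norm2_nonneg)
qed

lemma norm2_triangle_diff:
  assumes f: "f \<in> L2 II" and g: "g \<in> L2 II"
  shows "\<bar>norm2 f - norm2 g\<bar> \<le> norm2 (\<lambda>x. f x - g x)"
proof -
  have "(norm2 f - norm2 g)\<^sup>2 \<le> (norm2 (\<lambda>x. f x - g x))\<^sup>2"
    using ip_Cauchy_Schwarz[OF f g] by (simp add: norm2_diff_sq[OF f g] power2_diff)
  then have "\<bar>norm2 f - norm2 g\<bar> \<le> \<bar>norm2 (\<lambda>x. f x - g x)\<bar>"
    by (simp add: abs_le_square_iff)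
  then show ?thesis by (simp add: norm2_nonneg)
qed

lemma norm2_cong_AE:
  assumes "f \<in> L2 II" "f' \<in> L2 II" "AE x in lebesgue_on II. f x = f' x"
  shows "norm2 f = norm2 f'"
  using ip_cong_AE[OF assms(1,2,1,2,3,3)] norm2_sq[of f] norm2_sq[of f'] norm2_nonneg
  by (metis power2_eq_iff_nonneg)

lemma norm2_bounded:
  assumes f: "f \<in> L2 II" and B: "\<And>x. x \<in> II \<Longrightarrow> \<bar>f x\<bar> \<le> B"
  shows "norm2 f \<le> sqrt 2 * B"
proof -
  have "0 \<le> B" using B[of 0] by auto
  have "(LINT x|lebesgue_on II. (f x)\<^sup>2) \<le> (LINT x|lebesgue_on II. B\<^sup>2)"
  proof (rule integral_mono)
    show "integrable (lebesgue_on II) (\<lambda>x. B\<^sup>2)"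
      by (simp add: finite_measure.integrable_const finite_measure_lebesgue_on)
    fix x assume "x \<in> space (lebesgue_on II)"
    then have "\<bar>f x\<bar>\<^sup>2 \<le> B\<^sup>2" using B by (intro power_mono) auto
    then show "(f x)\<^sup>2 \<le> B\<^sup>2" by simp
  qed (use f in \<open>auto simp: L2_def\<close>)
  also have "\<dots> = 2 * B\<^sup>2" by (simp add: measure_restrict_space)
  finally show ?thesis
    unfolding norm2_def using \<open>0 \<le> B\<close> by (intro real_le_lsqrt) (auto simp: power_mult_distrib)
qed

lemma borel_measurable_lebesgue_on_cong:
  fixes f g :: "real \<Rightarrow> real"
  assumes "\<And>x. x \<in> S \<Longrightarrow> g x = f x" "f \<in> borel_measurable (lebesgue_on S)"
  shows "g \<in> borel_measurable (lebesgue_on S)"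
  using measurable_cong[of "lebesgue_on S" g f borel] assms by auto

lemma borel_measurable_finite_change:
  fixes f g :: "real \<Rightarrow> real"
  assumes f: "f \<in> borel_measurable (lebesgue_on II)" and A: "finite A" and eq: "\<And>x. x \<in> II - A \<Longrightarrow> g x = f x"
  shows "g \<in> borel_measurable (lebesgue_on II)"
proof -
  have "(\<lambda>x. f x + (\<Sum>a\<in>A \<inter> II. (g a - f a) * indicator {a} x)) \<in> borel_measurable (lebesgue_on II)"
    using f by (intro borel_measurable_add borel_measurable_sum borel_measurable_times
        borel_measurable_const borel_measurable_indicator) (auto simp: sets_restrict_space_iff)
  moreover have "g x = f x + (\<Sum>a\<in>A \<inter> II. (g a - f a) * indicator {a} x)" if "x \<in> II" for x
  proof -
    have "(\<Sum>a\<in>A \<inter> II. (g a - f a) * indicator {a} x) = (\<Sum>a\<in>A \<inter> II. if a = x then g a - f a else 0)"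
      by (intro sum.cong) (auto simp: indicator_def)
    then show ?thesis using A eq[of x] that by auto
  qed
  ultimately show "g \<in> borel_measurable (lebesgue_on II)"
    by (rule borel_measurable_lebesgue_on_cong[rotated])
qed

lemma L2_finite_change:
  assumes f: "f \<in> L2 II" and A: "finite A" and eq: "\<And>x. x \<in> II - A \<Longrightarrow> g x = f x"
  shows "g \<in> L2 II"
proof -
  have g: "g \<in> borel_measurable (lebesgue_on II)"
    using L2_measurable[OF f] A eq by (rule borel_measurable_finite_change)
  have "integrable (lebesgue_on II) (\<lambda>x. (g x)\<^sup>2)"
    by (rule integrable_cong_AE_imp[of _ "\<lambda>x. (f x)\<^sup>2"])
       (use f g eq in \<open>auto simp: L2_def intro!: AE_II_except_finite[OF A]\<close>)
  with g show ?thesis by (simp add: L2_def)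
qed

section \<open>Iterated derivatives and functions with two branches\<close>

lemma nderiv_0 [simp]: "nderiv S 0 f = f"
  by (simp add: nderiv_def)

lemma nderiv_Suc: "nderiv S (Suc n) f x = vector_derivative (nderiv S n f) (at x within S)"
  by (simp add: nderiv_def)

text \<open>Iterated derivatives are local on open sets, so the ambient set and the function may be
  changed together. This moves between \<open>II\<close>, \<open>punctured t\<close> and open
  subintervals, and replaces a chosen solution by an explicit one.\<close>

lemma nderiv_open_subset:
  assumes S: "open S'" "S' \<subseteq> S" and eq: "\<And>y. y \<in> S' \<Longrightarrow> f y = g y"
  shows "x \<in> S' \<Longrightarrow> nderiv S' n f x = nderiv S n g x"
proof (induction n arbitrary: x)
  case 0
  then show ?case by (simp add: eq)
next
  case (Suc n)
  have "x \<in> interior S" using Suc.prems S by (meson interior_maximal subsetD)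
  then have "at x within S' = at x" "at x within S = at x"
    using at_within_open[OF Suc.prems S(1)] at_within_interior by simp_all
  moreover have "vector_derivative (nderiv S' n f) (at x) = vector_derivative (nderiv S n g) (at x)"
  proof (rule vector_derivative_cong_eq)
    show "\<forall>\<^sub>F y in nhds x. y \<in> UNIV \<longrightarrow> nderiv S' n f y = nderiv S n g y"
      unfolding eventually_nhds using Suc.IH Suc.prems S(1) by (intro exI[of _ S']) simp
  qed auto
  ultimately show ?case by (simp add: nderiv_Suc)
qed

text \<open>\<open>vector_derivative\<close> is a choice operator; its iterates are evaluated by
  exhibiting all derivatives as one explicit chain and using uniqueness of derivatives at points
  where the filter is nontrivial.\<close>

lemma nderiv_chain:
  assumes S: "\<And>x. x \<in> S \<Longrightarrow> at x within S \<noteq> bot"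
    and F: "\<And>j x. j < m \<Longrightarrow> x \<in> S \<Longrightarrow> (F j has_real_derivative F (Suc j) x) (at x within S)"
    and u: "\<And>x. x \<in> S \<Longrightarrow> u x = F 0 x"
  shows "j \<le> m \<Longrightarrow> x \<in> S \<Longrightarrow> nderiv S j u x = F j x"
proof (induction j arbitrary: x)
  case 0
  then show ?case by (simp add: u)
next
  case (Suc j)
  have "(F j has_vector_derivative F (Suc j) x) (at x within S)"
    using F[of j x] Suc.prems by (simp add: has_real_derivative_iff_has_vector_derivative)
  then have "(nderiv S j u has_vector_derivative F (Suc j) x) (at x within S)"
    by (rule has_vector_derivative_transform[rotated 2]) (use Suc in simp_all)
  then show ?case
    using S Suc.prems by (simp add: nderiv_Suc vector_derivative_within)
qed

lemma abs_cont_on_cong: "(\<And>x. x \<in> S \<Longrightarrow> f x = g x) \<Longrightarrow> abs_cont_on S f \<Longrightarrow> abs_cont_on S g"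
proof -
  assume eq: "\<And>x. x \<in> S \<Longrightarrow> f x = g x" and f: "abs_cont_on S f"
  have "(\<Sum>i<n. \<bar>g (b i) - g (a i)\<bar>) = (\<Sum>i<n. \<bar>f (b i) - f (a i)\<bar>)"
    if "\<forall>i<n. a i \<le> b i \<and> {a i..b i} \<subseteq> S" for n :: nat and a b
    using that by (intro sum.cong) (auto simp: eq[symmetric] subset_iff)
  then show ?thesis
    using f unfolding abs_cont_on_def by (simp cong: imp_cong)
qed

lemma L2m_chain:
  assumes S: "\<And>x. x \<in> S \<Longrightarrow> at x within S \<noteq> bot" "is_interval S" "S \<in> lmeasurable" and m: "m \<ge> 1"
    and F: "\<And>j x. j < m \<Longrightarrow> x \<in> S \<Longrightarrow> (F j has_real_derivative F (Suc j) x) (at x within S)"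
    and u: "\<And>x. x \<in> S \<Longrightarrow> u x = F 0 x"
    and Fm: "continuous_on S (F m)" "\<And>x. x \<in> S \<Longrightarrow> \<bar>F m x\<bar> \<le> B"
  shows "u \<in> L2m m S"
proof -
  have nd: "nderiv S j u x = F j x" if "j \<le> m" "x \<in> S" for j x
    using nderiv_chain[OF S(1) F u] that by blast
  have "nderiv S j u differentiable_on S" if "j < m - 1" for j
    unfolding differentiable_on_def
  proof
    fix x assume "x \<in> S"
    moreover from this have "(F j has_vector_derivative F (Suc j) x) (at x within S)"
      using F[of j x] that by (simp add: has_real_derivative_iff_has_vector_derivative)
    ultimately have "(nderiv S j u has_vector_derivative F (Suc j) x) (at x within S)"
      using that nd by (simp add: has_vector_derivative_transform[of x S _ "F j"])
    then show "nderiv S j u differentiable (at x within S)"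
      by (rule differentiableI_vector)
  qed
  moreover have "abs_cont_on S (nderiv S (m - 1) u)"
  proof (rule abs_cont_on_cong)
    have Fd: "(F (m - 1) has_real_derivative F m x) (at x within S)" if "x \<in> S" for x
      using F[of "m - 1" x] m that by simp
    show "abs_cont_on S (F (m - 1))"
      using field_differentiable_bound[OF is_interval_convex[OF S(2)] Fd, of B] Fm(2)
      by (intro lipschitz_imp_abs_cont_on[of _ _ B]) auto
  qed (simp add: nd)
  moreover have "nderiv S m u \<in> L2 S"
  proof (rule L2_bounded[OF S(3)])
    have "F m \<in> borel_measurable (lebesgue_on S)"
      using Fm(1) S(3) by (intro continuous_imp_measurable_on_sets_lebesgue) auto
    then show "nderiv S m u \<in> borel_measurable (lebesgue_on S)"
      by (rule borel_measurable_lebesgue_on_cong[rotated]) (simp add: nd)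
    show "\<bar>nderiv S m u x\<bar> \<le> B" if "x \<in> S" for x
      using Fm(2) nd[of m x] that by simp
  qed
  ultimately show ?thesis unfolding L2m_def by simp
qed

text \<open>Cauchy-Schwarz against the indicator function of the subinterval, whose norm is
  \<open>sqrt (y - x)\<close>.\<close>

lemma integral_bound_norm2:
  assumes g: "g \<in> L2 II" and I: "(g has_integral I) {x..y}" and xy: "-1 \<le> x" "x \<le> y" "y \<le> 1"
  shows "\<bar>I\<bar> \<le> sqrt (y - x) * norm2 g"
proof -
  let ?c = "\<lambda>z. if z \<in> {x..y} then 1 else 0::real"
  have "?c \<in> borel_measurable (lebesgue_on II)"
    by (intro measurable_restrict_space1 measurable_If) auto
  then have c: "?c \<in> L2 II"
    by (intro L2_bounded[of _ _ 1]) auto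
  have "((\<lambda>z. if z \<in> {x..y} then g z else 0) has_integral I) II"
    using I xy by (subst has_integral_restrict) auto
  then have "integral II (\<lambda>z. ?c z * g z) = I"
    by (intro integral_unique) (simp add: if_distrib[of "\<lambda>c. c * g _"] cong: if_cong)
  then have 1: "ip ?c g = I"
    unfolding ip_def using L2_mult_integrable[OF c g] by (subst lebesgue_integral_eq_integral) auto
  have "((\<lambda>z. if z \<in> {x..y} then 1 else 0::real) has_integral (y - x)) II"
    using xy has_integral_const_real[of "1::real" x y] by (subst has_integral_restrict) auto
  then have "integral II (\<lambda>z. ?c z * ?c z) = y - x"
    by (intro integral_unique) (simp add: if_distrib[of "\<lambda>c. c * _"] cong: if_cong)
  then have "ip ?c ?c = y - x"
    unfolding ip_def using L2_mult_integrable[OF c c] by (subst lebesgue_integral_eq_integral) auto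
  then have "norm2 ?c = sqrt (y - x)"
    using norm2_sq[of ?c] norm2_nonneg[of ?c] by (metis real_sqrt_unique)
  then show ?thesis
    using ip_Cauchy_Schwarz[OF c g] 1 by simp
qed

lemma integral_derivative_except:
  fixes f :: "real \<Rightarrow> real"
  assumes "a \<le> b" "continuous_on {a..b} f" "\<And>x. x \<in> {a<..<b} \<Longrightarrow> x \<noteq> t \<Longrightarrow> (f has_real_derivative g x) (at x)"
  shows "(g has_integral (f b - f a)) {a..b}"
  by (rule fundamental_theorem_of_calculus_interior_strong[of "{t}"])
     (use assms in \<open>simp_all add: has_real_derivative_iff_has_vector_derivative\<close>)

lemma bounded_on_II:
  assumes "continuous_on UNIV f"
  shows "\<exists>B. \<forall>x\<in>II. \<bar>f x\<bar> \<le> (B::real)"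
proof -
  have "continuous_on II f" using assms by (rule continuous_on_subset) simp
  from continuous_on_Icc_bounded[OF this] show ?thesis by metis
qed

lemma DERIV_imp_has_vector_derivative_within:
  "(f has_real_derivative D) (at x) \<Longrightarrow> (f has_vector_derivative D) (at x within S)"
  unfolding has_real_derivative_iff_has_vector_derivative by (rule has_vector_derivative_at_within)

text \<open>The point \<open>t\<close> belongs to the left branch, so for \<open>t = -1\<close> the
  left branch is visible on \<open>II\<close> only at the endpoint -1 itself.\<close>

definition pw :: "real \<Rightarrow> (real \<Rightarrow> real) \<Rightarrow> (real \<Rightarrow> real) \<Rightarrow> real \<Rightarrow> real" where
  "pw t a b = (\<lambda>x. if x \<le> t then a x else b x)"

lemma L2_pw:
  assumes "continuous_on UNIV a" "continuous_on UNIV b"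
  shows "pw t a b \<in> L2 II"
proof -
  have "pw t a b \<in> borel_measurable borel"
    unfolding pw_def using assms by (intro measurable_If borel_measurable_continuous_onI) auto
  then have m: "pw t a b \<in> borel_measurable (lebesgue_on II)"
    by (intro measurable_restrict_space1 measurable_completion) simp
  obtain A where A: "\<And>x. x \<in> II \<Longrightarrow> \<bar>a x\<bar> \<le> A"
    using bounded_on_II[OF assms(1)] by blast
  obtain B where B: "\<And>x. x \<in> II \<Longrightarrow> \<bar>b x\<bar> \<le> B"
    using bounded_on_II[OF assms(2)] by blast
  show ?thesis
    by (rule L2_bounded[OF _ m, of "max A B"])
       (auto simp: pw_def max.coboundedI1[OF A] max.coboundedI2[OF B])
qed

lemma continuous_on_pw:
  assumes "continuous_on UNIV a" "continuous_on UNIV b" "a t = b t"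
  shows "continuous_on S (pw t a b)"
  unfolding pw_def using assms(3)
  by (intro continuous_on_cases_le)
     (auto intro: continuous_on_subset[OF assms(1)] continuous_on_subset[OF assms(2)])

lemma pw_derivative_off:
  assumes a: "\<And>x. (a has_real_derivative a1 x) (at x)" and b: "\<And>x. (b has_real_derivative b1 x) (at x)"
    and x: "x \<noteq> t"
  shows "(pw t a b has_real_derivative pw t a1 b1 x) (at x)"
proof (cases "x < t")
  case True
  then have "(pw t a b has_real_derivative a1 x) (at x)"
    by (intro has_field_derivative_transform_within_open[OF a[of x], of "{..<t}"]) (auto simp: pw_def)
  then show ?thesis using True by (simp add: pw_def)
next
  case False
  then have "(pw t a b has_real_derivative b1 x) (at x)"
    using x by (intro has_field_derivative_transform_within_open[OF b[of x], of "{t<..}"]) (auto simp: pw_def)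
  then show ?thesis using False x by (simp add: pw_def)
qed

lemma pw_derivative:
  assumes a: "\<And>x. (a has_real_derivative a1 x) (at x)" and b: "\<And>x. (b has_real_derivative b1 x) (at x)"
    and t: "a t = b t" "a1 t = b1 t"
  shows "(pw t a b has_real_derivative pw t a1 b1 x) (at x)"
proof (cases "x = t")
  case True
  have "((\<lambda>y. (pw t a b y - pw t a b t) / (y - t)) \<longlongrightarrow> a1 t) (at t)"
  proof (rule filterlim_split_at)
    have "((\<lambda>y. (a y - a t) / (y - t)) \<longlongrightarrow> a1 t) (at_left t)"
      using a[of t] unfolding has_field_derivative_iff by (rule tendsto_within_subset) auto
    then show "((\<lambda>y. (pw t a b y - pw t a b t) / (y - t)) \<longlongrightarrow> a1 t) (at_left t)"
      by (rule Lim_transform_eventually) (auto simp: eventually_at_filter pw_def)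
    have "((\<lambda>y. (b y - b t) / (y - t)) \<longlongrightarrow> b1 t) (at_right t)"
      using b[of t] unfolding has_field_derivative_iff by (rule tendsto_within_subset) auto
    then show "((\<lambda>y. (pw t a b y - pw t a b t) / (y - t)) \<longlongrightarrow> a1 t) (at_right t)"
      unfolding t(2) by (rule Lim_transform_eventually) (auto simp: eventually_at_filter pw_def t)
  qed
  then show ?thesis using True by (simp add: has_field_derivative_iff pw_def)
next
  case False
  then show ?thesis by (rule pw_derivative_off[OF a b])
qed

lemma pw_cmult: "(\<lambda>x. c * pw t a b x) = pw t (\<lambda>x. c * a x) (\<lambda>x. c * b x)"
  by (simp add: pw_def fun_eq_iff)

lemma pw_diff: "(\<lambda>x. pw t a b x - pw t a' b' x) = pw t (\<lambda>x. a x - a' x) (\<lambda>x. b x - b' x)"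
  by (simp add: pw_def fun_eq_iff)

lemma at_within_II_nontrivial:
  assumes "x \<in> II"
  shows "at x within II \<noteq> bot"
proof -
  consider "x = -1" | "x = 1" | "-1 < x" "x < 1" using assms by fastforce
  then show ?thesis
    by cases (simp_all add: at_within_Icc_at_right at_within_Icc_at_left at_within_Icc_at)
qed

lemma at_within_II_interior: "x \<in> {-1<..<1} \<Longrightarrow> at x within II = at (x::real)"
  by (simp add: at_within_Icc_at)

lemma abs_cont_on_pw:
  assumes a: "\<And>x. (a has_real_derivative a1 x) (at x)" and b: "\<And>x. (b has_real_derivative b1 x) (at x)"
    and c: "continuous_on UNIV a1" "continuous_on UNIV b1" and t: "a t = b t"
  shows "abs_cont_on II (pw t a b)"
proof -
  obtain A where A: "\<And>x. x \<in> II \<Longrightarrow> \<bar>a1 x\<bar> \<le> A"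
    using bounded_on_II[OF c(1)] by blast
  obtain B where B: "\<And>x. x \<in> II \<Longrightarrow> \<bar>b1 x\<bar> \<le> B"
    using bounded_on_II[OF c(2)] by blast
  have M: "\<bar>pw t a1 b1 x\<bar> \<le> max A B" if "x \<in> II" for x
    using that by (auto simp: pw_def max.coboundedI1[OF A] max.coboundedI2[OF B])
  have M0: "0 \<le> max A B" using M[of 0] by auto
  have cont: "continuous_on S (pw t a b)" for S
    using a b t by (intro continuous_on_pw continuous_at_imp_continuous_on ballI DERIV_isCont) auto
  have "\<bar>pw t a b y - pw t a b x\<bar> \<le> max A B * (y - x)" if "x \<in> II" "y \<in> II" "x \<le> y" for x y
  proof -
    have "(pw t a1 b1 has_integral (pw t a b y - pw t a b x)) {x..y}"
      using that pw_derivative_off[OF a b] by (intro integral_derivative_except[OF _ cont]) auto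
    then have "norm (pw t a b y - pw t a b x) \<le> max A B * measure lborel {x..y}"
      using that M M0 by (intro has_integral_bound_real[of _ "{}"]) auto
    then show ?thesis using that by simp
  qed
  note * = this
  show ?thesis
  proof (rule lipschitz_imp_abs_cont_on)
    fix x y assume "x \<in> II" "y \<in> II"
    then show "\<bar>pw t a b y - pw t a b x\<bar> \<le> max A B * \<bar>y - x\<bar>"
      using *[of x y] *[of y x] by (cases "x \<le> y") (auto simp: abs_minus_commute)
  qed
qed

lemma L2m_1_pw:
  assumes a: "\<And>x. (a has_real_derivative a1 x) (at x)" and b: "\<And>x. (b has_real_derivative b1 x) (at x)"
    and c: "continuous_on UNIV a1" "continuous_on UNIV b1" and t: "a t = b t"
  shows "pw t a b \<in> L2m 1 II"
    and "x \<in> II - {t} \<Longrightarrow> nderiv II 1 (pw t a b) x = pw t a1 b1 x"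
proof -
  have nd: "nderiv II 1 (pw t a b) x = pw t a1 b1 x" if "x \<in> II - {t}" for x
  proof -
    have "(pw t a b has_vector_derivative pw t a1 b1 x) (at x within II)"
      using that by (intro DERIV_imp_has_vector_derivative_within pw_derivative_off[OF a b]) simp
    then show ?thesis
      using that at_within_II_nontrivial[of x] by (simp add: nderiv_Suc vector_derivative_within)
  qed
  then show "x \<in> II - {t} \<Longrightarrow> nderiv II 1 (pw t a b) x = pw t a1 b1 x" .
  have "nderiv II 1 (pw t a b) \<in> L2 II"
    by (rule L2_finite_change[OF L2_pw[OF c], of "{t}"]) (use nd in auto)
  then show "pw t a b \<in> L2m 1 II"
    using abs_cont_on_pw[OF a b c t] by (simp add: L2m_def)
qed

lemma L2m_2_pw:
  assumes a: "\<And>x. (a has_real_derivative a1 x) (at x)" "\<And>x. (a1 has_real_derivative a2 x) (at x)"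
    and b: "\<And>x. (b has_real_derivative b1 x) (at x)" "\<And>x. (b1 has_real_derivative b2 x) (at x)"
    and c: "continuous_on UNIV a2" "continuous_on UNIV b2" and t: "a t = b t" "a1 t = b1 t"
  shows "pw t a b \<in> L2m 2 II"
    and "x \<in> II \<Longrightarrow> nderiv II 1 (pw t a b) x = pw t a1 b1 x"
    and "x \<in> II - {t} \<Longrightarrow> nderiv II 2 (pw t a b) x = pw t a2 b2 x"
proof -
  have d: "(pw t a b has_vector_derivative pw t a1 b1 x) (at x within II)" for x
    by (intro DERIV_imp_has_vector_derivative_within pw_derivative[OF a(1) b(1) t])
  have nd1: "nderiv II 1 (pw t a b) x = pw t a1 b1 x" if "x \<in> II" for x
    using d[of x] that at_within_II_nontrivial[of x] by (simp add: nderiv_Suc vector_derivative_within)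
  then show "x \<in> II \<Longrightarrow> nderiv II 1 (pw t a b) x = pw t a1 b1 x" .
  have nd2: "nderiv II 2 (pw t a b) x = pw t a2 b2 x" if x: "x \<in> II - {t}" for x
  proof -
    have "(pw t a1 b1 has_vector_derivative pw t a2 b2 x) (at x within II)"
      using x by (intro DERIV_imp_has_vector_derivative_within pw_derivative_off[OF a(2) b(2)]) simp
    then have "(nderiv II 1 (pw t a b) has_vector_derivative pw t a2 b2 x) (at x within II)"
      by (rule has_vector_derivative_transform[rotated 2]) (use x nd1 in simp_all)
    then show ?thesis
      using x at_within_II_nontrivial[of x] by (simp add: numeral_2_eq_2 nderiv_Suc[of _ "Suc 0"] vector_derivative_within)
  qed
  then show "x \<in> II - {t} \<Longrightarrow> nderiv II 2 (pw t a b) x = pw t a2 b2 x" .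
  have "nderiv II 2 (pw t a b) \<in> L2 II"
    by (rule L2_finite_change[OF L2_pw[OF c], of "{t}"]) (use nd2 in auto)
  moreover have "abs_cont_on II (nderiv II 1 (pw t a b))"
    by (rule abs_cont_on_cong[OF _ abs_cont_on_pw[OF a(2) b(2) c t(2)]]) (rule nd1[symmetric])
  moreover have "pw t a b differentiable_on II"
    unfolding differentiable_on_def using d differentiableI_vector by blast
  ultimately show "pw t a b \<in> L2m 2 II"
    by (simp add: L2m_def)
qed

lemma L2m_1D:
  assumes f: "f \<in> L2m 1 II"
  shows "abs_cont_on II f" "nderiv II 1 f \<in> L2 II" "continuous_on II f" "f \<in> L2 II"
    "x \<in> {-1<..<1} \<Longrightarrow> nderiv II 1 f x = vector_derivative f (at x)"
proof -
  show 1: "abs_cont_on II f" "nderiv II 1 f \<in> L2 II" using f by (auto simp: L2m_def)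
  show "continuous_on II f" by (rule abs_cont_on_imp_continuous_on[OF 1(1)])
  then show "f \<in> L2 II" by (rule L2_continuous_on)
  show "x \<in> {-1<..<1} \<Longrightarrow> nderiv II 1 f x = vector_derivative f (at x)"
    by (simp add: nderiv_Suc at_within_II_interior)
qed

lemma L2m_2D:
  assumes f: "f \<in> L2m 2 II"
  shows "abs_cont_on II (nderiv II 1 f)" "nderiv II 2 f \<in> L2 II"
    "x \<in> II \<Longrightarrow> (f has_real_derivative nderiv II 1 f x) (at x within II)"
    "continuous_on II f" "continuous_on II (nderiv II 1 f)" "f \<in> L2 II" "nderiv II 1 f \<in> L2 II"
    "abs_cont_on II f"
    "x \<in> {-1<..<1} \<Longrightarrow> nderiv II 2 f x = vector_derivative (nderiv II 1 f) (at x)"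
    "x \<in> {-1<..<1} \<Longrightarrow> nderiv II 1 f x = vector_derivative f (at x)"
proof -
  show 1: "abs_cont_on II (nderiv II 1 f)" "nderiv II 2 f \<in> L2 II" using f by (auto simp: L2m_def)
  have "f differentiable_on II" using f by (auto simp: L2m_def)
  then show d: "(f has_real_derivative nderiv II 1 f x) (at x within II)" if "x \<in> II" for x
    using that unfolding differentiable_on_def
    by (auto simp: nderiv_Suc has_real_derivative_iff_has_vector_derivative vector_derivative_works)
  show c1: "continuous_on II (nderiv II 1 f)" by (rule abs_cont_on_imp_continuous_on[OF 1(1)])
  then show "nderiv II 1 f \<in> L2 II" by (rule L2_continuous_on)
  show "continuous_on II f"
    using d DERIV_continuous continuous_on_eq_continuous_within by blast
  then show "f \<in> L2 II" by (rule L2_continuous_on)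
  obtain B where B: "\<And>x. x \<in> II \<Longrightarrow> \<bar>nderiv II 1 f x\<bar> \<le> B"
    using continuous_on_Icc_bounded[OF c1] by blast
  show "abs_cont_on II f"
    using field_differentiable_bound[of II f "nderiv II 1 f" B] d B
    by (intro lipschitz_imp_abs_cont_on[of _ _ B]) auto
  show "x \<in> {-1<..<1} \<Longrightarrow> nderiv II 1 f x = vector_derivative f (at x)"
    by (simp add: nderiv_Suc at_within_II_interior)
  show "x \<in> {-1<..<1} \<Longrightarrow> nderiv II 2 f x = vector_derivative (nderiv II 1 f) (at x)"
    by (simp add: numeral_2_eq_2 nderiv_Suc[of _ "Suc 0"] at_within_II_interior)
qed

text \<open>Integration by parts on [-1, t] and on [t, 1] separately. The two boundary terms at
  \<open>t\<close> combine to the jump of the kernel times \<open>h t\<close>.\<close>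

lemma ip_pw_by_parts:
  assumes t: "-1 \<le> t" "t \<le> 1"
    and h: "abs_cont_on II h" "dh \<in> L2 II" "\<And>x. x \<in> {-1<..<1} \<Longrightarrow> dh x = vector_derivative h (at x)"
    and a: "\<And>x. (a has_real_derivative a1 x) (at x)" and b: "\<And>x. (b has_real_derivative b1 x) (at x)"
    and c: "continuous_on UNIV a1" "continuous_on UNIV b1"
  shows "ip (pw t a b) dh + ip (pw t a1 b1) h = a t * h t - a (-1) * h (-1) + (b 1 * h 1 - b t * h t)"
proof -
  have cont: "continuous_on UNIV a" "continuous_on UNIV b"
    using a b by (auto intro!: continuous_at_imp_continuous_on DERIV_isCont)
  have hL: "h \<in> L2 II" by (intro L2_continuous_on abs_cont_on_imp_continuous_on h(1))
  let ?\<phi> = "\<lambda>x. pw t a b x * dh x + pw t a1 b1 x * h x"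
  have int: "integrable (lebesgue_on II) (\<lambda>x. pw t a b x * dh x)" "integrable (lebesgue_on II) (\<lambda>x. pw t a1 b1 x * h x)"
    using L2_pw cont c h(2) hL by (auto intro!: L2_mult_integrable)
  have "ip (pw t a b) dh + ip (pw t a1 b1) h = (LINT x|lebesgue_on II. ?\<phi> x)"
    unfolding ip_def using int by simp
  also have "\<dots> = integral II ?\<phi>"
    using int by (intro lebesgue_integral_eq_integral) auto
  also have "(?\<phi> has_integral a t * h t - a (-1) * h (-1) + (b 1 * h 1 - b t * h t)) II"
  proof (rule has_integral_combine[OF t])
    have "((\<lambda>x. a x * vector_derivative h (at x) + a1 x * h x) has_integral a t * h t - a (-1) * h (-1)) {-1..t}"
      using t by (intro abs_cont_on_integration_by_parts abs_cont_on_subset[OF h(1)])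
         (simp_all add: has_field_derivative_at_within[OF a] continuous_on_subset[OF c(1)])
    then show "(?\<phi> has_integral a t * h t - a (-1) * h (-1)) {-1..t}"
      by (rule has_integral_spike[rotated 2, of _ _ _ "{-1, t}"]) (use h(3) t in \<open>auto simp: pw_def\<close>)
    have "((\<lambda>x. b x * vector_derivative h (at x) + b1 x * h x) has_integral b 1 * h 1 - b t * h t) {t..1}"
      using t by (intro abs_cont_on_integration_by_parts abs_cont_on_subset[OF h(1)])
         (simp_all add: has_field_derivative_at_within[OF b] continuous_on_subset[OF c(2)])
    then show "(?\<phi> has_integral b 1 * h 1 - b t * h t) {t..1}"
      by (rule has_integral_spike[rotated 2, of _ _ _ "{t, 1}"]) (use h(3) t in \<open>auto simp: pw_def\<close>)
  qed
  then have "integral II ?\<phi> = a t * h t - a (-1) * h (-1) + (b 1 * h 1 - b t * h t)"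
    by (rule integral_unique)
  finally show ?thesis .
qed

text \<open>A Poincare inequality: the pointwise bound by \<open>sqrt 2 * norm2 g\<close> is
  integrated over an interval of length 2. The exceptional point \<open>t\<close> is where two
  branches meet.\<close>

lemma norm2_le_norm2_derivative:
  assumes f: "continuous_on II f" "f (-1) = 0" and g: "g \<in> L2 II"
    and d: "\<And>x. x \<in> {-1<..<1} \<Longrightarrow> x \<noteq> t \<Longrightarrow> (f has_real_derivative g x) (at x)"
  shows "norm2 f \<le> 2 * norm2 g"
proof -
  have "\<bar>f x\<bar> \<le> sqrt 2 * norm2 g" if x: "x \<in> II" for x
  proof -
    have "(g has_integral (f x - f (-1))) {-1..x}"
      using x d by (intro integral_derivative_except[of _ _ _ t] continuous_on_subset[OF f(1)]) auto
    then have "\<bar>f x - f (-1)\<bar> \<le> sqrt (x - (-1)) * norm2 g"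
      using x by (intro integral_bound_norm2[OF g]) auto
    also have "\<dots> \<le> sqrt 2 * norm2 g"
      using x norm2_nonneg by (intro mult_right_mono real_sqrt_le_mono) auto
    finally show ?thesis using f(2) by simp
  qed
  then have "norm2 f \<le> sqrt 2 * (sqrt 2 * norm2 g)"
    by (rule norm2_bounded[OF L2_continuous_on[OF f(1)]])
  then show ?thesis by (simp add: mult.assoc[symmetric])
qed

section \<open>Deviation from bounded operators and functionals\<close>

text \<open>Bounds in the supremum norm hold only almost everywhere. Continuity carries them to
  single points, in particular to -1, where the extremal functions are evaluated.\<close>

lemma AE_bound_continuous:
  fixes f :: "real \<Rightarrow> real"
  assumes f: "continuous_on II f" and ae: "AE x in lebesgue_on II. \<bar>f x\<bar> \<le> c" and x: "x \<in> II"
  shows "\<bar>f x\<bar> \<le> c"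
proof (rule ccontr)
  assume "\<not> \<bar>f x\<bar> \<le> c"
  then have "0 < \<bar>f x\<bar> - c" by simp
  then obtain d where d: "d > 0" "\<And>y. y \<in> II \<Longrightarrow> dist y x < d \<Longrightarrow> dist (f y) (f x) < \<bar>f x\<bar> - c"
    using f x unfolding continuous_on_iff by blast
  define a b where "a = max (-1) (x - d)" and "b = min 1 (x + d)"
  have ab: "a < b" using d(1) x by (auto simp: a_def b_def)
  have big: "\<not> \<bar>f y\<bar> \<le> c" if "y \<in> {a<..<b}" for y
  proof -
    have "y \<in> II" "dist y x < d" using that by (auto simp: a_def b_def dist_real_def)
    then have "\<bar>f y - f x\<bar> < \<bar>f x\<bar> - c" using d(2) by (simp add: dist_real_def)
    then show ?thesis by linarith
  qed
  have "AE y in lebesgue. y \<in> II \<longrightarrow> \<bar>f y\<bar> \<le> c"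
    using ae by (subst (asm) AE_restrict_space_iff) auto
  then have "AE y in lebesgue. y \<notin> {a<..<b}"
  proof (rule AE_mp, intro AE_I2 impI)
    fix y assume y: "y \<in> II \<longrightarrow> \<bar>f y\<bar> \<le> c"
    show "y \<notin> {a<..<b}"
    proof
      assume "y \<in> {a<..<b}"
      moreover from this have "y \<in> II" by (auto simp: a_def b_def)
      ultimately show False using big y by blast
    qed
  qed
  then have "{a<..<b} \<in> null_sets lebesgue"
    by (subst (asm) AE_iff_null_sets[symmetric]) auto
  then have "emeasure lebesgue {a<..<b} = 0" by auto
  then show False using ab by simp
qed

lemma norm_inf_le:
  assumes "f \<in> borel_measurable (lebesgue_on II)" "AE x in lebesgue_on II. \<bar>f x\<bar> \<le> c"
  shows "norm_inf f \<le> ereal c"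
  unfolding norm_inf_def using assms by (intro esssup_I) auto

lemma norm_inf_le_imp_AE:
  assumes "norm_inf f \<le> ereal c"
  shows "AE x in lebesgue_on II. \<bar>f x\<bar> \<le> c"
proof -
  have "AE x in lebesgue_on II. ereal \<bar>f x\<bar> \<le> norm_inf f"
    unfolding norm_inf_def by (rule esssup_AE)
  then show ?thesis
    by eventually_elim (use assms in \<open>metis ereal_less_eq(3) order_trans\<close>)
qed

lemma linear_operator_lincomb:
  "linear_operator S \<Longrightarrow> f \<in> L2 II \<Longrightarrow> g \<in> L2 II \<Longrightarrow>
    AE x in lebesgue_on II. S (\<lambda>y. a * f y + b * g y) x = a * S f x + b * S g x"
  by (simp add: linear_operator_def)

lemma linear_functional_lincomb:
  "linear_functional S \<Longrightarrow> f \<in> L2 II \<Longrightarrow> g \<in> L2 II \<Longrightarrow> S (\<lambda>y. a * f y + b * g y) = a * S f + b * S g"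
  unfolding linear_functional_def
  by (elim conjE, drule (1) bspec, drule (1) bspec, drule spec, drule spec, assumption)

text \<open>Scaling by a number strictly above \<open>norm2 f\<close> treats functions of norm 0
  along with all others.\<close>

lemma linear_operator_bound:
  assumes S: "linear_operator S" "operator_norm S \<le> ereal N" and f: "f \<in> L2 II" and c: "norm2 f < c"
    and N: "N < N'"
  shows "AE x in lebesgue_on II. \<bar>S f x\<bar> \<le> N' * c"
proof -
  have c0: "c > 0" using c norm2_nonneg[of f] by simp
  let ?g = "\<lambda>x. (1 / c) * f x"
  have g: "?g \<in> L2 II" using f by (rule L2_cmult)
  have "norm2 ?g \<le> 1" unfolding norm2_cmult using c c0 by simp
  then have "norm_inf (S ?g) \<le> operator_norm S"
    unfolding operator_norm_def using g by (intro SUP_upper) auto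
  also have "\<dots> < ereal N'" using S(2) N by (simp add: le_less_trans)
  finally have 1: "AE x in lebesgue_on II. \<bar>S ?g x\<bar> \<le> N'" by (intro norm_inf_le_imp_AE less_imp_le)
  have "AE x in lebesgue_on II. S (\<lambda>y. c * ?g y + 0 * ?g y) x = c * S ?g x + 0 * S ?g x"
    by (rule linear_operator_lincomb[OF S(1) g g])
  moreover have "(\<lambda>y. c * ?g y + 0 * ?g y) = f" using c0 by simp
  ultimately have "AE x in lebesgue_on II. S f x = c * S ?g x" by simp
  with 1 show ?thesis
    by eventually_elim (use c0 in \<open>simp add: abs_mult mult.commute mult_left_mono\<close>)
qed

lemma linear_functional_bound:
  assumes S: "linear_functional S" "functional_norm S \<le> ereal N" and f: "f \<in> L2 II" and c: "norm2 f < c"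
  shows "\<bar>S f\<bar> \<le> N * c"
proof -
  have c0: "c > 0" using c norm2_nonneg[of f] by simp
  let ?g = "\<lambda>x. (1 / c) * f x"
  have g: "?g \<in> L2 II" using f by (rule L2_cmult)
  have "norm2 ?g \<le> 1" unfolding norm2_cmult using c c0 by simp
  then have "ereal \<bar>S ?g\<bar> \<le> functional_norm S"
    unfolding functional_norm_def using g by (intro SUP_upper) auto
  then have 1: "\<bar>S ?g\<bar> \<le> N" using S(2) by (metis ereal_less_eq(3) order_trans)
  have "S (\<lambda>y. c * ?g y + 0 * ?g y) = c * S ?g + 0 * S ?g"
    by (rule linear_functional_lincomb[OF S(1) g g])
  moreover have "(\<lambda>y. c * ?g y + 0 * ?g y) = f" using c0 by simp
  ultimately have "S f = c * S ?g" by simp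
  with 1 show ?thesis using c0 by (simp add: abs_mult mult.commute mult_left_mono)
qed

text \<open>Stechkin's lower bound: the derivative is at most the deviation on \<open>f\<close> plus
  the size of \<open>S f\<close>, which is at most \<open>N * norm2 f\<close>. The estimate holds
  almost everywhere with a slack \<open>e\<close>, is carried to \<open>x\<close> by continuity, and
  is contradicted for small \<open>e\<close>.\<close>

lemma U_dev_ge:
  assumes S: "linear_operator S" "operator_norm S \<le> ereal N"
    and f: "f \<in> W2 r" "f \<in> L2 II" "continuous_on II (nderiv II k f)" and x: "x \<in> II"
  shows "ereal (\<bar>nderiv II k f x\<bar> - N * norm2 f) \<le> U_dev r k S"
proof (rule ccontr)
  assume "\<not> ?thesis"
  then have "U_dev r k S < ereal (\<bar>nderiv II k f x\<bar> - N * norm2 f)" by simp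
  then obtain c where c: "U_dev r k S < ereal c" "c < \<bar>nderiv II k f x\<bar> - N * norm2 f"
    using ereal_dense2 by (metis ereal_less(2) less_ereal.simps(1))
  have "norm_inf (\<lambda>x. nderiv II k f x - S f x) \<le> U_dev r k S"
    unfolding U_dev_def using f(1) by (intro SUP_upper)
  then have 1: "AE x in lebesgue_on II. \<bar>nderiv II k f x - S f x\<bar> \<le> c"
    using less_imp_le[OF c(1)] by (intro norm_inf_le_imp_AE) (rule order_trans)
  have "((\<lambda>e. c + (N + e) * (norm2 f + e)) \<longlongrightarrow> c + (N + 0) * (norm2 f + 0)) (at_right 0)"
    by (intro tendsto_intros)
  then have "eventually (\<lambda>e. c + (N + e) * (norm2 f + e) < \<bar>nderiv II k f x\<bar>) (at_right 0)"
    using c(2) by (intro order_tendstoD(2)) auto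
  then have "eventually (\<lambda>e. c + (N + e) * (norm2 f + e) < \<bar>nderiv II k f x\<bar> \<and> e > 0) (at_right 0)"
    using eventually_at_right_less by eventually_elim simp
  then obtain e where e: "c + (N + e) * (norm2 f + e) < \<bar>nderiv II k f x\<bar>" "e > 0"
    using eventually_happens' trivial_limit_at_right_real by blast
  have "AE x in lebesgue_on II. \<bar>S f x\<bar> \<le> (N + e) * (norm2 f + e)"
    using e(2) by (intro linear_operator_bound[OF S f(2)]) auto
  with 1 have "AE x in lebesgue_on II. \<bar>nderiv II k f x\<bar> \<le> c + (N + e) * (norm2 f + e)"
    by eventually_elim linarith
  then have "\<bar>nderiv II k f x\<bar> \<le> c + (N + e) * (norm2 f + e)"
    by (rule AE_bound_continuous[OF f(3) _ x])
  with e(1) show False by simp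
qed

lemma functional_dev_ge:
  assumes S: "linear_functional S" "functional_norm S \<le> ereal N" and f: "f \<in> W2 r" "f \<in> L2 II"
  shows "ereal (\<bar>nderiv II k f x\<bar> - N * norm2 f) \<le> (SUP f\<in>W2 r. ereal \<bar>nderiv II k f x - S f\<bar>)"
proof -
  have "\<bar>S f\<bar> \<le> N * norm2 f"
  proof (rule tendsto_lowerbound)
    show "((\<lambda>e. N * (norm2 f + e)) \<longlongrightarrow> N * norm2 f) (at_right 0)"
      by (auto intro!: tendsto_eq_intros)
    show "\<forall>\<^sub>F e in at_right 0. \<bar>S f\<bar> \<le> N * (norm2 f + e)"
      using eventually_at_right_less[of 0]
      by eventually_elim (intro linear_functional_bound[OF S f(2)], simp)
  qed simp
  then have "\<bar>nderiv II k f x\<bar> - N * norm2 f \<le> \<bar>nderiv II k f x - S f\<bar>" by linarith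
  then show ?thesis using f(1) by (intro SUP_upper2[of f]) auto
qed

lemma nderiv_cong_on:
  assumes "\<And>x. x \<in> S \<Longrightarrow> f x = g x"
  shows "x \<in> S \<Longrightarrow> nderiv S n f x = nderiv S n g x"
proof (induction n arbitrary: x)
  case 0
  then show ?case by (simp add: assms)
next
  case (Suc n)
  show ?case unfolding nderiv_Suc
    by (rule vector_derivative_cong_eq) (use Suc in \<open>auto intro: always_eventually\<close>)
qed

text \<open>Hoelder continuity of order 1/2, the form in which the orthogonality identities deliver
  continuity in the parameter and in \<open>t\<close>.\<close>

lemma continuous_on_if_square_lipschitz:
  fixes f :: "real \<Rightarrow> real"
  assumes C: "\<And>x y. x \<in> S \<Longrightarrow> y \<in> S \<Longrightarrow> (f x - f y)\<^sup>2 \<le> C * \<bar>x - y\<bar>"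
  shows "continuous_on S f"
  unfolding continuous_on_iff
proof (intro ballI allI impI)
  fix x and e :: real assume x: "x \<in> S" and e: "e > 0"
  show "\<exists>d>0. \<forall>x'\<in>S. dist x' x < d \<longrightarrow> dist (f x') (f x) < e"
  proof (intro exI[of _ "e\<^sup>2 / (\<bar>C\<bar> + 1)"] conjI ballI impI)
    fix x' assume x': "x' \<in> S" "dist x' x < e\<^sup>2 / (\<bar>C\<bar> + 1)"
    have "(f x' - f x)\<^sup>2 \<le> C * \<bar>x' - x\<bar>" using C x x' by blast
    also have "\<dots> \<le> (\<bar>C\<bar> + 1) * \<bar>x' - x\<bar>" by (intro mult_right_mono) auto
    also have "\<dots> < e\<^sup>2"
      using x'(2) by (simp add: dist_real_def pos_less_divide_eq add_nonneg_pos mult.commute)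
    finally have "\<bar>f x' - f x\<bar>\<^sup>2 < e\<^sup>2" by simp
    then have "\<bar>f x' - f x\<bar> < e" by (rule power2_less_imp_less) (use e in simp)
    then show "dist (f x') (f x) < e" using e by (simp add: dist_real_def)
  qed (use e in \<open>simp add: add_nonneg_pos\<close>)
qed

lemma poly_L2m:
  assumes rk: "(r = 1 \<and> k = 0) \<or> (r = 2 \<and> k \<in> {0, 1::nat})" and Q: "degree Q \<le> r - 1"
  shows "poly Q \<in> L2m r II" "x \<in> II \<Longrightarrow> nderiv II k (poly Q) x = poly ((pderiv ^^ k) Q) x"
    "x \<in> II \<Longrightarrow> nderiv II r (poly Q) x = 0"
proof -
  define F where "F j = poly ((pderiv ^^ j) Q)" for j
  have F: "(F j has_real_derivative F (Suc j) x) (at x within II)" for j x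
    unfolding F_def funpow.simps o_def by (rule has_field_derivative_at_within[OF poly_DERIV])
  have Fr: "F r = (\<lambda>x. 0)"
  proof -
    have "(pderiv ^^ r) Q = 0"
      using rk
    proof
      assume "r = 1 \<and> k = 0"
      then show ?thesis using Q by (simp add: pderiv_eq_0_iff)
    next
      assume "r = 2 \<and> k \<in> {0, 1}"
      then show ?thesis using Q by (simp add: numeral_2_eq_2 pderiv_eq_0_iff degree_pderiv)
    qed
    then show ?thesis by (simp add: F_def fun_eq_iff)
  qed
  have nd: "nderiv II j (poly Q) x = F j x" if "x \<in> II" "j \<le> r" for x j
    using nderiv_chain[of II r F "poly Q" j x] at_within_II_nontrivial F that by (simp add: F_def)
  show "x \<in> II \<Longrightarrow> nderiv II k (poly Q) x = poly ((pderiv ^^ k) Q) x"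
    using nd[of x k] rk by (auto simp: F_def)
  show "x \<in> II \<Longrightarrow> nderiv II r (poly Q) x = 0" using nd[of x r] Fr by simp
  show "poly Q \<in> L2m r II"
    by (rule L2m_chain[of II r F _ 0]) (use rk F Fr at_within_II_nontrivial in \<open>auto simp: F_def is_interval_cc\<close>)
qed

section \<open>The extremal problem for a family of representers\<close>

text \<open>Here \<open>U l t\<close> and \<open>V l t\<close> are the solution $u_{\lambda,t}$ and its \<open>r\<close>-th derivative. The
  reflection symmetric endpoint \<open>t = 1\<close> is left out of the family.\<close>
locale kernel_family =
  fixes r k :: nat and \<sigma> :: real and U V :: "real \<Rightarrow> real \<Rightarrow> real \<Rightarrow> real"
  assumes rk: "(r = 1 \<and> k = 0) \<or> (r = 2 \<and> k \<in> {0, 1})"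
    and sigma: "\<sigma> * \<sigma> = 1"
    and U_L2: "\<And>l t. 0 \<le> l \<Longrightarrow> t \<in> {-1..<1} \<Longrightarrow> U l t \<in> L2 II"
    and V_L2m: "\<And>l t c. 0 \<le> l \<Longrightarrow> t \<in> {-1..<1} \<Longrightarrow> (\<lambda>x. c * V l t x) \<in> L2m r II"
    and V_top: "\<And>l t c. 0 \<le> l \<Longrightarrow> t \<in> {-1..<1} \<Longrightarrow>
      AE x in lebesgue_on II. nderiv II r (\<lambda>x. c * V l t x) x = c * (\<sigma> * l * U l t x)"
    and V_k: "\<And>l t c x. 0 \<le> l \<Longrightarrow> t \<in> {-1..<1} \<Longrightarrow> x \<in> II \<Longrightarrow>
      nderiv II k (\<lambda>x. c * V l t x) x = c * nderiv II k (V l t) x"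
    and rep: "\<And>l t f. 0 \<le> l \<Longrightarrow> t \<in> {-1..<1} \<Longrightarrow> f \<in> L2m r II \<Longrightarrow>
      nderiv II k f t = ip (V l t) f + \<sigma> * ip (U l t) (nderiv II r f)"
    and G_le: "\<And>l t. 0 < l \<Longrightarrow> t \<in> {-1..<1} \<Longrightarrow> nderiv II k (V l t) t \<le> nderiv II k (V l (-1)) (-1)"
    and G_at_top: "\<And>t. t \<in> {-1..<1} \<Longrightarrow> filterlim (\<lambda>l. nderiv II k (V l t) t) at_top at_top"
    and G_sublinear: "((\<lambda>l. nderiv II k (V l (-1)) (-1) / l) \<longlongrightarrow> 0) at_top"
    and poincare: "\<And>l m t. 0 \<le> l \<Longrightarrow> 0 \<le> m \<Longrightarrow> t \<in> {-1..<1} \<Longrightarrow>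
      norm2 (\<lambda>x. U l t x - U m t x) \<le> 4 * norm2 (\<lambda>x. V l t x - V m t x)"
    and V_next: "\<And>l. 0 \<le> l \<Longrightarrow> Suc k < r \<Longrightarrow> \<exists>C. \<forall>s\<in>{-1<..<1}. \<forall>t\<in>{-1<..<1}.
      (norm2 (\<lambda>x. nderiv II (Suc k) (V l t) x - nderiv II (Suc k) (V l s) x))\<^sup>2 \<le>
      C * ((norm2 (\<lambda>x. V l t x - V l s x))\<^sup>2 + l * (norm2 (\<lambda>x. U l t x - U l s x))\<^sup>2)"
    and V_poly: "\<exists>Q. degree Q \<le> r - 1 \<and> (\<forall>x\<in>II. poly Q x = V 0 (-1) x)"
    and u_sol_deriv_eq: "\<And>l t x. 0 \<le> l \<Longrightarrow> t \<in> {-1..<1} \<Longrightarrow> x \<in> punctured t \<Longrightarrow> u_sol_deriv r k l t x = V l t x"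
    and norm2_u_sol_deriv_1: "\<And>l. 0 \<le> l \<Longrightarrow> norm2 (u_sol_deriv r k l 1) = norm2 (V l (-1))"
    and u_end_eq: "\<And>l x. 0 \<le> l \<Longrightarrow> x \<in> {-1<..<1} \<Longrightarrow> u_end r k l x = U l (-1) x"
    and u_end_deriv_eq: "\<And>l x. 0 \<le> l \<Longrightarrow> x \<in> {-1<..<1} \<Longrightarrow> nderiv II r (u_end r k l) x = V l (-1) x"
begin

definition G :: "real \<Rightarrow> real \<Rightarrow> real" where "G l t = nderiv II k (V l t) t"

abbreviation nU :: "real \<Rightarrow> real \<Rightarrow> real" where "nU l t \<equiv> norm2 (U l t)"
abbreviation nV :: "real \<Rightarrow> real \<Rightarrow> real" where "nV l t \<equiv> norm2 (V l t)"
abbreviation dU :: "real \<Rightarrow> real \<Rightarrow> real \<Rightarrow> real" where "dU l m t \<equiv> norm2 (\<lambda>x. U l t x - U m t x)"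
abbreviation dV :: "real \<Rightarrow> real \<Rightarrow> real \<Rightarrow> real" where "dV l m t \<equiv> norm2 (\<lambda>x. V l t x - V m t x)"

lemma abs_sigma: "\<bar>\<sigma>\<bar> = 1"
  using sigma by (auto simp: square_eq_1_iff)

lemma L2m_L2: "f \<in> L2m r II \<Longrightarrow> f \<in> L2 II"
  using rk L2m_1D(4) L2m_2D(6) by blast

lemma L2m_continuous: "f \<in> L2m r II \<Longrightarrow> continuous_on II f"
  using rk L2m_1D(3) L2m_2D(4) by blast

lemma L2m_continuous_k: "f \<in> L2m r II \<Longrightarrow> continuous_on II (nderiv II k f)"
  using rk L2m_1D(3) L2m_2D(4) L2m_2D(5) by (auto simp del: One_nat_def)

lemma L2m_top: "f \<in> L2m r II \<Longrightarrow> nderiv II r f \<in> L2 II"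
  by (simp add: L2m_def)

lemma V_in_L2m: "0 \<le> l \<Longrightarrow> t \<in> {-1..<1} \<Longrightarrow> V l t \<in> L2m r II"
  using V_L2m[of l t 1] by simp

lemma V_L2: "0 \<le> l \<Longrightarrow> t \<in> {-1..<1} \<Longrightarrow> V l t \<in> L2 II"
  by (intro L2m_L2 V_in_L2m)

lemma end_in: "-1 \<in> {-1..<1::real}" by simp

lemma ip_top_V:
  assumes "0 \<le> l" "t \<in> {-1..<1}" "g \<in> L2 II"
  shows "ip g (nderiv II r (V l t)) = \<sigma> * l * ip g (U l t)"
proof -
  have "ip g (nderiv II r (V l t)) = ip g (\<lambda>x. \<sigma> * l * U l t x)"
    using assms V_top[of l t 1] by (intro ip_cong_AE L2m_top V_in_L2m L2_cmult U_L2) auto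
  then show ?thesis by (simp add: ip_cmult_right)
qed

lemma L2m_next:
  assumes "f \<in> L2m r II"
  shows "abs_cont_on II (nderiv II k f)" "nderiv II (Suc k) f \<in> L2 II"
    "x \<in> {-1<..<1} \<Longrightarrow> nderiv II (Suc k) f x = vector_derivative (nderiv II k f) (at x)"
proof -
  consider "r = 1" "k = 0" | "r = 2" "k = 0" | "r = 2" "k = 1" using rk by auto
  then show "abs_cont_on II (nderiv II k f)" "nderiv II (Suc k) f \<in> L2 II"
    using assms L2m_1D(1,2)[of f] L2m_2D(1,2,7,8)[of f] by (cases; simp add: numeral_2_eq_2)+
  show "x \<in> {-1<..<1} \<Longrightarrow> nderiv II (Suc k) f x = vector_derivative (nderiv II k f) (at x)"
    by (simp add: nderiv_Suc at_within_II_interior)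
qed

text \<open>If \<open>r = Suc k\<close>, the next derivative is the top one,
  \<open>\<sigma> * l * U\<close>, and the bound holds with the constant \<open>l\<close>. The
  remaining case \<open>r = 2\<close>, \<open>k = 0\<close> is what the assumption
  \<open>V_next\<close> supplies.\<close>

lemma V_next_bound:
  assumes l: "0 \<le> l"
  shows "\<exists>C. \<forall>s\<in>{-1<..<1}. \<forall>t\<in>{-1<..<1}.
      (norm2 (\<lambda>x. nderiv II (Suc k) (V l t) x - nderiv II (Suc k) (V l s) x))\<^sup>2 \<le>
      C * ((norm2 (\<lambda>x. V l t x - V l s x))\<^sup>2 + l * (norm2 (\<lambda>x. U l t x - U l s x))\<^sup>2)"
proof (cases "Suc k < r")
  case True
  then show ?thesis using V_next[OF l] by blast
next
  case False
  then have r: "r = Suc k" using rk by auto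
  show ?thesis
  proof (intro exI[of _ l] ballI)
    fix s t :: real assume st: "s \<in> {-1<..<1}" "t \<in> {-1<..<1}"
    have st': "s \<in> {-1..<1}" "t \<in> {-1..<1}" using st by auto
    have L: "nderiv II (Suc k) (V l t) \<in> L2 II" "nderiv II (Suc k) (V l s) \<in> L2 II"
      using L2m_next(2) V_in_L2m l st' by blast+
    have "norm2 (\<lambda>x. nderiv II (Suc k) (V l t) x - nderiv II (Suc k) (V l s) x) =
          norm2 (\<lambda>x. (\<sigma> * l) * (U l t x - U l s x))"
    proof (rule norm2_cong_AE)
      show "(\<lambda>x. nderiv II (Suc k) (V l t) x - nderiv II (Suc k) (V l s) x) \<in> L2 II" by (rule L2_diff[OF L])
      show "(\<lambda>x. (\<sigma> * l) * (U l t x - U l s x)) \<in> L2 II" using l st' by (intro L2_cmult L2_diff U_L2)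
      show "AE x in lebesgue_on II. nderiv II (Suc k) (V l t) x - nderiv II (Suc k) (V l s) x = (\<sigma> * l) * (U l t x - U l s x)"
        using V_top[OF l st'(1), of 1] V_top[OF l st'(2), of 1] unfolding r
        by eventually_elim (simp add: algebra_simps)
    qed
    then have "(norm2 (\<lambda>x. nderiv II (Suc k) (V l t) x - nderiv II (Suc k) (V l s) x))\<^sup>2 =
        (\<sigma> * \<sigma>) * l * (l * (norm2 (\<lambda>x. U l t x - U l s x))\<^sup>2)"
      by (simp add: norm2_cmult power_mult_distrib power2_eq_square[of "\<sigma>"] power2_eq_square[of l])
    also have "\<dots> \<le> l * ((norm2 (\<lambda>x. V l t x - V l s x))\<^sup>2 + l * (norm2 (\<lambda>x. U l t x - U l s x))\<^sup>2)"
      unfolding sigma using l by (simp add: mult_left_mono)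
    finally show "(norm2 (\<lambda>x. nderiv II (Suc k) (V l t) x - nderiv II (Suc k) (V l s) x))\<^sup>2 \<le>
      l * ((norm2 (\<lambda>x. V l t x - V l s x))\<^sup>2 + l * (norm2 (\<lambda>x. U l t x - U l s x))\<^sup>2)" .
  qed
qed

text \<open>The squared distance of the representers at \<open>t\<close> and \<open>s\<close> is the increment of the \<open>k\<close>-th derivative
  of their difference, which is bounded by the distance itself times $\sqrt{|t-s|}$.\<close>
lemma V_continuous:
  assumes l: "0 \<le> l"
  shows "\<exists>C. \<forall>s\<in>{-1<..<1}. \<forall>t\<in>{-1<..<1}. (norm2 (\<lambda>x. V l t x - V l s x))\<^sup>2 \<le> C * \<bar>t - s\<bar>"
proof -
  define D where "D s t = (norm2 (\<lambda>x. V l t x - V l s x))\<^sup>2 + l * (norm2 (\<lambda>x. U l t x - U l s x))\<^sup>2" for s t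
  obtain C where C: "\<And>s t. s \<in> {-1<..<1} \<Longrightarrow> t \<in> {-1<..<1} \<Longrightarrow>
      (norm2 (\<lambda>x. nderiv II (Suc k) (V l t) x - nderiv II (Suc k) (V l s) x))\<^sup>2 \<le> C * D s t"
    unfolding D_def using V_next_bound[OF l] by blast
  have D_sym: "D s t = D t s" for s t
    unfolding D_def norm2_def by (simp add: power2_commute)
  have D_pos: "0 \<le> D s t" for s t unfolding D_def using l by simp
  have main: "D s t \<le> \<bar>C\<bar> * (t - s)" if st: "s \<in> {-1<..<1}" "t \<in> {-1<..<1}" "s \<le> t" for s t
  proof -
    have st': "s \<in> {-1..<1}" "t \<in> {-1..<1}" using st by auto
    have Vm: "V l s \<in> L2m r II" "V l t \<in> L2m r II" using l st' by (auto intro: V_in_L2m)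
    have L: "nderiv II (Suc k) (V l t) \<in> L2 II" "nderiv II (Suc k) (V l s) \<in> L2 II"
      using L2m_next(2) Vm by blast+
    have ftc: "(nderiv II (Suc k) f has_integral (nderiv II k f t - nderiv II k f s)) {s..t}" if "f \<in> L2m r II" for f
    proof -
      have "((\<lambda>x. vector_derivative (nderiv II k f) (at x)) has_integral (nderiv II k f t - nderiv II k f s)) {s..t}"
        using st by (intro fundamental_theorem_of_calculus_abs_cont abs_cont_on_subset[OF L2m_next(1)[OF that]]) auto
      then show ?thesis
        by (rule has_integral_eq[rotated]) (use L2m_next(3)[OF that] st in auto)
    qed
    \<comment> \<open>Reproducing kernel identity: \<open>rep\<close> is applied to the representer
      at \<open>b\<close>, whose top derivative is \<open>\<sigma> * l * U\<close>. The right side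
      is symmetric in \<open>a\<close> and \<open>b\<close>, so the squared distance becomes a
      second difference of kernel values.\<close>
    have rp: "nderiv II k (V l b) a = ip (V l a) (V l b) + l * ip (U l a) (U l b)"
      if "a \<in> {-1..<1}" "b \<in> {-1..<1}" for a b
    proof -
      have "nderiv II k (V l b) a = ip (V l a) (V l b) + \<sigma> * (\<sigma> * l * ip (U l a) (U l b))"
        using l that by (simp add: rep[of l a "V l b"] V_in_L2m ip_top_V U_L2)
      also have "\<sigma> * (\<sigma> * l * ip (U l a) (U l b)) = (\<sigma> * \<sigma>) * (l * ip (U l a) (U l b))" by simp
      finally show ?thesis by (simp add: sigma)
    qed
    let ?I = "(nderiv II k (V l t) t - nderiv II k (V l t) s) - (nderiv II k (V l s) t - nderiv II k (V l s) s)"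
    have "D s t = ?I"
      unfolding D_def using l st'
      by (simp add: rp norm2_diff_sq V_L2 U_L2 norm2_sq[symmetric] ip_commute[of "V l t" "V l s"]
            ip_commute[of "U l t" "U l s"] algebra_simps)
    moreover have "\<bar>?I\<bar> \<le> sqrt (t - s) * norm2 (\<lambda>x. nderiv II (Suc k) (V l t) x - nderiv II (Suc k) (V l s) x)"
      using st by (intro integral_bound_norm2 L2_diff L has_integral_diff ftc Vm) auto
    ultimately have "D s t \<le> sqrt (t - s) * norm2 (\<lambda>x. nderiv II (Suc k) (V l t) x - nderiv II (Suc k) (V l s) x)"
      by linarith
    then have "(D s t)\<^sup>2 \<le> (sqrt (t - s) * norm2 (\<lambda>x. nderiv II (Suc k) (V l t) x - nderiv II (Suc k) (V l s) x))\<^sup>2"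
      using D_pos by (rule power_mono)
    also have "\<dots> \<le> (t - s) * (C * D s t)"
      using st C[of s t] by (simp add: power_mult_distrib mult_left_mono)
    also have "\<dots> \<le> (t - s) * (\<bar>C\<bar> * D s t)"
      using st D_pos[of s t] by (intro mult_left_mono mult_right_mono) auto
    finally have "D s t * D s t \<le> (\<bar>C\<bar> * (t - s)) * D s t" by (simp add: power2_eq_square mult_ac)
    then show ?thesis
      using D_pos[of s t] st by (cases "D s t = 0") (auto simp: mult_le_cancel_right)
  qed
  show ?thesis
  proof (intro exI[of _ "\<bar>C\<bar>"] ballI)
    fix s t :: real assume st: "s \<in> {-1<..<1}" "t \<in> {-1<..<1}"
    have "(norm2 (\<lambda>x. V l t x - V l s x))\<^sup>2 \<le> D s t" using l by (simp add: D_def)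
    also have "\<dots> \<le> \<bar>C\<bar> * \<bar>t - s\<bar>"
      using main[of s t] main[of t s] D_sym[of s t] st by (cases "s \<le> t") auto
    finally show "(norm2 (\<lambda>x. V l t x - V l s x))\<^sup>2 \<le> \<bar>C\<bar> * \<bar>t - s\<bar>" .
  qed
qed

text \<open>Representing \<open>V m t\<close> by the pair of parameter \<open>l\<close> gives a
  value that does not depend on \<open>l\<close>. Hence, in the inner product weighted by
  \<open>m\<close>, the difference of two representing pairs is orthogonal to the pair of parameter
  \<open>m\<close>.\<close>

lemma ip_V_V:
  assumes "0 \<le> l" "0 \<le> m" "t \<in> {-1..<1}"
  shows "ip (V l t) (V m t) + m * ip (U l t) (U m t) = G m t"
proof -
  have "G m t = ip (V l t) (V m t) + \<sigma> * (\<sigma> * m * ip (U l t) (U m t))"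
    unfolding G_def using assms by (simp add: rep[of l t "V m t"] V_in_L2m ip_top_V U_L2)
  also have "\<sigma> * (\<sigma> * m * ip (U l t) (U m t)) = (\<sigma> * \<sigma>) * (m * ip (U l t) (U m t))" by simp
  finally show ?thesis by (simp add: sigma)
qed

lemma G_eq: "0 \<le> l \<Longrightarrow> t \<in> {-1..<1} \<Longrightarrow> G l t = (nV l t)\<^sup>2 + l * (nU l t)\<^sup>2"
  using ip_V_V[of l l t] by (simp add: norm2_sq)

text \<open>This is the orthogonality of the difference of the pairs to the pair of parameter
  \<open>m\<close>; minimality of \<open>G m t\<close> follows at once.\<close>

lemma pythagoras:
  assumes "0 \<le> l" "0 \<le> m" "t \<in> {-1..<1}"
  shows "(dV l m t)\<^sup>2 + m * (dU l m t)\<^sup>2 = (nV l t)\<^sup>2 + m * (nU l t)\<^sup>2 - G m t"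
proof -
  have "(dV l m t)\<^sup>2 + m * (dU l m t)\<^sup>2 =
     (nV l t)\<^sup>2 + m * (nU l t)\<^sup>2 - 2 * (ip (V l t) (V m t) + m * ip (U l t) (U m t)) + ((nV m t)\<^sup>2 + m * (nU m t)\<^sup>2)"
    using assms by (simp add: norm2_diff_sq V_L2 U_L2 algebra_simps)
  then show ?thesis unfolding ip_V_V[OF assms] using G_eq[OF assms(2,3)] by simp
qed

lemma G_min: "0 \<le> l \<Longrightarrow> 0 \<le> m \<Longrightarrow> t \<in> {-1..<1} \<Longrightarrow> G m t \<le> (nV l t)\<^sup>2 + m * (nU l t)\<^sup>2"
proof -
  assume *: "0 \<le> l" "0 \<le> m" "t \<in> {-1..<1}"
  have "0 \<le> (dV l m t)\<^sup>2 + m * (dU l m t)\<^sup>2" using * by simp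
  then show ?thesis using pythagoras[OF *] by simp
qed

text \<open>Add the Pythagorean identities for (l, m) and (m, l): the terms in \<open>nV\<close>
  cancel. Monotonicity of \<open>nU\<close> and the modulus of continuity in the parameter both come
  from here.\<close>

lemma difference_identity:
  assumes "0 \<le> l" "0 \<le> m" "t \<in> {-1..<1}"
  shows "2 * (dV l m t)\<^sup>2 + (l + m) * (dU l m t)\<^sup>2 = (l - m) * ((nU m t)\<^sup>2 - (nU l t)\<^sup>2)"
proof -
  have "dV m l t = dV l m t" "dU m l t = dU l m t"
    unfolding norm2_def by (simp_all add: power2_commute)
  then show ?thesis
    using pythagoras[of l m t] pythagoras[of m l t] G_eq[of l t] G_eq[of m t] assms
    by (simp add: algebra_simps)
qed

lemma nU_antimono: 
  assumes "0 \<le> m" "m \<le> l" "t \<in> {-1..<1}"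
  shows "nU l t \<le> nU m t"
proof (cases "l = m")
  case False
  have "0 \<le> 2 * (dV l m t)\<^sup>2 + (l + m) * (dU l m t)\<^sup>2" using assms by simp
  also have "\<dots> = (l - m) * ((nU m t)\<^sup>2 - (nU l t)\<^sup>2)"
    using assms by (intro difference_identity) auto
  finally have "0 \<le> (l - m) * ((nU m t)\<^sup>2 - (nU l t)\<^sup>2)" .
  then have "(nU l t)\<^sup>2 \<le> (nU m t)\<^sup>2" using False assms by (simp add: zero_le_mult_iff)
  then show ?thesis using norm2_nonneg by (meson power2_le_imp_le)
qed simp

lemma nU_square_antimono: "0 \<le> m \<Longrightarrow> m \<le> l \<Longrightarrow> t \<in> {-1..<1} \<Longrightarrow> (nU l t)\<^sup>2 \<le> (nU m t)\<^sup>2"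
  by (intro power_mono nU_antimono norm2_nonneg)

lemma dV_bound:
  assumes "0 \<le> l" "0 \<le> m" "t \<in> {-1..<1}"
  shows "2 * (dV l m t)\<^sup>2 \<le> \<bar>l - m\<bar> * (nU 0 t)\<^sup>2"
proof -
  have "2 * (dV l m t)\<^sup>2 \<le> 2 * (dV l m t)\<^sup>2 + (l + m) * (dU l m t)\<^sup>2" using assms by simp
  also have "\<dots> = (l - m) * ((nU m t)\<^sup>2 - (nU l t)\<^sup>2)" by (rule difference_identity[OF assms])
  also have "\<dots> \<le> \<bar>l - m\<bar> * \<bar>(nU m t)\<^sup>2 - (nU l t)\<^sup>2\<bar>"
    by (simp add: abs_mult[symmetric])
  also have "\<dots> \<le> \<bar>l - m\<bar> * (nU 0 t)\<^sup>2"
  proof (intro mult_left_mono)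
    have "(nU m t)\<^sup>2 \<le> (nU 0 t)\<^sup>2" "(nU l t)\<^sup>2 \<le> (nU 0 t)\<^sup>2" using assms by (auto intro: nU_square_antimono)
    then show "\<bar>(nU m t)\<^sup>2 - (nU l t)\<^sup>2\<bar> \<le> (nU 0 t)\<^sup>2"
      using zero_le_power2[of "nU m t"] zero_le_power2[of "nU l t"] by linarith
  qed simp
  finally show ?thesis .
qed

lemma nV_diff:
  assumes "0 \<le> m" "m \<le> l" "t \<in> {-1..<1}"
  shows "(dV l m t)\<^sup>2 \<le> (nV l t)\<^sup>2 - (nV m t)\<^sup>2"
proof -
  have "(nV l t)\<^sup>2 - (nV m t)\<^sup>2 = (dV l m t)\<^sup>2 + m * (dU l m t)\<^sup>2 + m * ((nU m t)\<^sup>2 - (nU l t)\<^sup>2)"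
    using pythagoras[of l m t] G_eq[of m t] assms by (simp add: algebra_simps)
  moreover have "0 \<le> m * (dU l m t)\<^sup>2" "0 \<le> m * ((nU m t)\<^sup>2 - (nU l t)\<^sup>2)"
    using assms nU_square_antimono[of m l t] by auto
  ultimately show ?thesis by linarith
qed

lemma nV_mono:
  assumes "0 \<le> m" "m \<le> l" "t \<in> {-1..<1}"
  shows "nV m t \<le> nV l t"
proof -
  have "(nV m t)\<^sup>2 \<le> (nV l t)\<^sup>2" using nV_diff[OF assms] zero_le_power2[of "dV l m t"] by linarith
  then show ?thesis using norm2_nonneg by (meson power2_le_imp_le)
qed

text \<open>If \<open>nU\<close> vanished at \<open>l\<close>, it would vanish at all larger
  parameters by monotonicity, so \<open>V\<close> and with it \<open>G\<close> would stop changing,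
  whereas \<open>G\<close> tends to infinity.\<close>

lemma nU_pos:
  assumes "0 \<le> l" "t \<in> {-1..<1}"
  shows "0 < nU l t"
proof (rule ccontr)
  assume "\<not> 0 < nU l t"
  then have z: "nU l t = 0" using norm2_nonneg[of "U l t"] by simp
  have "G m t = (nV l t)\<^sup>2" if m: "m \<ge> l" for m
  proof -
    have zm: "nU m t = 0"
      using nU_antimono[of l m t] z m assms norm2_nonneg[of "U m t"] by simp
    then have "2 * (dV m l t)\<^sup>2 + (m + l) * (dU m l t)\<^sup>2 = 0"
      using difference_identity[of m l t] z m assms by simp
    moreover have "0 \<le> (m + l) * (dU m l t)\<^sup>2" using m assms by simp
    ultimately have "(dV m l t)\<^sup>2 \<le> 0" by linarith
    then have "dV m l t = 0" by simp
    then have "nV m t = nV l t"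
      using norm2_triangle_diff[of "V m t" "V l t"] V_L2 m assms by simp
    then show ?thesis using G_eq[of m t] zm m assms by simp
  qed
  moreover have "eventually (\<lambda>m. (nV l t)\<^sup>2 < G m t) at_top"
    using G_at_top[OF assms(2)] by (simp add: filterlim_at_top_dense G_def)
  then have "eventually (\<lambda>m. (nV l t)\<^sup>2 < G m t \<and> l \<le> m) at_top"
    using eventually_ge_at_top by (rule eventually_conj)
  then obtain m where "(nV l t)\<^sup>2 < G m t" "l \<le> m"
    by (auto dest: eventually_happens)
  ultimately show False by simp
qed

text \<open>Equality forces both differences to have norm 0, the second by \<open>poincare\<close>.
  The two functions \<open>V\<close> then agree with their top derivatives, so
  \<open>l * U = m * U\<close> almost everywhere, which contradicts \<open>nU_pos\<close>.\<close>

lemma nV_strict_mono: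
  assumes "0 \<le> m" "m < l" "t \<in> {-1..<1}"
  shows "nV m t < nV l t"
proof (rule ccontr)
  assume "\<not> nV m t < nV l t"
  then have "nV m t = nV l t" using nV_mono[of m l t] assms by simp
  then have "(dV l m t)\<^sup>2 \<le> 0" using nV_diff[of m l t] assms by simp
  then have dV: "dV l m t = 0" by simp
  have dU: "dU l m t = 0" using poincare[of l m t] dV assms norm2_nonneg[of "\<lambda>x. U l t x - U m t x"] by simp
  have Vc: "continuous_on II (V l t)" "continuous_on II (V m t)"
    using assms by (auto intro!: L2m_continuous V_in_L2m)
  have eq0: "AE x in lebesgue_on II. f x = 0" if "norm2 f = 0" "f \<in> L2 II" for f
  proof -
    have "(LINT x|lebesgue_on II. (f x)\<^sup>2) = 0" using that(1) by (simp add: norm2_def)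
    moreover have "integrable (lebesgue_on II) (\<lambda>x. (f x)\<^sup>2)" using that(2) by (simp add: L2_def)
    ultimately have "AE x in lebesgue_on II. (f x)\<^sup>2 = 0"
      by (subst (asm) integral_nonneg_eq_0_iff_AE) auto
    then show ?thesis by eventually_elim simp
  qed
  have VL: "(\<lambda>x. V l t x - V m t x) \<in> L2 II" "(\<lambda>x. U l t x - U m t x) \<in> L2 II"
    using assms by (auto intro!: L2_diff V_L2 U_L2)
  have "V l t x = V m t x" if "x \<in> II" for x
  proof -
    have "AE x in lebesgue_on II. \<bar>V l t x - V m t x\<bar> \<le> 0" using eq0[OF dV VL(1)] by simp
    then show ?thesis
      using AE_bound_continuous[of "\<lambda>x. V l t x - V m t x" 0 x] that Vc by (auto intro: continuous_on_diff)
  qed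
  then have nd: "nderiv II r (V l t) x = nderiv II r (V m t) x" if "x \<in> II" for x
    using that by (rule nderiv_cong_on)
  have "AE x in lebesgue_on II. nderiv II r (V l t) x = \<sigma> * l * U l t x"
       "AE x in lebesgue_on II. nderiv II r (V m t) x = \<sigma> * m * U m t x"
    using V_top[of l t 1] V_top[of m t 1] assms by simp_all
  moreover have "AE x in lebesgue_on II. nderiv II r (V l t) x = nderiv II r (V m t) x"
    by (rule AE_I2) (use nd in simp)
  moreover have "AE x in lebesgue_on II. U l t x - U m t x = 0" by (rule eq0[OF dU VL(2)])
  ultimately have "AE x in lebesgue_on II. U l t x = 0"
  proof eventually_elim
    case (elim x)
    have "U m t x = U l t x" using elim(4) by simp
    then have "\<sigma> * l * U l t x = \<sigma> * m * U l t x" using elim(1-3) by metis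
    then have "\<sigma> * ((l - m) * U l t x) = 0" by (simp add: algebra_simps)
    moreover have "\<sigma> \<noteq> 0" using sigma by auto
    ultimately show ?case using assms(2) by simp
  qed
  then have "norm2 (U l t) = norm2 (\<lambda>x. 0)"
    using assms by (intro norm2_cong_AE U_L2 L2_continuous_on) auto
  then show False using nU_pos[of l t] assms by (simp add: norm2_zero)
qed

text \<open>The pair of parameter \<open>l\<close> competes in the minimum that defines
  \<open>G m t\<close>. Since \<open>l * (nU l t)^2\<close> is at most \<open>G l (-1)\<close>,
  which is o(l), a bound on \<open>nV\<close> would bound \<open>G m t\<close> for all
  \<open>m\<close>.\<close>

lemma nV_unbounded:
  assumes t: "t \<in> {-1..<1}"
  shows "\<exists>l\<ge>0. N < nV l t"
proof (rule ccontr)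
  assume "\<not> ?thesis"
  then have N: "nV l t \<le> N" if "l \<ge> 0" for l using that by force
  have "G m t \<le> N\<^sup>2" if m: "m \<ge> 0" for m
  proof (rule tendsto_lowerbound)
    show "((\<lambda>l. N\<^sup>2 + m * (G l (-1) / l)) \<longlongrightarrow> N\<^sup>2) at_top"
      using tendsto_add[OF tendsto_const[of "N\<^sup>2"] tendsto_mult[OF tendsto_const[of m] G_sublinear]]
      by (simp add: G_def)
    show "\<forall>\<^sub>F l in at_top. G m t \<le> N\<^sup>2 + m * (G l (-1) / l)"
      using eventually_gt_at_top[of 0]
    proof eventually_elim
      case (elim l)
      have "G m t \<le> (nV l t)\<^sup>2 + m * (nU l t)\<^sup>2" using G_min elim m t by simp
      also have "\<dots> \<le> N\<^sup>2 + m * (G l (-1) / l)"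
      proof (intro add_mono power_mono mult_left_mono)
        have "l * (nU l t)\<^sup>2 \<le> G l t" using G_eq[of l t] elim t by simp
        also have "\<dots> \<le> G l (-1)" using G_le elim t by (simp add: G_def)
        finally show "(nU l t)\<^sup>2 \<le> G l (-1) / l" using elim by (simp add: field_simps)
      qed (use N elim m norm2_nonneg in auto)
      finally show ?case .
    qed
  qed simp
  moreover have "eventually (\<lambda>m. N\<^sup>2 < G m t) at_top"
    using G_at_top[OF t] by (simp add: filterlim_at_top_dense G_def)
  then have "eventually (\<lambda>m. N\<^sup>2 < G m t \<and> 0 \<le> m) at_top"
    using eventually_ge_at_top by (rule eventually_conj)
  then obtain m where "N\<^sup>2 < G m t" "0 \<le> m"
    by (auto dest: eventually_happens)
  ultimately show False by force
qed

lemma nV_continuous: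
  assumes t: "t \<in> {-1..<1}"
  shows "continuous_on {0..} (\<lambda>l. nV l t)"
proof (rule continuous_on_if_square_lipschitz)
  fix l m :: real assume lm: "l \<in> {0..}" "m \<in> {0..}"
  have "\<bar>nV l t - nV m t\<bar> \<le> dV l m t" using lm t by (intro norm2_triangle_diff V_L2) auto
  then have "\<bar>nV l t - nV m t\<bar>\<^sup>2 \<le> (dV l m t)\<^sup>2" by (intro power_mono) auto
  also have "\<dots> \<le> (nU 0 t)\<^sup>2 * \<bar>l - m\<bar>"
  proof -
    have "2 * (dV l m t)\<^sup>2 \<le> (nU 0 t)\<^sup>2 * \<bar>l - m\<bar>" using dV_bound[of l m t] lm t by (simp add: mult.commute)
    then show ?thesis using zero_le_power2[of "dV l m t"] by linarith
  qed
  finally show "(nV l t - nV m t)\<^sup>2 \<le> (nU 0 t)\<^sup>2 * \<bar>l - m\<bar>" by simp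
qed

text \<open>\<open>difference_identity\<close> controls the distance of the functions
  \<open>V\<close> up to parameter 0; \<open>poincare\<close> passes this control on to
  \<open>U\<close>.\<close>

lemma nU_tendsto:
  assumes "0 \<le> m" and t: "t \<in> {-1..<1}"
  shows "((\<lambda>l. nU l t) \<longlongrightarrow> nU m t) (at_right m)"
proof -
  have "continuous_on {0..} (\<lambda>l. nU l t)"
  proof (rule continuous_on_if_square_lipschitz)
    fix l m :: real assume lm: "l \<in> {0..}" "m \<in> {0..}"
    have "\<bar>nU l t - nU m t\<bar> \<le> dU l m t" using lm t by (intro norm2_triangle_diff U_L2) auto
    also have "\<dots> \<le> 4 * dV l m t" using lm t by (intro poincare) auto
    finally have "\<bar>nU l t - nU m t\<bar>\<^sup>2 \<le> (4 * dV l m t)\<^sup>2" by (intro power_mono) auto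
    also have "\<dots> = 8 * (2 * (dV l m t)\<^sup>2)" by (simp add: power_mult_distrib)
    also have "\<dots> \<le> 8 * (\<bar>l - m\<bar> * (nU 0 t)\<^sup>2)" using dV_bound[of l m t] lm t by (intro mult_left_mono) auto
    finally show "(nU l t - nU m t)\<^sup>2 \<le> (8 * (nU 0 t)\<^sup>2) * \<bar>l - m\<bar>" by (simp add: mult_ac)
  qed
  then have "((\<lambda>l. nU l t) \<longlongrightarrow> nU m t) (at m within {0..})"
    using assms(1) by (simp add: continuous_on_def)
  then show ?thesis by (rule tendsto_within_subset) (use assms(1) in auto)
qed

section \<open>The parameter \<open>lm N t\<close> and continuity of the operator in
  \<open>t\<close>\<close>

definition M0 :: real where "M0 = nV 0 (-1)"

text \<open>The comparison \<open>G_le\<close> is available for positive parameters only. It is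
  squeezed between \<open>nV\<close> and the competitor of parameter 0 at the endpoint, and the
  parameter tends to 0 from the right.\<close>

lemma nV_0_le:
  assumes t: "t \<in> {-1..<1}"
  shows "nV 0 t \<le> M0"
proof -
  have "(nV 0 t)\<^sup>2 \<le> M0\<^sup>2"
  proof (rule tendsto_lowerbound)
    show "((\<lambda>l. M0\<^sup>2 + l * (nU 0 (-1))\<^sup>2) \<longlongrightarrow> M0\<^sup>2) (at_right 0)"
      by (auto intro!: tendsto_eq_intros)
    show "\<forall>\<^sub>F l in at_right 0. (nV 0 t)\<^sup>2 \<le> M0\<^sup>2 + l * (nU 0 (-1))\<^sup>2"
      using eventually_at_right_less[of 0]
    proof eventually_elim
      case (elim l)
      have "(nV 0 t)\<^sup>2 \<le> (nV l t)\<^sup>2" using nV_mono[of 0 l t] elim t norm2_nonneg by (intro power_mono) auto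
      also have "\<dots> \<le> G l t" using G_eq[of l t] elim t by simp
      also have "\<dots> \<le> G l (-1)" using G_le elim t by (simp add: G_def)
      also have "\<dots> \<le> M0\<^sup>2 + l * (nU 0 (-1))\<^sup>2" using G_min[of 0 l "-1"] elim by (simp add: M0_def)
      finally show ?case .
    qed
  qed simp
  then show ?thesis unfolding M0_def using norm2_nonneg by (meson power2_le_imp_le)
qed

text \<open>\<open>nV_0_le\<close> puts the starting value below \<open>N\<close> for all
  \<open>t\<close> at once; unboundedness and the intermediate value theorem give existence, strict
  monotonicity gives uniqueness.\<close>

lemma ex1_nV:
  assumes N: "M0 \<le> N" and t: "t \<in> {-1..<1}"
  shows "\<exists>!l. 0 \<le> l \<and> nV l t = N"
proof -
  obtain L where L: "L \<ge> 0" "N < nV L t" using nV_unbounded[OF t] by blast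
  have "\<exists>l. 0 \<le> l \<and> l \<le> L \<and> nV l t = N"
    using nV_0_le[OF t] N L continuous_on_subset[OF nV_continuous[OF t]]
    by (intro IVT') auto
  moreover have "l = m" if "0 \<le> l" "0 \<le> m" "nV l t = nV m t" for l m
    using nV_strict_mono[of l m t] nV_strict_mono[of m l t] that t by (cases l m rule: linorder_cases) auto
  ultimately show ?thesis by (metis (no_types))
qed

definition lm :: "real \<Rightarrow> real \<Rightarrow> real" where "lm N t = (THE l. 0 \<le> l \<and> nV l t = N)"

lemma lm:
  assumes "M0 \<le> N" "t \<in> {-1..<1}"
  shows "0 \<le> lm N t" "nV (lm N t) t = N"
  using theI'[OF ex1_nV[OF assms]] by (auto simp: lm_def)


text \<open>Nothing is claimed about the chosen solution at -1, \<open>t\<close> and 1; membership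
  in \<open>L2\<close> and almost everywhere equality ignore these points.\<close>

lemma u_sol_deriv_L2:
  assumes "0 \<le> l" "t \<in> {-1..<1}"
  shows "u_sol_deriv r k l t \<in> L2 II" "AE x in lebesgue_on II. u_sol_deriv r k l t x = V l t x"
proof -
  have *: "u_sol_deriv r k l t x = V l t x" if "x \<in> II - {-1, t, 1}" for x
    using that by (intro u_sol_deriv_eq assms) auto
  show "u_sol_deriv r k l t \<in> L2 II"
    by (rule L2_finite_change[OF V_L2[OF assms], of "{-1, t, 1}"]) (use * in auto)
  show "AE x in lebesgue_on II. u_sol_deriv r k l t x = V l t x"
    by (rule AE_II_except_finite[of "{-1, t, 1}"]) (use * in auto)
qed

lemma norm2_u_sol_deriv: "0 \<le> l \<Longrightarrow> t \<in> {-1..<1} \<Longrightarrow> norm2 (u_sol_deriv r k l t) = nV l t"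
  using norm2_cong_AE u_sol_deriv_L2 V_L2 by blast

lemma norm2_u_end_deriv:
  assumes "0 \<le> l"
  shows "norm2 (nderiv II r (u_end r k l)) = nV l (-1)"
proof -
  have V: "V l (-1) \<in> L2 II" using assms by (intro V_L2) auto
  have *: "nderiv II r (u_end r k l) x = V l (-1) x" if "x \<in> II - {-1, 1}" for x
    using that assms by (intro u_end_deriv_eq) auto
  show ?thesis
    by (intro norm2_cong_AE[OF _ V] L2_finite_change[OF V, of "{-1, 1}"] AE_II_except_finite[of "{-1, 1}"])
       (use * in auto)
qed

lemma norm2_u_end:
  assumes "0 \<le> l"
  shows "norm2 (u_end r k l) = nU l (-1)"
proof -
  have V: "U l (-1) \<in> L2 II" using assms by (intro U_L2) auto
  have *: "u_end r k l x = U l (-1) x" if "x \<in> II - {-1, 1}" for x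
    using that assms by (intro u_end_eq) auto
  show ?thesis
    by (intro norm2_cong_AE[OF _ V] L2_finite_change[OF V, of "{-1, 1}"] AE_II_except_finite[of "{-1, 1}"])
       (use * in auto)
qed

lemma lam_eq: "t \<in> {-1..<1} \<Longrightarrow> lam r k N t = lm N t"
  unfolding lam_def lm_def by (intro arg_cong[where f = The] ext) (auto simp: norm2_u_sol_deriv)

lemma lam_1_eq: "lam r k N 1 = lm N (-1)"
  unfolding lam_def lm_def by (intro arg_cong[where f = The] ext) (auto simp: norm2_u_sol_deriv_1)

lemma lam_end_eq: "lam_end r k N = lm N (-1)"
  unfolding lam_end_def lm_def by (intro arg_cong[where f = The] ext) (auto simp: norm2_u_end_deriv)

lemma S_op_eq:
  assumes "M0 \<le> N" "t \<in> {-1..<1}" "f \<in> L2 II"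
  shows "S_op r k N f t = ip (V (lm N t) t) f"
proof -
  have "S_op r k N f t = ip (u_sol_deriv r k (lm N t) t) f"
    using assms(2) by (simp add: S_op_def ip_def lam_eq)
  also have "\<dots> = ip (V (lm N t) t) f"
    using u_sol_deriv_L2[of "lm N t" t] lm[OF assms(1,2)] assms
    by (intro ip_cong_AE V_L2) auto
  finally show ?thesis .
qed

text \<open>At parameter 0 the quantity \<open>G\<close> carries no information on \<open>U\<close>,
  so the bound is imported from parameter 1, where \<open>G 1 (-1)\<close> controls both norms. The
  constant 9 is 1 for \<open>nU 1 t\<close> plus 4 from \<open>poincare\<close> times 2 for the
  distance of the functions \<open>V\<close>.\<close>

lemma nU_0_bounded: "\<exists>B. \<forall>t\<in>{-1..<1}. nU 0 t \<le> B"
proof (intro exI ballI)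
  fix t :: real assume t: "t \<in> {-1..<1}"
  let ?g = "sqrt (G 1 (-1))"
  have g: "(nV 1 t)\<^sup>2 + 1 * (nU 1 t)\<^sup>2 \<le> G 1 (-1)"
    using G_eq[of 1 t] G_le[of 1 t] t by (simp add: G_def)
  then have "nV 1 t \<le> ?g" "nU 1 t \<le> ?g"
    using zero_le_power2[of "nV 1 t"] zero_le_power2[of "nU 1 t"]
    by (intro real_le_rsqrt; linarith)+
  moreover have "nU 0 t - nU 1 t \<le> dU 0 1 t"
    using norm2_triangle_diff[of "U 0 t" "U 1 t"] U_L2 t by auto
  moreover have "dU 0 1 t \<le> 4 * dV 0 1 t" using t by (intro poincare) auto
  moreover have "dV 0 1 t \<le> 2 * ?g"
  proof -
    have "(dV 0 1 t)\<^sup>2 = (nV 0 t)\<^sup>2 - 2 * ip (V 0 t) (V 1 t) + (nV 1 t)\<^sup>2"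
      using t by (intro norm2_diff_sq V_L2) auto
    also have "\<dots> \<le> (nV 0 t)\<^sup>2 + 2 * (nV 0 t * nV 1 t) + (nV 1 t)\<^sup>2"
    proof -
      have "\<bar>ip (V 0 t) (V 1 t)\<bar> \<le> nV 0 t * nV 1 t"
        using t by (intro ip_Cauchy_Schwarz V_L2) auto
      then show ?thesis by linarith
    qed
    also have "\<dots> = (nV 0 t + nV 1 t)\<^sup>2" by (simp add: power2_sum)
    finally have "dV 0 1 t \<le> nV 0 t + nV 1 t"
      by (rule power2_le_imp_le) (simp add: norm2_nonneg)
    also have "\<dots> \<le> 2 * nV 1 t" using nV_mono[of 0 1 t] t by simp
    finally show ?thesis using \<open>nV 1 t \<le> ?g\<close> by simp
  qed
  ultimately show "nU 0 t \<le> 9 * ?g" by linarith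
qed

lemma nV_continuous_t:
  assumes l: "0 \<le> l"
  shows "continuous_on {-1<..<1} (\<lambda>t. nV l t)"
proof -
  obtain C where C: "\<And>s t. s \<in> {-1<..<1} \<Longrightarrow> t \<in> {-1<..<1} \<Longrightarrow> (norm2 (\<lambda>x. V l t x - V l s x))\<^sup>2 \<le> C * \<bar>t - s\<bar>"
    using V_continuous[OF l] by blast
  show ?thesis
  proof (rule continuous_on_if_square_lipschitz)
    fix t s :: real assume ts: "t \<in> {-1<..<1}" "s \<in> {-1<..<1}"
    have "\<bar>nV l t - nV l s\<bar> \<le> norm2 (\<lambda>x. V l t x - V l s x)"
      using ts l by (intro norm2_triangle_diff V_L2) auto
    then have "\<bar>nV l t - nV l s\<bar>\<^sup>2 \<le> (norm2 (\<lambda>x. V l t x - V l s x))\<^sup>2" by (intro power_mono) auto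
    also have "\<dots> \<le> C * \<bar>t - s\<bar>" using C ts by blast
    finally show "(nV l t - nV l s)\<^sup>2 \<le> C * \<bar>t - s\<bar>" by simp
  qed
qed

lemma lm_less_iff:
  assumes "M0 \<le> N" "t \<in> {-1..<1}" "0 \<le> l"
  shows "lm N t < l \<longleftrightarrow> N < nV l t" "l < lm N t \<longleftrightarrow> nV l t < N"
  using nV_strict_mono[of "lm N t" l t] nV_strict_mono[of l "lm N t" t] lm[OF assms(1,2)] assms(2,3)
  by (cases l "lm N t" rule: linorder_cases; force)+

text \<open>By strict monotonicity, \<open>a < lm N t\<close> means \<open>nV a t < N\<close>, and
  for fixed nonnegative \<open>a\<close> this is an open condition on \<open>t\<close>; likewise
  from above. For negative \<open>a\<close> the lower bound is automatic.\<close>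

lemma lm_continuous:
  assumes N: "M0 \<le> N"
  shows "continuous_on {-1<..<1} (lm N)"
  unfolding continuous_on_def
proof (intro ballI order_tendstoI)
  fix t a :: real assume t: "t \<in> {-1<..<1}"
  have ev: "\<forall>\<^sub>F s in at t within {-1<..<1}. s \<in> {-1<..<1}"
    by (simp add: eventually_at_filter)
  have cont: "((\<lambda>s. nV l s) \<longlongrightarrow> nV l t) (at t within {-1<..<1})" if "0 \<le> l" for l
    using nV_continuous_t[OF that] t by (simp add: continuous_on_def)
  {
    assume a: "a < lm N t"
    show "\<forall>\<^sub>F s in at t within {-1<..<1}. a < lm N s"
    proof (cases "0 \<le> a")
      case True
      then have "nV a t < N" using a lm_less_iff(2)[OF N, of t a] t by simp
      then have "\<forall>\<^sub>F s in at t within {-1<..<1}. nV a s < N"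
        using cont[OF True] by (rule order_tendstoD(2)[rotated])
      then show ?thesis using ev
        by eventually_elim (use True lm_less_iff(2)[OF N, of _ a] in simp)
    next
      case False
      have "a < lm N s" if "s \<in> {-1<..<1}" for s using lm(1)[OF N, of s] that False by simp
      with ev show ?thesis by (simp add: eventually_mono)
    qed
  }
  {
    assume a: "lm N t < a"
    then have a0: "0 \<le> a" using lm(1)[OF N, of t] t by simp
    then have "N < nV a t" using a lm_less_iff(1)[OF N, of t a] t by simp
    then have "\<forall>\<^sub>F s in at t within {-1<..<1}. N < nV a s"
      using cont[OF a0] by (rule order_tendstoD(1)[rotated])
    then show "\<forall>\<^sub>F s in at t within {-1<..<1}. lm N s < a" using ev
      by eventually_elim (use a0 lm_less_iff(1)[OF N, of _ a] in simp)
  }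
qed

text \<open>The change from \<open>t\<close> to \<open>s\<close> is split at the kernel with the old
  parameter and the new point. Changing the parameter costs \<open>dV_bound\<close>, uniform in the
  point by \<open>nU_0_bounded\<close>; changing the point costs \<open>V_continuous\<close>. The
  purpose is measurability.\<close>

lemma S_op_continuous:
  assumes N: "M0 \<le> N" and f: "f \<in> L2 II"
  shows "continuous_on {-1<..<1} (S_op r k N f)"
  unfolding continuous_on_def
proof
  fix t :: real assume t: "t \<in> {-1<..<1}"
  let ?F = "at t within {-1<..<1}" and ?l = "lm N t"
  have ev: "\<forall>\<^sub>F s in ?F. s \<in> {-1<..<1}" by (simp add: eventually_at_filter)
  obtain B where B: "\<And>t. t \<in> {-1..<1} \<Longrightarrow> nU 0 t \<le> B" using nU_0_bounded by blast
  have l: "0 \<le> ?l" using lm(1)[OF N, of t] t by simp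
  obtain C where C: "\<And>s t. s \<in> {-1<..<1} \<Longrightarrow> t \<in> {-1<..<1} \<Longrightarrow> (norm2 (\<lambda>x. V ?l t x - V ?l s x))\<^sup>2 \<le> C * \<bar>t - s\<bar>"
    using V_continuous[OF l] by blast
  have lim_l: "(lm N \<longlongrightarrow> ?l) ?F" using lm_continuous[OF N] t by (simp add: continuous_on_def)
  let ?b = "\<lambda>s. norm2 f * (sqrt (\<bar>lm N s - ?l\<bar> * B\<^sup>2) + sqrt (C * \<bar>s - t\<bar>))"
  have "\<forall>\<^sub>F s in ?F. norm (S_op r k N f s - S_op r k N f t) \<le> ?b s"
    using ev
  proof eventually_elim
    case (elim s)
    have ls: "0 \<le> lm N s" using lm(1)[OF N, of s] elim by simp
    have L: "V (lm N s) s \<in> L2 II" "V ?l s \<in> L2 II" "V ?l t \<in> L2 II"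
      using elim t l ls by (auto intro!: V_L2)
    have "S_op r k N f s - S_op r k N f t = ip (V (lm N s) s) f - ip (V ?l t) f"
      using elim t by (simp add: S_op_eq[OF N _ f])
    also have "\<dots> = ip (\<lambda>x. V (lm N s) s x - V ?l s x) f + ip (\<lambda>x. V ?l s x - V ?l t x) f"
      using L f by (simp add: ip_diff_left)
    finally have "\<bar>S_op r k N f s - S_op r k N f t\<bar> \<le>
        \<bar>ip (\<lambda>x. V (lm N s) s x - V ?l s x) f\<bar> + \<bar>ip (\<lambda>x. V ?l s x - V ?l t x) f\<bar>" by linarith
    also have "\<dots> \<le> dV (lm N s) ?l s * norm2 f + norm2 (\<lambda>x. V ?l s x - V ?l t x) * norm2 f"
      using L f by (intro add_mono ip_Cauchy_Schwarz L2_diff)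
    also have "\<dots> \<le> sqrt (\<bar>lm N s - ?l\<bar> * B\<^sup>2) * norm2 f + sqrt (C * \<bar>s - t\<bar>) * norm2 f"
    proof (intro add_mono mult_right_mono norm2_nonneg real_le_rsqrt)
      show "(norm2 (\<lambda>x. V ?l s x - V ?l t x))\<^sup>2 \<le> C * \<bar>s - t\<bar>" using C elim t by blast
      have "2 * (dV (lm N s) ?l s)\<^sup>2 \<le> \<bar>lm N s - ?l\<bar> * (nU 0 s)\<^sup>2"
        using elim l ls by (intro dV_bound) auto
      also have "\<dots> \<le> \<bar>lm N s - ?l\<bar> * B\<^sup>2"
        using B[of s] elim norm2_nonneg by (intro mult_left_mono power_mono) auto
      finally show "(dV (lm N s) ?l s)\<^sup>2 \<le> \<bar>lm N s - ?l\<bar> * B\<^sup>2"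
        using zero_le_power2[of "dV (lm N s) ?l s"] by linarith
    qed
    finally show ?case by (simp add: algebra_simps)
  qed
  moreover have "(?b \<longlongrightarrow> norm2 f * (sqrt (\<bar>?l - ?l\<bar> * B\<^sup>2) + sqrt (C * \<bar>t - t\<bar>))) ?F"
    by (intro tendsto_intros lim_l)
  then have "(?b \<longlongrightarrow> 0) ?F" by simp
  ultimately have "((\<lambda>s. S_op r k N f s - S_op r k N f t) \<longlongrightarrow> 0) ?F"
    by (rule Lim_null_comparison)
  then show "(S_op r k N f \<longlongrightarrow> S_op r k N f t) ?F"
    by (simp add: LIM_zero_iff)
qed

end

lemma norm2_cong_on:
  assumes "\<And>x. x \<in> II \<Longrightarrow> f x = g x"
  shows "norm2 f = norm2 g"
  unfolding norm2_def by (intro arg_cong[where f = sqrt] Bochner_Integration.integral_cong) (simp_all add: assms)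

lemma ip_zero_on:
  assumes "\<And>x. x \<in> II \<Longrightarrow> g x = 0"
  shows "ip f g = 0"
proof -
  have "ip f g = (LINT x|lebesgue_on II. 0)"
    unfolding ip_def by (intro Bochner_Integration.integral_cong) (simp_all add: assms)
  then show ?thesis by simp
qed

lemma borel_measurable_continuous_on_open_II:
  fixes f :: "real \<Rightarrow> real"
  assumes "continuous_on {-1<..<1} f"
  shows "f \<in> borel_measurable (lebesgue_on II)"
proof -
  have "f \<in> borel_measurable (lebesgue_on {-1<..<1})"
    using assms by (intro continuous_imp_measurable_on_sets_lebesgue) auto
  then have "(\<lambda>x. if x \<in> {-1<..<1} then f x else 0) \<in> borel_measurable lebesgue"
    by (subst (asm) borel_measurable_if[symmetric]) auto
  then have "(\<lambda>x. if x \<in> {-1<..<1} then f x else 0) \<in> borel_measurable (lebesgue_on II)"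
    by (rule measurable_restrict_space1)
  then show ?thesis
    by (rule borel_measurable_finite_change[of _ "{-1, 1}"]) auto
qed

lemma borel_measurable_continuous_on_II: "continuous_on II f \<Longrightarrow> (f :: real \<Rightarrow> real) \<in> borel_measurable (lebesgue_on II)"
  by (intro continuous_imp_measurable_on_sets_lebesgue) auto

section \<open>Sharp constants for polynomials, and the lower and upper bounds for the
  deviation\<close>

context kernel_family
begin

text \<open>The term with \<open>U\<close> is paired with the derivative of order \<open>r\<close>,
  which is 0 on these polynomials. So \<open>V 0 t\<close> alone represents the functional.\<close>

lemma poly_rep:
  assumes "degree Q \<le> r - 1" "t \<in> {-1..<1}"
  shows "poly ((pderiv ^^ k) Q) t = ip (V 0 t) (poly Q)"
proof -
  have "nderiv II k (poly Q) t = ip (V 0 t) (poly Q) + \<sigma> * ip (U 0 t) (nderiv II r (poly Q))"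
    using assms poly_L2m(1)[OF rk] by (intro rep) auto
  also have "ip (U 0 t) (nderiv II r (poly Q)) = 0"
    using poly_L2m(3)[OF rk assms(1)] by (rule ip_zero_on)
  finally show ?thesis using poly_L2m(2)[OF rk assms(1), of t] assms(2) by simp
qed

text \<open>A representer of norm 0 would annihilate the monomial of degree \<open>k\<close>, whose
  derivative of order \<open>k\<close> is 1 because \<open>k\<close> is 0 or 1.\<close>

lemma M0_pos: "0 < M0"
proof (rule ccontr)
  assume "\<not> 0 < M0"
  then have z: "nV 0 (-1) = 0" using norm2_nonneg[of "V 0 (-1)"] by (simp add: M0_def)
  let ?Q = "monom 1 k :: real poly"
  have dQ: "degree ?Q \<le> r - 1" using rk by (auto simp: degree_monom_eq)
  have "poly ((pderiv ^^ k) ?Q) (-1) = 1"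
    using rk by (auto simp: pderiv_monom poly_monom)
  then have "ip (V 0 (-1)) (poly ?Q) = 1" using poly_rep[OF dQ end_in] by simp
  moreover have "\<bar>ip (V 0 (-1)) (poly ?Q)\<bar> \<le> nV 0 (-1) * norm2 (poly ?Q)"
    using L2m_L2[OF poly_L2m(1)[OF rk dQ]] by (intro ip_Cauchy_Schwarz V_L2) auto
  ultimately show False using z by simp
qed

lemma poly_bound:
  assumes Q: "degree Q \<le> r - 1" and t: "t \<in> {-1..<1}" and c: "M0 \<le> c"
  shows "\<bar>poly ((pderiv ^^ k) Q) t\<bar> \<le> c * norm2 (poly Q)"
proof -
  have "\<bar>poly ((pderiv ^^ k) Q) t\<bar> \<le> nV 0 t * norm2 (poly Q)"
    unfolding poly_rep[OF Q t] using t L2m_L2[OF poly_L2m(1)[OF rk Q]] by (intro ip_Cauchy_Schwarz V_L2) auto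
  also have "\<dots> \<le> c * norm2 (poly Q)"
    using nV_0_le[OF t] c norm2_nonneg by (intro mult_right_mono) auto
  finally show ?thesis .
qed

text \<open>The representer at -1 for parameter 0 is itself a polynomial, so Cauchy-Schwarz is
  attained on it.\<close>

lemma poly_extremal:
  obtains Q where "degree Q \<le> r - 1" "norm2 (poly Q) = M0" "poly ((pderiv ^^ k) Q) (-1) = M0\<^sup>2"
proof -
  obtain Q where Q: "degree Q \<le> r - 1" "\<And>x. x \<in> II \<Longrightarrow> poly Q x = V 0 (-1) x" using V_poly by blast
  have n: "norm2 (poly Q) = M0" unfolding M0_def by (rule norm2_cong_on) (rule Q(2))
  have "poly ((pderiv ^^ k) Q) (-1) = nderiv II k (poly Q) (-1)"
    using poly_L2m(2)[OF rk Q(1), of "-1"] by simp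
  also have "\<dots> = G 0 (-1)" unfolding G_def by (rule nderiv_cong_on) (use Q(2) in auto)
  also have "\<dots> = M0\<^sup>2" using G_eq[of 0 "-1"] by (simp add: M0_def)
  finally show thesis using that Q(1) n by blast
qed

text \<open>For the upper bound the point 1 may be dropped as a null set. For sharpness the almost
  everywhere bound on the extremal polynomial is carried to -1 by continuity.\<close>

lemma M_const_eq: "M_const r k = M0"
  unfolding M_const_def
proof (rule Least_equality)
  show "\<forall>Q. degree Q \<le> r - 1 \<longrightarrow> norm_inf (poly ((pderiv ^^ k) Q)) \<le> ereal (M0 * norm2 (poly Q))"
  proof (intro allI impI norm_inf_le)
    fix Q :: "real poly" assume Q: "degree Q \<le> r - 1"
    show "poly ((pderiv ^^ k) Q) \<in> borel_measurable (lebesgue_on II)"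
      by (intro borel_measurable_continuous_on_II continuous_intros)
    show "AE x in lebesgue_on II. \<bar>poly ((pderiv ^^ k) Q) x\<bar> \<le> M0 * norm2 (poly Q)"
      by (rule AE_II_except_finite[of "{1}"]) (use poly_bound[OF Q] in auto)
  qed
next
  fix c assume c: "\<forall>Q. degree Q \<le> r - 1 \<longrightarrow> norm_inf (poly ((pderiv ^^ k) Q)) \<le> ereal (c * norm2 (poly Q))"
  obtain Q where Q: "degree Q \<le> r - 1" "norm2 (poly Q) = M0" "poly ((pderiv ^^ k) Q) (-1) = M0\<^sup>2"
    by (rule poly_extremal)
  have "AE x in lebesgue_on II. \<bar>poly ((pderiv ^^ k) Q) x\<bar> \<le> c * M0"
    using c Q(1,2) by (intro norm_inf_le_imp_AE) auto
  then have "\<bar>poly ((pderiv ^^ k) Q) (-1)\<bar> \<le> c * M0"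
    by (intro AE_bound_continuous continuous_intros) auto
  then show "M0 \<le> c" using Q(3) M0_pos by (simp add: power2_eq_square)
qed

lemma M_end_eq: "M_end r k = M0"
  unfolding M_end_def
proof (rule Least_equality)
  show "\<forall>Q. degree Q \<le> r - 1 \<longrightarrow> \<bar>poly ((pderiv ^^ k) Q) (-1)\<bar> \<le> M0 * norm2 (poly Q)"
    using poly_bound end_in by blast
next
  fix c assume c: "\<forall>Q. degree Q \<le> r - 1 \<longrightarrow> \<bar>poly ((pderiv ^^ k) Q) (-1)\<bar> \<le> c * norm2 (poly Q)"
  obtain Q where Q: "degree Q \<le> r - 1" "norm2 (poly Q) = M0" "poly ((pderiv ^^ k) Q) (-1) = M0\<^sup>2"
    by (rule poly_extremal)
  then have "\<bar>M0\<^sup>2\<bar> \<le> c * M0" using c by metis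
  then show "M0 \<le> c" using M0_pos by (simp add: power2_eq_square)
qed

text \<open>The top derivative of \<open>V\<close> is \<open>\<sigma> * l * U\<close>, which turns
  the constraint of the class into a bound on \<open>c\<close>. For \<open>l = 0\<close> every
  nonnegative \<open>c\<close> is admissible.\<close>

lemma scaled_V_in_W2:
  assumes l: "0 \<le> l" and c: "0 \<le> c" "c * (l * nU l (-1)) \<le> 1"
  shows "(\<lambda>x. c * V l (-1) x) \<in> W2 r"
proof -
  have "norm2 (nderiv II r (\<lambda>x. c * V l (-1) x)) = norm2 (\<lambda>x. (c * (\<sigma> * l)) * U l (-1) x)"
    using V_top[OF l end_in, of c] V_L2m[OF l end_in, of c] U_L2[OF l end_in]
    by (intro norm2_cong_AE L2m_top L2_cmult) (auto simp: mult_ac)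
  also have "\<dots> = c * (l * nU l (-1))"
    unfolding norm2_cmult using l c(1) abs_sigma by (simp add: abs_mult)
  finally show ?thesis using V_L2m[OF l end_in, of c] c(2) by (simp add: W2_def)
qed

lemma scaled_V_value:
  assumes "0 \<le> l" "0 \<le> c"
  shows "\<bar>nderiv II k (\<lambda>x. c * V l (-1) x) (-1)\<bar> - N * norm2 (\<lambda>x. c * V l (-1) x) = c * (G l (-1) - N * nV l (-1))"
proof -
  have "0 \<le> G l (-1)" using G_eq[OF assms(1) end_in] assms by simp
  then show ?thesis
    unfolding norm2_cmult using V_k[OF assms(1) end_in, of "-1" c] assms
    by (simp add: abs_mult G_def[symmetric] algebra_simps)
qed

lemma U_dev_lower:
  assumes S: "linear_operator S" "operator_norm S \<le> ereal N"
    and l: "0 \<le> l" and c: "0 \<le> c" "c * (l * nU l (-1)) \<le> 1"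
  shows "ereal (c * (G l (-1) - N * nV l (-1))) \<le> U_dev r k S"
  using U_dev_ge[OF S scaled_V_in_W2[OF l c] L2m_L2[OF V_L2m[OF l end_in]] L2m_continuous_k[OF V_L2m[OF l end_in]], of "-1"]
  by (simp add: scaled_V_value[OF l c(1)])

text \<open>At parameter 0 all nonnegative multiples of the polynomial representer lie in
  \<open>W2\<close>, and each unit of the multiple contributes \<open>M0 * (M0 - N) > 0\<close> to
  the deviation.\<close>

lemma E_best_infinite:
  assumes N: "N < M0"
  shows "E_best r k N = \<infinity>"
proof -
  have "U_dev r k S = \<infinity>" if S: "linear_operator S" "operator_norm S \<le> ereal N" for S
  proof (rule ereal_top)
    fix B :: real
    define d where "d = M0 * (M0 - N)"
    have d: "0 < d" using N M0_pos by (simp add: d_def)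
    have "ereal (\<bar>B\<bar> / d * (G 0 (-1) - N * nV 0 (-1))) \<le> U_dev r k S"
      using d by (intro U_dev_lower[OF S]) auto
    moreover have "G 0 (-1) - N * nV 0 (-1) = d"
      using G_eq[of 0 "-1"] by (simp add: M0_def[symmetric] d_def power2_eq_square algebra_simps)
    then have "\<bar>B\<bar> / d * (G 0 (-1) - N * nV 0 (-1)) = \<bar>B\<bar>" using d by simp
    ultimately have "ereal \<bar>B\<bar> \<le> U_dev r k S" by simp
    then show "ereal B \<le> U_dev r k S" by (rule order_trans[rotated]) simp
  qed
  then show ?thesis
    unfolding E_best_def by (auto intro!: antisym INF_greatest)
qed

text \<open>The largest admissible multiple is c = 1 / (l * nU). Since G = nV^2 + l * nU^2 and
  \<open>nV\<close> is at least \<open>N\<close> to the right of the critical parameter, the lower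
  bound is at least \<open>nU\<close>. The critical parameter itself may be 0, where
  \<open>c\<close> would be undefined, so it is reached only as a limit.\<close>

lemma nU_le_if_lower:
  assumes N: "M0 \<le> N"
    and X: "\<And>l c. 0 \<le> l \<Longrightarrow> 0 \<le> c \<Longrightarrow> c * (l * nU l (-1)) \<le> 1 \<Longrightarrow> ereal (c * (G l (-1) - N * nV l (-1))) \<le> X"
  shows "ereal (nU (lm N (-1)) (-1)) \<le> X"
proof -
  let ?m = "lm N (-1)"
  note m = lm[OF N end_in]
  have "((\<lambda>l. ereal (nU l (-1))) \<longlongrightarrow> ereal (nU ?m (-1))) (at_right ?m)"
    by (intro tendsto_ereal nU_tendsto m end_in)
  moreover have "\<forall>\<^sub>F l in at_right ?m. ereal (nU l (-1)) \<le> X"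
    using eventually_at_right_less[of ?m]
  proof eventually_elim
    case (elim l)
    have l: "0 < l" using elim m by simp
    have u: "0 < nU l (-1)" using l by (intro nU_pos) auto
    have v: "N \<le> nV l (-1)" using nV_mono[OF m(1) less_imp_le[OF elim] end_in] m(2) by simp
    let ?c = "1 / (l * nU l (-1))"
    have "nU l (-1) = ?c * (l * (nU l (-1))\<^sup>2)" using l u by (simp add: field_simps power2_eq_square)
    also have "\<dots> \<le> ?c * (G l (-1) - N * nV l (-1))"
    proof (intro mult_left_mono)
      have "N * nV l (-1) \<le> nV l (-1) * nV l (-1)" using v norm2_nonneg by (intro mult_right_mono) auto
      then show "l * (nU l (-1))\<^sup>2 \<le> G l (-1) - N * nV l (-1)"
        using G_eq[of l "-1"] l by (simp add: power2_eq_square)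
    qed (use l u in auto)
    finally have "ereal (nU l (-1)) \<le> ereal (?c * (G l (-1) - N * nV l (-1)))" by simp
    also have "\<dots> \<le> X" using l u by (intro X) auto
    finally show ?case .
  qed
  ultimately show ?thesis by (rule tendsto_upperbound) simp
qed

lemma nU_lm_le:
  assumes N: "M0 \<le> N" and t: "t \<in> {-1..<1}"
  shows "nU (lm N t) t \<le> nU (lm N (-1)) (-1)"
proof -
  note m = lm[OF N t] and e = lm[OF N end_in]
  \<comment> \<open>Parameters strictly above \<open>lm N t\<close> are used, since
    \<open>G_le\<close> and the final division by \<open>l\<close> need a positive \<open>l\<close>,
    while \<open>lm N t\<close> may be 0.\<close>
  have "\<forall>\<^sub>F l in at_right (lm N t). nU l t \<le> nU (lm N (-1)) (-1)"
    using eventually_at_right_less[of "lm N t"]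
  proof eventually_elim
    case (elim l)
    have l: "0 < l" using elim m by simp
    have "N \<le> nV l t" using nV_mono[OF m(1) less_imp_le[OF elim] t] m(2) by simp
    moreover have "0 \<le> N" using N M0_pos by simp
    ultimately have "N\<^sup>2 \<le> (nV l t)\<^sup>2" by (intro power_mono)
    then have "N\<^sup>2 + l * (nU l t)\<^sup>2 \<le> G l t" using G_eq[of l t] l t by simp
    also have "\<dots> \<le> G l (-1)" using G_le[OF l t] by (simp add: G_def)
    also have "\<dots> \<le> N\<^sup>2 + l * (nU (lm N (-1)) (-1))\<^sup>2"
      using G_min[OF e(1) less_imp_le[OF l] end_in] e(2) by simp
    finally have "(nU l t)\<^sup>2 \<le> (nU (lm N (-1)) (-1))\<^sup>2" using l by simp
    then show ?case using norm2_nonneg by (meson power2_le_imp_le)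
  qed
  with nU_tendsto[OF m(1) t] show ?thesis by (rule tendsto_upperbound) simp
qed

lemma S_op_bound:
  assumes N: "M0 \<le> N" and t: "t \<in> {-1..<1}" and f: "f \<in> L2 II"
  shows "\<bar>S_op r k N f t\<bar> \<le> N * norm2 f"
  using ip_Cauchy_Schwarz[OF V_L2[OF lm(1)[OF N t] t] f] by (simp add: S_op_eq[OF N t f] lm(2)[OF N t])

lemma S_op_measurable:
  "M0 \<le> N \<Longrightarrow> f \<in> L2 II \<Longrightarrow> S_op r k N f \<in> borel_measurable (lebesgue_on II)"
  by (intro borel_measurable_continuous_on_open_II S_op_continuous)

lemma norm_inf_S_op:
  assumes N: "M0 \<le> N" and f: "f \<in> L2 II"
  shows "norm_inf (S_op r k N f) \<le> ereal (N * norm2 f)"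
  by (intro norm_inf_le S_op_measurable N f AE_II_except_finite[of "{1}"] S_op_bound) auto

lemma linear_operator_S_op:
  assumes N: "M0 \<le> N"
  shows "linear_operator (S_op r k N)"
  unfolding linear_operator_def
proof (intro conjI ballI allI impI)
  fix f assume f: "f \<in> L2 II"
  have "norm_inf (S_op r k N f) < \<infinity>" using norm_inf_S_op[OF N f] by (rule le_less_trans) simp
  then show "S_op r k N f \<in> Linf" using S_op_measurable[OF N f] by (simp add: Linf_def)
  fix g assume g: "g \<in> L2 II"
  show "AE x in lebesgue_on II. S_op r k N f x = S_op r k N g x" if ae: "AE x in lebesgue_on II. f x = g x"
  proof (rule AE_II_except_finite[of "{1}"])
    fix t assume "t \<in> II - {1}"
    then have t: "t \<in> {-1..<1}" by auto
    note V = V_L2[OF lm(1)[OF N t] t]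
    show "S_op r k N f t = S_op r k N g t"
      unfolding S_op_eq[OF N t f] S_op_eq[OF N t g] by (rule ip_cong_AE[OF V V f g _ ae]) simp
  qed simp
  fix a b
  show "AE x in lebesgue_on II. S_op r k N (\<lambda>y. a * f y + b * g y) x = a * S_op r k N f x + b * S_op r k N g x"
  proof (rule AE_II_except_finite[of "{1}"])
    fix t assume "t \<in> II - {1}"
    then have t: "t \<in> {-1..<1}" by auto
    show "S_op r k N (\<lambda>y. a * f y + b * g y) t = a * S_op r k N f t + b * S_op r k N g t"
      unfolding S_op_eq[OF N t f] S_op_eq[OF N t g] S_op_eq[OF N t L2_lincomb[OF f g]]
      by (rule ip_lincomb_right[OF V_L2[OF lm(1)[OF N t] t] f g])
  qed simp
qed

lemma operator_norm_S_op:
  assumes N: "M0 \<le> N"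
  shows "operator_norm (S_op r k N) \<le> ereal N"
  unfolding operator_norm_def
proof (rule SUP_least)
  fix f assume "f \<in> {f \<in> L2 II. norm2 f \<le> 1}"
  then have f: "f \<in> L2 II" "norm2 f \<le> 1" by auto
  have "norm_inf (S_op r k N f) \<le> ereal (N * norm2 f)" by (rule norm_inf_S_op[OF N f(1)])
  also have "\<dots> \<le> ereal N" using f(2) N M0_pos mult_left_mono[of "norm2 f" 1 N] by simp
  finally show "norm_inf (S_op r k N f) \<le> ereal N" .
qed

text \<open>The error of the representing functional is exactly the second term of
  \<open>rep\<close>, and the top derivative of \<open>f\<close> has norm at most 1.\<close>

lemma pointwise_deviation:
  assumes l: "0 \<le> l" and t: "t \<in> {-1..<1}" and f: "f \<in> W2 r"
  shows "\<bar>nderiv II k f t - ip (V l t) f\<bar> \<le> nU l t"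
proof -
  have f': "f \<in> L2m r II" "norm2 (nderiv II r f) \<le> 1" using f by (auto simp: W2_def)
  have "\<bar>nderiv II k f t - ip (V l t) f\<bar> = \<bar>\<sigma>\<bar> * \<bar>ip (U l t) (nderiv II r f)\<bar>"
    using rep[OF l t f'(1)] by (simp add: abs_mult)
  also have "\<dots> \<le> 1 * (nU l t * norm2 (nderiv II r f))"
    using abs_sigma by (intro mult_mono ip_Cauchy_Schwarz U_L2 l t L2m_top f') auto
  also have "\<dots> \<le> nU l t" using f'(2) norm2_nonneg mult_left_mono[of "norm2 (nderiv II r f)" 1 "nU l t"] by simp
  finally show ?thesis .
qed

lemma U_dev_S_op_le:
  assumes N: "M0 \<le> N"
  shows "U_dev r k (S_op r k N) \<le> ereal (nU (lm N (-1)) (-1))"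
  unfolding U_dev_def
proof (rule SUP_least)
  fix f assume f: "f \<in> W2 r"
  then have f': "f \<in> L2m r II" by (simp add: W2_def)
  show "norm_inf (\<lambda>x. nderiv II k f x - S_op r k N f x) \<le> ereal (nU (lm N (-1)) (-1))"
  proof (rule norm_inf_le)
    show "(\<lambda>x. nderiv II k f x - S_op r k N f x) \<in> borel_measurable (lebesgue_on II)"
      by (intro borel_measurable_diff S_op_measurable[OF N L2m_L2[OF f']]
          borel_measurable_continuous_on_II L2m_continuous_k f')
    show "AE x in lebesgue_on II. \<bar>nderiv II k f x - S_op r k N f x\<bar> \<le> nU (lm N (-1)) (-1)"
    proof (rule AE_II_except_finite[of "{1}"])
      fix t assume "t \<in> II - {1}"
      then have t: "t \<in> {-1..<1}" by auto
      show "\<bar>nderiv II k f t - S_op r k N f t\<bar> \<le> nU (lm N (-1)) (-1)"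
        unfolding S_op_eq[OF N t L2m_L2[OF f']]
        by (rule order_trans[OF pointwise_deviation[OF lm(1)[OF N t] t f] nU_lm_le[OF N t]])
    qed simp
  qed
qed

lemma E_best_end_le:
  assumes N: "M0 \<le> N"
  shows "E_best_end r k N \<le> ereal (nU (lm N (-1)) (-1))"
proof -
  let ?m = "lm N (-1)"
  note m = lm[OF N end_in]
  note V = V_L2[OF m(1) end_in]
  have "linear_functional (ip (V ?m (-1)))"
    unfolding linear_functional_def
  proof (intro conjI ballI allI impI)
    fix f g assume f: "f \<in> L2 II" and g: "g \<in> L2 II"
    show "ip (V ?m (-1)) f = ip (V ?m (-1)) g" if "AE x in lebesgue_on II. f x = g x"
      by (rule ip_cong_AE[OF V V f g _ that]) simp
    show "ip (V ?m (-1)) (\<lambda>y. a * f y + b * g y) = a * ip (V ?m (-1)) f + b * ip (V ?m (-1)) g" for a b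
      by (rule ip_lincomb_right[OF V f g])
  qed
  moreover have "functional_norm (ip (V ?m (-1))) \<le> ereal N"
    unfolding functional_norm_def
  proof (rule SUP_least)
    fix f assume "f \<in> {f \<in> L2 II. norm2 f \<le> 1}"
    then have f: "f \<in> L2 II" "norm2 f \<le> 1" by auto
    have "\<bar>ip (V ?m (-1)) f\<bar> \<le> N * norm2 f" using ip_Cauchy_Schwarz[OF V f(1)] m(2) by simp
    also have "\<dots> \<le> N" using f(2) N M0_pos mult_left_mono[of "norm2 f" 1 N] by simp
    finally show "ereal \<bar>ip (V ?m (-1)) f\<bar> \<le> ereal N" by simp
  qed
  ultimately have "E_best_end r k N \<le> (SUP f\<in>W2 r. ereal \<bar>nderiv II k f (-1) - ip (V ?m (-1)) f\<bar>)"
    unfolding E_best_end_def by (intro INF_lower) auto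
  also have "\<dots> \<le> ereal (nU ?m (-1))"
    by (intro SUP_least) (simp add: pointwise_deviation[OF m(1) end_in])
  finally show ?thesis .
qed

lemma E_best_end_ge:
  assumes N: "M0 \<le> N"
  shows "ereal (nU (lm N (-1)) (-1)) \<le> E_best_end r k N"
  unfolding E_best_end_def
proof (rule INF_greatest)
  fix S assume "S \<in> {S. linear_functional S \<and> functional_norm S \<le> ereal N}"
  then have S: "linear_functional S" "functional_norm S \<le> ereal N" by auto
  show "ereal (nU (lm N (-1)) (-1)) \<le> (SUP f\<in>W2 r. ereal \<bar>nderiv II k f (-1) - S f\<bar>)"
  proof (rule nU_le_if_lower[OF N])
    fix l c :: real assume l: "0 \<le> l" and c: "0 \<le> c" "c * (l * nU l (-1)) \<le> 1"
    show "ereal (c * (G l (-1) - N * nV l (-1))) \<le> (SUP f\<in>W2 r. ereal \<bar>nderiv II k f (-1) - S f\<bar>)"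
      using functional_dev_ge[OF S scaled_V_in_W2[OF l c] L2m_L2[OF V_L2m[OF l end_in]], of k "-1"]
      by (simp add: scaled_V_value[OF l c(1)])
  qed
qed

lemma E_best_ge:
  assumes N: "M0 \<le> N"
  shows "ereal (nU (lm N (-1)) (-1)) \<le> E_best r k N"
  unfolding E_best_def
proof (rule INF_greatest)
  fix S assume "S \<in> {S. linear_operator S \<and> operator_norm S \<le> ereal N}"
  then show "ereal (nU (lm N (-1)) (-1)) \<le> U_dev r k S"
    by (intro nU_le_if_lower[OF N] U_dev_lower) auto
qed

theorem stechkin_problem:
  "(\<forall>N. 0 < N \<and> N < M_const r k \<longrightarrow> E_best r k N = \<infinity>) \<and>
   M_const r k = M_end r k \<and>
   (\<forall>N\<ge>M_const r k.
      (\<forall>t\<in>{-1..1}. \<exists>!l. 0 \<le> l \<and> norm2 (u_sol_deriv r k l t) = N) \<and>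
      lam r k N (-1) = lam_end r k N \<and>
      lam r k N 1 = lam_end r k N \<and>
      linear_operator (S_op r k N) \<and>
      E_best r k N = U_dev r k (S_op r k N) \<and>
      U_dev r k (S_op r k N) = ereal (norm2 (u_end r k (lam_end r k N))) \<and>
      ereal (norm2 (u_end r k (lam_end r k N))) = E_best_end r k N)"
  unfolding M_const_eq M_end_eq
proof (intro conjI allI impI ballI)
  fix N assume N: "M0 \<le> N"
  have E: "norm2 (u_end r k (lam_end r k N)) = nU (lm N (-1)) (-1)"
    unfolding lam_end_eq by (rule norm2_u_end) (rule lm(1)[OF N end_in])
  have up: "E_best r k N \<le> U_dev r k (S_op r k N)"
    unfolding E_best_def using linear_operator_S_op[OF N] operator_norm_S_op[OF N] by (intro INF_lower) auto
  note lo = E_best_ge[OF N] and di = U_dev_S_op_le[OF N]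
  show "E_best r k N = U_dev r k (S_op r k N)" by (rule antisym[OF up order_trans[OF di lo]])
  show "U_dev r k (S_op r k N) = ereal (norm2 (u_end r k (lam_end r k N)))"
    unfolding E by (rule antisym[OF di order_trans[OF lo up]])
  show "ereal (norm2 (u_end r k (lam_end r k N))) = E_best_end r k N"
    unfolding E by (rule antisym[OF E_best_end_ge[OF N] E_best_end_le[OF N]])
  show "linear_operator (S_op r k N)" by (rule linear_operator_S_op[OF N])
  show "lam r k N (-1) = lam_end r k N" by (simp add: lam_eq lam_end_eq)
  show "lam r k N 1 = lam_end r k N" by (simp add: lam_1_eq lam_end_eq)
  fix t :: real assume "t \<in> II"
  then consider "t = 1" | "t \<in> {-1..<1}" by fastforce
  then show "\<exists>!l. 0 \<le> l \<and> norm2 (u_sol_deriv r k l t) = N"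
  proof cases
    case 1
    then show ?thesis using ex1_nV[OF N end_in] norm2_u_sol_deriv_1 by (simp cong: conj_cong)
  next
    case 2
    then show ?thesis using ex1_nV[OF N 2] norm2_u_sol_deriv[OF _ 2] by (simp cong: conj_cong)
  qed
qed (auto simp: E_best_infinite)

end

section \<open>Uniqueness of the solutions\<close>

lemma L2m_derivative_exists:
  assumes u: "u \<in> L2m m S" and S: "{a<..<b} \<subseteq> S" and j: "j < m - 1" and x: "x \<in> {a<..<b}"
  shows "(nderiv S j u has_real_derivative nderiv S (Suc j) u x) (at x)"
proof -
  have xi: "x \<in> interior S" using x S by (meson interior_maximal open_greaterThanLessThan subsetD)
  have "nderiv S j u differentiable (at x within S)"
    using u j x S unfolding L2m_def differentiable_on_def by blast
  then have "(nderiv S j u has_vector_derivative nderiv S (Suc j) u x) (at x within S)"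
    unfolding nderiv_Suc by (simp add: vector_derivative_works)
  then show ?thesis
    unfolding at_within_interior[OF xi] by (simp add: has_real_derivative_iff_has_vector_derivative)
qed

text \<open>An equation for \<open>nderiv\<close> says nothing about differentiability, because
  \<open>vector_derivative\<close> has some value at every point. But the derivative
  \<open>h\<close> of order \<open>m - 1\<close> is absolutely continuous, so it is the integral of
  the continuous function \<open>c * u\<close>, and hence differentiable everywhere.\<close>

lemma L2m_classical_solution:
  assumes u: "u \<in> L2m m S" and S: "{a<..<b} \<subseteq> S" and m: "2 \<le> m"
    and ode: "\<And>x. x \<in> {a<..<b} \<Longrightarrow> nderiv S m u x = c * u x"
    and j: "j < m" and x: "x \<in> {a<..<b}"
  shows "(nderiv S j u has_real_derivative nderiv S (Suc j) u x) (at x)"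
proof (cases "j < m - 1")
  case True
  then show ?thesis using L2m_derivative_exists[OF u S _ x] by blast
next
  case False
  then have j: "Suc j = m" using j by simp
  define h where "h = nderiv S (m - 1) u"
  have h: "abs_cont_on S h" using u by (simp add: L2m_def h_def)
  have jh: "nderiv S j u = h" using j by (simp add: h_def flip: j)
  obtain p q where pq: "a < p" "p < x" "x < q" "q < b"
    using x dense[of a x] dense[of x b] by auto
  have sub: "{p..q} \<subseteq> {a<..<b}" using pq by auto
  have at: "at z within S = at z" if "z \<in> {a<..<b}" for z
    using that S by (intro at_within_interior) (meson interior_maximal open_greaterThanLessThan subsetD)
  have uc: "continuous_on {p..q} (\<lambda>z. c * u z)"
  proof (intro continuous_intros continuous_at_imp_continuous_on ballI)
    fix z assume "z \<in> {p..q}"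
    then have "(nderiv S 0 u has_real_derivative nderiv S (Suc 0) u z) (at z)"
      using L2m_derivative_exists[OF u S, of 0 z] m sub by auto
    then show "isCont u z" by (simp add: DERIV_isCont)
  qed
  have hy: "h y = h p + integral {p..y} (\<lambda>z. c * u z)" if y: "y \<in> {p..q}" for y
  proof -
    have "{p..y} \<subseteq> {p..q}" using y by auto
    then have "{p..y} \<subseteq> S" using sub S by blast
    then have "((\<lambda>z. vector_derivative h (at z)) has_integral (h y - h p)) {p..y}"
      using y by (intro fundamental_theorem_of_calculus_abs_cont abs_cont_on_subset[OF h]) auto
    moreover have "vector_derivative h (at z) = c * u z" if "z \<in> {p..y}" for z
    proof -
      have "z \<in> {p..q}" using that y by auto
      then have z: "z \<in> {a<..<b}" using sub by blast
      have "vector_derivative h (at z) = nderiv S (Suc j) u z"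
        unfolding nderiv_Suc jh using at[OF z] by simp
      then show ?thesis using ode[OF z] j by simp
    qed
    ultimately have "((\<lambda>z. c * u z) has_integral (h y - h p)) {p..y}"
      by (rule has_integral_eq[rotated])
    then have "integral {p..y} (\<lambda>z. c * u z) = h y - h p" by (rule integral_unique)
    then show ?thesis by linarith
  qed
  have "((\<lambda>y. integral {p..y} (\<lambda>z. c * u z)) has_real_derivative c * u x) (at x within {p..q})"
    using pq by (intro integral_has_real_derivative[OF uc]) auto
  then have "((\<lambda>y. integral {p..y} (\<lambda>z. c * u z)) has_real_derivative c * u x) (at x)"
    using pq by (simp add: at_within_Icc_at)
  from DERIV_add[OF DERIV_const[of "h p"] this]
  have "((\<lambda>y. h p + integral {p..y} (\<lambda>z. c * u z)) has_real_derivative c * u x) (at x)"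
    by (simp only: add_0)
  then have "(h has_real_derivative c * u x) (at x)"
  proof (rule has_field_derivative_transform_within_open[of _ _ _ "{p<..<q}"])
    fix y assume "y \<in> {p<..<q}"
    then show "h p + integral {p..y} (\<lambda>z. c * u z) = h y" by (intro hy[symmetric]) simp
  qed (use pq in auto)
  then show ?thesis unfolding jh j ode[OF x] .
qed

lemma L2m_top_bounded:
  assumes "u \<in> L2m m S" "is_interval S" "bounded S"
  shows "\<exists>B. \<forall>x\<in>S. \<bar>nderiv S (m - 1) u x\<bar> \<le> B"
proof -
  have "bounded (nderiv S (m - 1) u ` S)"
    using assms by (intro bounded_uniformly_continuous_image abs_cont_on_imp_uniformly_continuous_on)
      (auto simp: L2m_def)
  then show ?thesis by (auto simp: bounded_iff)
qed

text \<open>The mean value theorem carries boundedness down from the highest derivative. In the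
  energy below, bounded derivatives of high order multiply derivatives that tend to 0 at the
  endpoints.\<close>

lemma bounded_chain:
  fixes w :: "nat \<Rightarrow> real \<Rightarrow> real"
  assumes d: "\<And>s x. s < n \<Longrightarrow> x \<in> {a<..<b} \<Longrightarrow> (w s has_real_derivative w (Suc s) x) (at x)"
    and top: "\<exists>B. \<forall>x\<in>{a<..<b}. \<bar>w n x\<bar> \<le> B"
  shows "s \<le> n \<Longrightarrow> \<exists>B. \<forall>x\<in>{a<..<b}. \<bar>w s x\<bar> \<le> B"
proof (induction rule: inc_induct)
  case base
  show ?case by (rule top)
next
  case (step s)
  show ?case
  proof (cases "a < b")
    case True
    obtain B where B: "\<And>x. x \<in> {a<..<b} \<Longrightarrow> \<bar>w (Suc s) x\<bar> \<le> B" using step.IH by blast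
    define c where "c = (a + b) / 2"
    have c: "c \<in> {a<..<b}" using True by (simp add: c_def)
    have B0: "0 \<le> B" using B[OF c] by simp
    have "\<bar>w s x\<bar> \<le> \<bar>w s c\<bar> + B * (b - a)" if x: "x \<in> {a<..<b}" for x
    proof -
      have "norm (w s x - w s c) \<le> B * norm (x - c)"
        using d[OF step.hyps(2)] B x c
        by (intro field_differentiable_bound[of "{a<..<b}" "w s" "w (Suc s)"])
           (auto intro: has_field_derivative_at_within)
      also have "\<dots> \<le> B * (b - a)" using x c B0 by (intro mult_left_mono) auto
      finally show ?thesis by simp
    qed
    then show ?thesis by blast
  qed auto
qed

lemma increasing_between_limits:
  fixes E :: "real \<Rightarrow> real"
  assumes d: "\<And>x. x \<in> {a<..<b} \<Longrightarrow> (E has_real_derivative E1 x) (at x)" "\<And>x. x \<in> {a<..<b} \<Longrightarrow> 0 \<le> E1 x"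
    and lim: "(E \<longlongrightarrow> A) (at_right a)" "(E \<longlongrightarrow> B) (at_left b)" and x: "x \<in> {a<..<b}"
  shows "A \<le> E x" "E x \<le> B"
proof -
  have mono: "E y \<le> E z" if "a < y" "y \<le> z" "z < b" for y z
  proof (rule DERIV_nonneg_imp_nondecreasing[of y z E])
    fix x assume "y \<le> x" "x \<le> z"
    then have "x \<in> {a<..<b}" using that by auto
    then show "\<exists>D. (E has_real_derivative D) (at x) \<and> D \<ge> 0" using d by blast
  qed (use that in simp)
  have "\<forall>\<^sub>F y in at_right a. E y \<le> E x"
    using eventually_at_right_real[of a x] x by (auto elim!: eventually_mono intro: mono)
  with lim(1) show "A \<le> E x" by (rule tendsto_upperbound) simp
  have "\<forall>\<^sub>F y in at_left b. E x \<le> E y"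
    using eventually_at_left_real[of x b] x by (auto elim!: eventually_mono intro: mono)
  with lim(2) show "E x \<le> B" by (rule tendsto_lowerbound) simp
qed

lemma increasing_constant:
  fixes E :: "real \<Rightarrow> real"
  assumes d: "\<And>x. x \<in> {a<..<b} \<Longrightarrow> (E has_real_derivative E1 x) (at x)" "\<And>x. x \<in> {a<..<b} \<Longrightarrow> 0 \<le> E1 x"
    and lim: "(E \<longlongrightarrow> A) (at_right a)" "(E \<longlongrightarrow> A) (at_left b)" and x: "x \<in> {a<..<b}"
  shows "E1 x = 0"
proof -
  have "E y = A" if "y \<in> {a<..<b}" for y
    using increasing_between_limits[OF d lim that] by simp
  then have "((\<lambda>y. A) has_real_derivative E1 x) (at x)"
    using x by (intro has_field_derivative_transform_within_open[OF d(1)[OF x], of "{a<..<b}"]) auto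
  then show ?thesis using DERIV_const DERIV_unique by blast
qed

text \<open>The common limit at \<open>t\<close> is nonnegative when approached from the left piece
  and nonpositive from the right piece, so it is 0, and on each piece an increasing function has
  equal limits at both ends. For \<open>t = -1\<close> there is a single piece.\<close>

lemma increasing_constant_punctured:
  fixes E :: "real \<Rightarrow> real"
  assumes t: "t \<in> {-1..<1}"
    and d: "\<And>x. x \<in> punctured t \<Longrightarrow> (E has_real_derivative E1 x) (at x)" "\<And>x. x \<in> punctured t \<Longrightarrow> 0 \<le> E1 x"
    and lim: "(E \<longlongrightarrow> 0) (at_right (-1))" "(E \<longlongrightarrow> 0) (at_left 1)"
    and mid: "t \<noteq> -1 \<Longrightarrow> \<exists>p. (E \<longlongrightarrow> p) (at_left t) \<and> (E \<longlongrightarrow> p) (at_right t)"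
    and x: "x \<in> punctured t"
  shows "E1 x = 0"
proof (cases "t = -1")
  case True
  then show ?thesis using x d lim by (intro increasing_constant[of "-1" 1 E E1 0]) auto
next
  case False
  then have t': "-1 < t" "t < 1" using t by auto
  obtain p where p: "(E \<longlongrightarrow> p) (at_left t)" "(E \<longlongrightarrow> p) (at_right t)" using mid[OF False] by blast
  have "0 \<le> p"
    using increasing_between_limits[of "-1" t E E1 0 p "(t - 1) / 2"] d lim(1) p(1) t' by (auto intro: order_trans)
  moreover have "p \<le> 0"
    using increasing_between_limits[of t 1 E E1 p 0 "(t + 1) / 2"] d lim(2) p(2) t' by (auto intro: order_trans)
  ultimately have "p = 0" by simp
  then show ?thesis
    using x d lim p t' increasing_constant[of "-1" t E E1 0 x] increasing_constant[of t 1 E E1 0 x] by auto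
qed

text \<open>The function is constant on each piece, and each piece touches an endpoint at which the
  limit is 0.\<close>

lemma zero_derivative_punctured:
  fixes w :: "real \<Rightarrow> real"
  assumes t: "t \<in> {-1..<1}" and d: "\<And>x. x \<in> punctured t \<Longrightarrow> (w has_real_derivative 0) (at x)"
    and lim: "(w \<longlongrightarrow> 0) (at_right (-1))" "(w \<longlongrightarrow> 0) (at_left 1)" and x: "x \<in> punctured t"
  shows "w x = 0"
proof -
  have const: "w y = w z" if "{a<..<b} \<subseteq> punctured t" "y \<in> {a<..<b}" "z \<in> {a<..<b}" for a b y z
  proof -
    have "\<exists>c. \<forall>x\<in>{a<..<b}. w x = c"
    proof (rule has_field_derivative_zero_constant)
      fix x assume "x \<in> {a<..<b}"
      then have "(w has_real_derivative 0) (at x)" using that(1) d by blast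
      then show "(w has_real_derivative 0) (at x within {a<..<b})" by (rule has_field_derivative_at_within)
    qed simp
    then show ?thesis using that by metis
  qed
  show ?thesis
  proof (cases "x < t")
    case True
    then have x: "x \<in> {-1<..<t}" using x by auto
    have "\<forall>\<^sub>F y in at_right (-1). w y = w x"
      using eventually_at_right_real[of "-1" x] x
      by (auto elim!: eventually_mono intro!: const[of "-1" t])
    then have "((\<lambda>y. w x) \<longlongrightarrow> 0) (at_right (-1::real))" using Lim_transform_eventually[OF lim(1), of "\<lambda>y. w x"] by simp
    then show ?thesis using tendsto_const_iff[of "at_right (-1::real)" "w x" 0] by simp
  next
    case False
    then have x: "x \<in> {t<..<1}" using x by auto
    have "\<forall>\<^sub>F y in at_left 1. w y = w x"
      using eventually_at_left_real[of x 1] x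
      by (auto elim!: eventually_mono intro!: const[of t 1])
    then have "((\<lambda>y. w x) \<longlongrightarrow> 0) (at_left (1::real))" using Lim_transform_eventually[OF lim(2), of "\<lambda>y. w x"] by simp
    then show ?thesis using tendsto_const_iff[of "at_left (1::real)" "w x" 0] by simp
  qed
qed

lemma tendsto_mult_bounded_zero:
  fixes f g :: "real \<Rightarrow> real"
  assumes f: "(f \<longlongrightarrow> 0) F" and g: "\<forall>\<^sub>F x in F. \<bar>g x\<bar> \<le> B"
  shows "((\<lambda>x. g x * f x) \<longlongrightarrow> 0) F"
proof (rule Lim_null_comparison)
  show "\<forall>\<^sub>F x in F. norm (g x * f x) \<le> B * \<bar>f x\<bar>"
    using g by eventually_elim (simp add: abs_mult mult_right_mono)
  show "((\<lambda>x. B * \<bar>f x\<bar>) \<longlongrightarrow> 0) F"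
    using tendsto_mult[OF tendsto_const[of B] tendsto_rabs[OF f]] by simp
qed

lemma eventually_punctured:
  assumes "t \<in> {-1..<1}"
  shows "\<forall>\<^sub>F x in at_right (-1). x \<in> punctured t" "\<forall>\<^sub>F x in at_left 1. x \<in> punctured t"
    "\<forall>\<^sub>F x in at_right t. x \<in> punctured t" "-1 < t \<Longrightarrow> \<forall>\<^sub>F x in at_left t. x \<in> punctured t"
proof -
  show "\<forall>\<^sub>F x in at_right (-1). x \<in> punctured t"
  proof (cases "t = -1")
    case True
    then show ?thesis using eventually_at_right_real[of "-1" 1] by (auto elim!: eventually_mono)
  next
    case False
    then show ?thesis using eventually_at_right_real[of "-1" t] assms by (auto elim!: eventually_mono)
  qed
  show "\<forall>\<^sub>F x in at_left 1. x \<in> punctured t" "\<forall>\<^sub>F x in at_right t. x \<in> punctured t"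
    using eventually_at_left_real[of t 1] eventually_at_right_real[of t 1] assms by (auto elim!: eventually_mono)
  show "-1 < t \<Longrightarrow> \<forall>\<^sub>F x in at_left t. x \<in> punctured t"
    using eventually_at_left_real[of "-1" t] by (auto elim!: eventually_mono)
qed

text \<open>The energy \<open>E\<close> below satisfies $E' = (w^{(r)})^2 + \lambda w^2$, vanishes at both endpoints and is
  continuous at \<open>t\<close>.\<close>
lemma homogeneous_problem_trivial:
  fixes w :: "nat \<Rightarrow> real \<Rightarrow> real"
  assumes r: "1 \<le> r" and t: "t \<in> {-1..<1}" and l: "0 \<le> l"
    and d: "\<And>s x. s < 2 * r \<Longrightarrow> x \<in> punctured t \<Longrightarrow> (w s has_real_derivative w (Suc s) x) (at x)"
    and ode: "\<And>x. x \<in> punctured t \<Longrightarrow> (-1) ^ r * w (2 * r) x + l * w 0 x = 0"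
    and bnd: "\<And>s. s < 2 * r \<Longrightarrow> \<exists>B. \<forall>x\<in>punctured t. \<bar>w s x\<bar> \<le> B"
    and ends: "\<And>s. s < r \<Longrightarrow> (w s \<longlongrightarrow> 0) (at_right (-1)) \<and> (w s \<longlongrightarrow> 0) (at_left 1)"
    and mid: "\<And>s. t \<noteq> -1 \<Longrightarrow> s < 2 * r \<Longrightarrow> \<exists>p. (w s \<longlongrightarrow> p) (at_left t) \<and> (w s \<longlongrightarrow> p) (at_right t)"
    and x: "x \<in> punctured t"
  shows "w 0 x = 0"
proof -
  define E where "E x = (\<Sum>j<r. (-1) ^ j * (w (r + j) x * w (r - 1 - j) x))" for x
  \<comment> \<open>The summand of index \<open>j\<close> in \<open>E\<close> has derivative
    \<open>A x j - A x (Suc j)\<close>. The sum telescopes to \<open>A x 0 - A x r\<close>, and the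
    equation rewrites the last term as the square weighted by \<open>l\<close>.\<close>
  define A where "A x j = (-1) ^ j * (w (r + j) x * w (r - j) x)" for x j
  have E: "(E has_real_derivative (w r x)\<^sup>2 + l * (w 0 x)\<^sup>2) (at x)" if x: "x \<in> punctured t" for x
  proof -
    have "((\<lambda>x. (-1) ^ j * (w (r + j) x * w (r - 1 - j) x)) has_real_derivative A x j - A x (Suc j)) (at x)"
      if j: "j < r" for j
    proof -
      have "(w (r + j) has_real_derivative w (Suc (r + j)) x) (at x)" using j x by (intro d) auto
      moreover have "(w (r - 1 - j) has_real_derivative w (Suc (r - 1 - j)) x) (at x)" using j x by (intro d) auto
      moreover have "Suc (r - 1 - j) = r - j" "r - 1 - j = r - Suc j" using j by auto
      ultimately have "(w (r + j) has_real_derivative w (Suc (r + j)) x) (at x)"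
        "(w (r - Suc j) has_real_derivative w (r - j) x) (at x)" by simp_all
      then show ?thesis
        unfolding A_def \<open>r - 1 - j = r - Suc j\<close> by (auto intro!: derivative_eq_intros simp: algebra_simps)
    qed
    then have "(E has_real_derivative (\<Sum>j<r. A x j - A x (Suc j))) (at x)"
      unfolding E_def by (intro DERIV_sum) auto
    also have "(\<Sum>j<r. A x j - A x (Suc j)) = A x 0 - A x r" by (rule sum_lessThan_telescope')
    also have "\<dots> = (w r x)\<^sup>2 - ((-1) ^ r * w (2 * r) x) * w 0 x"
      by (simp add: A_def power2_eq_square mult_2)
    also have "(-1) ^ r * w (2 * r) x = - (l * w 0 x)" using ode[OF x] by linarith
    finally show ?thesis by (simp add: power2_eq_square mult_ac)
  qed
  have lim: "(E \<longlongrightarrow> 0) F"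
    if F: "\<And>s. s < r \<Longrightarrow> (w s \<longlongrightarrow> 0) F" "\<forall>\<^sub>F x in F. x \<in> punctured t" for F
  proof -
    have "((\<lambda>x. (-1) ^ j * (w (r + j) x * w (r - 1 - j) x)) \<longlongrightarrow> 0) F" if j: "j < r" for j
    proof -
      have "\<exists>B. \<forall>x\<in>punctured t. \<bar>w (r + j) x\<bar> \<le> B" using j by (intro bnd) simp
      then obtain B where B: "\<forall>x\<in>punctured t. \<bar>w (r + j) x\<bar> \<le> B" by blast
      then have "\<forall>\<^sub>F x in F. \<bar>w (r + j) x\<bar> \<le> B" by (intro eventually_mono[OF F(2)]) blast
      then have "((\<lambda>x. w (r + j) x * w (r - 1 - j) x) \<longlongrightarrow> 0) F"
        using j by (intro tendsto_mult_bounded_zero F(1)) auto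
      from tendsto_mult[OF tendsto_const[of "(-1) ^ j"] this] show ?thesis by simp
    qed
    from tendsto_sum[of "{..<r}", OF this] show ?thesis unfolding E_def by simp
  qed
  have "(w r x)\<^sup>2 + l * (w 0 x)\<^sup>2 = 0" if x: "x \<in> punctured t" for x
  proof (rule increasing_constant_punctured[OF t E _ _ _ _ x])
    show "(E \<longlongrightarrow> 0) (at_right (-1))" "(E \<longlongrightarrow> 0) (at_left 1)"
      using ends eventually_punctured[OF t] by (auto intro!: lim)
    assume t1: "t \<noteq> -1"
    obtain p where p: "\<And>s. s < 2 * r \<Longrightarrow> (w s \<longlongrightarrow> p s) (at_left t) \<and> (w s \<longlongrightarrow> p s) (at_right t)"
      using mid[OF t1] by metis
    show "\<exists>p. (E \<longlongrightarrow> p) (at_left t) \<and> (E \<longlongrightarrow> p) (at_right t)"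
      unfolding E_def
      by (intro exI[of _ "\<Sum>j<r. (-1) ^ j * (p (r + j) * p (r - 1 - j))"] conjI tendsto_sum tendsto_mult tendsto_const)
         (use p in auto)
  qed (use l in auto)
  moreover have "0 \<le> l * (w 0 x)\<^sup>2" for x using l by simp
  ultimately have top: "w r x = 0" if "x \<in> punctured t" for x
    using that by (metis add_nonneg_eq_0_iff zero_eq_power2 zero_le_power2)
  \<comment> \<open>For \<open>l = 0\<close> the energy only shows that the derivative of order
    \<open>r\<close> vanishes. Descending one order at a time, each derivative is locally constant
    with limit 0 at the endpoints.\<close>
  have "\<forall>x\<in>punctured t. w s x = 0" if "s \<le> r" for s
    using that
  proof (induction rule: inc_induct)
    case base
    show ?case using top by blast
  next
    case (step s)
    show ?case
    proof
      fix x assume "x \<in> punctured t"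
      show "w s x = 0"
      proof (rule zero_derivative_punctured[OF t _ _ _ \<open>x \<in> punctured t\<close>])
        fix y assume "y \<in> punctured t"
        then show "(w s has_real_derivative 0) (at y)" using d[of s y] step by simp
      qed (use ends step in auto)
    qed
  qed
  then show ?thesis using x by blast
qed

text \<open>This is the homogeneous problem at \<open>t = -1\<close>: there
  \<open>punctured (-1)\<close> is the whole open interval and no matching condition
  remains.\<close>

lemma u_problem_unique:
  assumes r: "1 \<le> r" and l: "0 \<le> l" and u: "u_problem r k l u" and v: "u_problem r k l v" and x: "x \<in> {-1<..<1}"
  shows "u x = v x"
proof -
  have facts: "(\<forall>s<2 * r. \<forall>x\<in>{-1<..<1}. (nderiv II s u has_real_derivative nderiv II (Suc s) u x) (at x)) \<and>
      (\<forall>s<2 * r. continuous_on II (nderiv II s u))" if u: "u_problem r k l u" for u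
  proof (intro conjI allI impI ballI)
    fix s assume s: "s < 2 * r"
    have L: "u \<in> L2m (2 * r) II" using u by (simp add: u_problem_def)
    have ode: "nderiv II (2 * r) u x = (- ((-1) ^ r) * l) * u x" if "x \<in> {-1<..<1}" for x
    proof -
      have "(-1) ^ r * nderiv II (2 * r) u x + l * u x = 0" using u that by (simp add: u_problem_def)
      then have "(-1) ^ r * ((-1) ^ r * nderiv II (2 * r) u x) = - ((-1) ^ r * (l * u x))"
        by (metis add_eq_0_iff2 mult_minus_right)
      then show ?thesis by (simp add: mult.assoc[symmetric] power_mult_distrib[symmetric])
    qed
    show "(nderiv II s u has_real_derivative nderiv II (Suc s) u x) (at x)" if "x \<in> {-1<..<1}" for x
      by (rule L2m_classical_solution[OF L _ _ ode s that]) (use r in auto)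
    show "continuous_on II (nderiv II s u)"
    proof (cases "s < 2 * r - 1")
      case True
      then show ?thesis using L by (auto simp: L2m_def intro: differentiable_imp_continuous_on)
    next
      case False
      then have "s = 2 * r - 1" using s by simp
      then show ?thesis using L by (auto simp: L2m_def intro: abs_cont_on_imp_continuous_on)
    qed
  qed
  note fu = facts[OF u] and fv = facts[OF v]
  define w where "w s x = nderiv II s u x - nderiv II s v x" for s x
  have p: "punctured (-1) = {-1<..<1}" by auto
  have wc: "continuous_on II (w s)" if "s < 2 * r" for s
    unfolding w_def using fu fv that by (intro continuous_on_diff) auto
  have "w 0 x = 0"
  proof (rule homogeneous_problem_trivial[of r "-1" l w])
    show "\<exists>B. \<forall>x\<in>punctured (-1). \<bar>w s x\<bar> \<le> B" if s: "s < 2 * r" for s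
      using continuous_on_Icc_bounded[OF wc[OF s]] unfolding p by (metis atLeastAtMost_iff greaterThanLessThan_iff less_imp_le)
    show "(w s \<longlongrightarrow> 0) (at_right (-1)) \<and> (w s \<longlongrightarrow> 0) (at_left 1)" if s: "s < r" for s
    proof -
      have "w s (-1) = 0" "w s 1 = 0" using u v s by (auto simp: u_problem_def w_def)
      moreover have "(w s \<longlongrightarrow> w s (-1)) (at_right (-1))" "(w s \<longlongrightarrow> w s 1) (at_left 1)"
        using wc[of s] s continuous_on_Icc_at_rightD[of "-1" 1 "w s"] continuous_on_Icc_at_leftD[of "-1" 1 "w s"] by auto
      ultimately show ?thesis by simp
    qed
    show "(-1) ^ r * w (2 * r) x + l * w 0 x = 0" if "x \<in> punctured (-1)" for x
    proof -
      have "(-1) ^ r * nderiv II (2 * r) u x + l * u x = 0" "(-1) ^ r * nderiv II (2 * r) v x + l * v x = 0"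
        using u v that by (auto simp: u_problem_def)
      then show ?thesis by (simp add: w_def algebra_simps)
    qed
    show "(w s has_real_derivative w (Suc s) x) (at x)" if "s < 2 * r" "x \<in> punctured (-1)" for s x
      unfolding w_def using fu fv that p by (intro DERIV_diff) auto
  qed (use r l x in auto)
  then show ?thesis by (simp add: w_def)
qed

text \<open>The prescribed jumps cancel in the difference of two solutions, whose derivatives
  therefore have equal one-sided limits at \<open>t\<close>.\<close>

lemma ut_problem_unique:
  assumes r: "1 \<le> r" and l: "0 \<le> l" and t: "-1 < t" "t < 1"
    and u: "ut_problem r k l t u" and v: "ut_problem r k l t v" and x: "x \<in> punctured t"
  shows "u x = v x"
proof -
  let ?P = "punctured t"
  have facts: "(\<forall>s<2 * r. \<forall>x\<in>?P. (nderiv ?P s u has_real_derivative nderiv ?P (Suc s) u x) (at x)) \<and>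
      (\<forall>s<2 * r. \<exists>B. \<forall>x\<in>?P. \<bar>nderiv ?P s u x\<bar> \<le> B)" if u: "ut_problem r k l t u" for u
  proof -
    have one: "(\<forall>s<2 * r. \<forall>x\<in>{a<..<b}. (nderiv ?P s u has_real_derivative nderiv ?P (Suc s) u x) (at x)) \<and>
      (\<forall>s<2 * r. \<exists>B. \<forall>x\<in>{a<..<b}. \<bar>nderiv ?P s u x\<bar> \<le> B)"
      if L: "u \<in> L2m (2 * r) {a<..<b}" and sub: "{a<..<b} \<subseteq> ?P" for a b
    proof -
      have eq: "nderiv {a<..<b} n u x = nderiv ?P n u x" if "x \<in> {a<..<b}" for n x
        using that sub by (intro nderiv_open_subset) auto
      have ode: "nderiv {a<..<b} (2 * r) u x = (- ((-1) ^ r) * l) * u x" if x: "x \<in> {a<..<b}" for x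
      proof -
        have "(-1) ^ r * nderiv ?P (2 * r) u x + l * u x = 0" using u x sub by (auto simp: ut_problem_def)
        then have "(-1) ^ r * ((-1) ^ r * nderiv ?P (2 * r) u x) = - ((-1) ^ r * (l * u x))"
          by (metis add_eq_0_iff2 mult_minus_right)
        then show ?thesis using eq[OF x] by (simp add: mult.assoc[symmetric] power_mult_distrib[symmetric])
      qed
      have d: "(nderiv {a<..<b} s u has_real_derivative nderiv {a<..<b} (Suc s) u x) (at x)"
        if "s < 2 * r" "x \<in> {a<..<b}" for s x
        by (rule L2m_classical_solution[OF L _ _ ode that]) (use r in auto)
      have d': "(nderiv ?P s u has_real_derivative nderiv ?P (Suc s) u x) (at x)"
        if "s < 2 * r" "x \<in> {a<..<b}" for s x
        using has_field_derivative_transform_within_open[OF d[OF that], of "{a<..<b}" "nderiv ?P s u"] that eq by simp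
      have "\<exists>B. \<forall>x\<in>{a<..<b}. \<bar>nderiv ?P s u x\<bar> \<le> B" if s: "s < 2 * r" for s
      \<comment> \<open>On an open piece, the derivative of order \<open>2 * r - 1\<close> is
        bounded because an absolutely continuous function is uniformly continuous.\<close>
      proof (rule bounded_chain[of "2 * r - 1"])
        show "\<exists>B. \<forall>x\<in>{a<..<b}. \<bar>nderiv ?P (2 * r - 1) u x\<bar> \<le> B"
          using L2m_top_bounded[OF L] by (simp add: eq is_interval_oo bounded_subset[OF bounded_closed_interval])
      qed (use d' s in auto)
      then show ?thesis using d' by blast
    qed
    have L: "u \<in> L2m (2 * r) {-1<..<t}" "u \<in> L2m (2 * r) {t<..<1}" using u by (auto simp: ut_problem_def)
    note left = one[OF L(1) Un_upper1] and right = one[OF L(2) Un_upper2]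
    have "\<exists>B. \<forall>x\<in>?P. \<bar>nderiv ?P s u x\<bar> \<le> B" if s: "s < 2 * r" for s
    proof -
      obtain B1 B2 where "\<forall>x\<in>{-1<..<t}. \<bar>nderiv ?P s u x\<bar> \<le> B1" "\<forall>x\<in>{t<..<1}. \<bar>nderiv ?P s u x\<bar> \<le> B2"
        using left right s by blast
      then have "\<forall>x\<in>?P. \<bar>nderiv ?P s u x\<bar> \<le> max B1 B2" by (auto simp: le_max_iff_disj)
      then show ?thesis by blast
    qed
    then show ?thesis using left right by blast
  qed
  note fu = facts[OF u] and fv = facts[OF v]
  define w where "w s x = nderiv ?P s u x - nderiv ?P s v x" for s x
  have "w 0 x = 0"
  proof (rule homogeneous_problem_trivial[of r t l w])
    show "\<exists>B. \<forall>x\<in>?P. \<bar>w s x\<bar> \<le> B" if s: "s < 2 * r" for s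
    proof -
      obtain B1 B2 where "\<forall>x\<in>?P. \<bar>nderiv ?P s u x\<bar> \<le> B1" "\<forall>x\<in>?P. \<bar>nderiv ?P s v x\<bar> \<le> B2"
        using fu fv s by blast
      then have "\<forall>x\<in>?P. \<bar>w s x\<bar> \<le> B1 + B2"
        unfolding w_def by (meson abs_triangle_ineq4 add_mono order_trans)
      then show ?thesis by blast
    qed
    show "(w s \<longlongrightarrow> 0) (at_right (-1)) \<and> (w s \<longlongrightarrow> 0) (at_left 1)" if s: "s < r" for s
    proof -
      have "s \<le> r - 1" using s by simp
      then have "(nderiv ?P s u \<longlongrightarrow> 0) (at_right (-1))" "(nderiv ?P s u \<longlongrightarrow> 0) (at_left 1)"
        "(nderiv ?P s v \<longlongrightarrow> 0) (at_right (-1))" "(nderiv ?P s v \<longlongrightarrow> 0) (at_left 1)"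
        using u v by (auto simp: ut_problem_def)
      from tendsto_diff[OF this(1,3)] tendsto_diff[OF this(2,4)] show ?thesis by (simp add: w_def[abs_def])
    qed
    show "\<exists>p. (w s \<longlongrightarrow> p) (at_left t) \<and> (w s \<longlongrightarrow> p) (at_right t)" if s: "s < 2 * r" for s
    proof -
      have "s \<le> 2 * r - 1" using s by simp
      then obtain p q p' q' where lims:
        "(nderiv ?P s u \<longlongrightarrow> p) (at_right t)" "(nderiv ?P s u \<longlongrightarrow> q) (at_left t)"
        "(nderiv ?P s v \<longlongrightarrow> p') (at_right t)" "(nderiv ?P s v \<longlongrightarrow> q') (at_left t)"
        and pq: "p - q = p' - q'"
        using u v unfolding ut_problem_def by metis
      have pq': "p - p' = q - q'" using pq by simp
      from tendsto_diff[OF lims(1,3)] tendsto_diff[OF lims(2,4)] show ?thesis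
        using pq' by (intro exI[of _ "q - q'"]) (simp add: w_def[abs_def])
    qed
    show "(-1) ^ r * w (2 * r) x + l * w 0 x = 0" if "x \<in> ?P" for x
    proof -
      have "(-1) ^ r * nderiv ?P (2 * r) u x + l * u x = 0" "(-1) ^ r * nderiv ?P (2 * r) v x + l * v x = 0"
        using u v that unfolding ut_problem_def by blast+
      then show ?thesis by (simp add: w_def algebra_simps)
    qed
    show "(w s has_real_derivative w (Suc s) x) (at x)" if "s < 2 * r" "x \<in> ?P" for s x
      unfolding w_def using fu fv that by (intro DERIV_diff) auto
  qed (use r l t x in auto)
  then show ?thesis by (simp add: w_def)
qed

section \<open>Solutions given by two branches\<close>

text \<open>Derivatives \<open>a j\<close> and \<open>b j\<close> of the two branches, to the left and to the right of \<open>t\<close>, of a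
  solution of the problem for \<open>t\<close>. For \<open>t = -1\<close> the right branch solves the problem at the endpoint.\<close>
definition solution_chain ::
  "nat \<Rightarrow> nat \<Rightarrow> real \<Rightarrow> real \<Rightarrow> (nat \<Rightarrow> real \<Rightarrow> real) \<Rightarrow> (nat \<Rightarrow> real \<Rightarrow> real) \<Rightarrow> bool" where
  "solution_chain r k l t a b \<longleftrightarrow>
     (\<forall>j<2 * r. \<forall>x. (a j has_real_derivative a (Suc j) x) (at x)) \<and>
     (\<forall>j<2 * r. \<forall>x. (b j has_real_derivative b (Suc j) x) (at x)) \<and>
     (\<forall>x. a (2 * r) x = - ((-1) ^ r) * l * a 0 x) \<and>
     (\<forall>x. b (2 * r) x = - ((-1) ^ r) * l * b 0 x) \<and>
     (\<forall>s<r. a s (-1) = 0) \<and> (\<forall>s<r. b s 1 = 0) \<and>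
     (\<forall>s<2 * r. b s t - a s t = (-1) powi (int k - 1) * of_bool (r - k - 1 = s))"

lemma at_within_open_nontrivial: "open S \<Longrightarrow> (x::real) \<in> S \<Longrightarrow> at x within S \<noteq> bot"
  using at_within_open[of x S] by simp

lemma pw_tendsto:
  assumes a: "continuous_on UNIV a" and b: "continuous_on UNIV b" and t: "-1 < t" "t < 1"
  shows "(pw t a b \<longlongrightarrow> a (-1)) (at_right (-1))" "(pw t a b \<longlongrightarrow> b 1) (at_left 1)"
    "(pw t a b \<longlongrightarrow> b t) (at_right t)" "(pw t a b \<longlongrightarrow> a t) (at_left t)"
proof -
  have ca: "(a \<longlongrightarrow> a x) (at x within S)" and cb: "(b \<longlongrightarrow> b x) (at x within S)" for x S
    using a b by (auto simp: continuous_on_def intro: tendsto_within_subset)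
  show "(pw t a b \<longlongrightarrow> a (-1)) (at_right (-1))"
    using eventually_at_right_real[of "-1" t] t
    by (intro Lim_transform_eventually[OF ca]) (auto elim!: eventually_mono simp: pw_def)
  show "(pw t a b \<longlongrightarrow> b 1) (at_left 1)"
    using eventually_at_left_real[of t 1] t
    by (intro Lim_transform_eventually[OF cb]) (auto elim!: eventually_mono simp: pw_def)
  show "(pw t a b \<longlongrightarrow> b t) (at_right t)"
    using eventually_at_right_real[of t 1] t
    by (intro Lim_transform_eventually[OF cb]) (auto elim!: eventually_mono simp: pw_def)
  show "(pw t a b \<longlongrightarrow> a t) (at_left t)"
    using eventually_at_left_real[of "-1" t] t
    by (intro Lim_transform_eventually[OF ca]) (auto elim!: eventually_mono simp: pw_def)
qed

lemma norm2_reflect: "norm2 (\<lambda>x. f (- x)) = norm2 f"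
  unfolding norm2_def using integral_reflect_real[where a = "-1" and b = 1 and f = "\<lambda>x. (f x)\<^sup>2"] by simp

context
  fixes r k :: nat and l t :: real and a b :: "nat \<Rightarrow> real \<Rightarrow> real"
  assumes r: "1 \<le> r" and l: "0 \<le> l" and t: "t \<in> {-1..<1}" and ch: "solution_chain r k l t a b"
begin

lemma chain_derivs:
  "j < 2 * r \<Longrightarrow> (a j has_real_derivative a (Suc j) x) (at x)"
  "j < 2 * r \<Longrightarrow> (b j has_real_derivative b (Suc j) x) (at x)"
  using ch by (auto simp: solution_chain_def)

lemma chain_continuous:
  assumes j: "j \<le> 2 * r"
  shows "continuous_on UNIV (a j)" "continuous_on UNIV (b j)"
proof -
  have *: "continuous_on UNIV (a j)" "continuous_on UNIV (b j)" if "j < 2 * r" for j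
    using chain_derivs[OF that] by (auto intro!: continuous_at_imp_continuous_on DERIV_isCont)
  have "a (2 * r) = (\<lambda>x. - ((-1) ^ r) * l * a 0 x)" "b (2 * r) = (\<lambda>x. - ((-1) ^ r) * l * b 0 x)"
    using ch by (auto simp: solution_chain_def)
  then have "continuous_on UNIV (a (2 * r))" "continuous_on UNIV (b (2 * r))"
    using *[of 0] r by (auto intro!: continuous_intros)
  then show "continuous_on UNIV (a j)" "continuous_on UNIV (b j)"
    using * j by (cases "j = 2 * r"; simp)+
qed

lemma chain_ode: "(-1) ^ r * a (2 * r) x + l * a 0 x = 0" "(-1) ^ r * b (2 * r) x + l * b 0 x = 0"
proof -
  have "((-1) ^ r * (-1) ^ r :: real) = 1" by (simp flip: power_mult_distrib)
  then have "(-1) ^ r * (- ((-1) ^ r) * l * y) + l * y = 0" for y :: real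
    by (simp add: mult.assoc[symmetric])
  moreover have "a (2 * r) x = - ((-1) ^ r) * l * a 0 x" "b (2 * r) x = - ((-1) ^ r) * l * b 0 x"
    using ch by (auto simp: solution_chain_def)
  ultimately show "(-1) ^ r * a (2 * r) x + l * a 0 x = 0" "(-1) ^ r * b (2 * r) x + l * b 0 x = 0"
    by presburger+
qed

lemma chain_jump: "s < 2 * r \<Longrightarrow> b s t - a s t = (-1) powi (int k - 1) * of_bool (r - k - 1 = s)"
  using ch by (auto simp: solution_chain_def)

lemma chain_ends: "s < r \<Longrightarrow> a s (-1) = 0" "s < r \<Longrightarrow> b s 1 = 0"
  using ch by (auto simp: solution_chain_def)

lemma nderiv_right_branch: "j \<le> 2 * r \<Longrightarrow> x \<in> II \<Longrightarrow> nderiv II j (b 0) x = b j x"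
  by (rule nderiv_chain[of II "2 * r" b])
     (simp_all add: at_within_II_nontrivial has_field_derivative_at_within[OF chain_derivs(2)])

lemma nderiv_pw:
  assumes "j \<le> 2 * r" "x \<in> punctured t"
  shows "nderiv (punctured t) j (pw t (a 0) (b 0)) x = pw t (a j) (b j) x"
  using assms
proof (rule nderiv_chain[of "punctured t" "2 * r" "\<lambda>j. pw t (a j) (b j)", rotated 3])
  fix j x assume "j < 2 * r" "x \<in> punctured t"
  then show "(pw t (a j) (b j) has_real_derivative pw t (a (Suc j)) (b (Suc j)) x) (at x within punctured t)"
    by (intro has_field_derivative_at_within[OF pw_derivative_off] chain_derivs) auto
next
  show "at x within punctured t \<noteq> bot" if "x \<in> punctured t" for x
    by (rule at_within_open_nontrivial[OF _ that]) auto
qed simp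

lemma L2m_branch:
  assumes S: "\<And>x. x \<in> S \<Longrightarrow> at x within S \<noteq> bot" "is_interval S" "S \<in> lmeasurable" "S \<subseteq> II"
    and F: "F = a \<or> F = b" and u: "\<And>x. x \<in> S \<Longrightarrow> u x = F 0 x"
  shows "u \<in> L2m (2 * r) S"
proof -
  have c: "continuous_on UNIV (F (2 * r))" using F chain_continuous[of "2 * r"] by auto
  obtain B where B: "\<forall>x\<in>II. \<bar>F (2 * r) x\<bar> \<le> B" using bounded_on_II[OF c] by blast
  show ?thesis
  proof (rule L2m_chain[where F = F and B = B])
    show "continuous_on S (F (2 * r))" using c by (rule continuous_on_subset) simp
    show "\<bar>F (2 * r) x\<bar> \<le> B" if "x \<in> S" for x using B S(4) that by blast
    show "(F j has_real_derivative F (Suc j) x) (at x within S)" if "j < 2 * r" for j x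
      using F chain_derivs[OF that] has_field_derivative_at_within by blast
  qed (use r S u in auto)
qed

lemma u_problem_chain:
  assumes t1: "t = -1"
  shows "u_problem r k l (b 0)"
  unfolding u_problem_def
proof (intro conjI ballI allI impI)
  show "b 0 \<in> L2m (2 * r) II"
    by (rule L2m_branch[of _ b]) (auto simp: at_within_II_nontrivial is_interval_cc)
  show "(-1) ^ r * nderiv II (2 * r) (b 0) x + l * b 0 x = 0" if "x \<in> {-1<..<1}" for x
    using nderiv_right_branch[of "2 * r" x] chain_ode(2)[of x] that by simp
  show "nderiv II s (b 0) (-1) = (-1) powi (int k - 1) * of_bool (r - k - 1 = s)" if "s \<le> r - 1" for s
    using nderiv_right_branch[of s "-1"] chain_jump[of s] chain_ends(1)[of s] that r t1 by simp
  show "nderiv II s (b 0) 1 = 0" if "s \<le> r - 1" for s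
    using nderiv_right_branch[of s 1] chain_ends(2)[of s] that r by simp
qed

lemma ut_problem_chain:
  assumes t1: "t \<noteq> -1"
  shows "ut_problem r k l t (pw t (a 0) (b 0))"
  unfolding ut_problem_def
proof (intro conjI ballI allI impI)
  have t': "-1 < t" "t < 1" using t t1 by auto
  show "pw t (a 0) (b 0) \<in> L2m (2 * r) {-1<..<t}"
    by (rule L2m_branch[of _ a])
       (use t' at_within_open_nontrivial[of "{-1<..<t}"] in \<open>auto simp: is_interval_oo pw_def\<close>)
  show "pw t (a 0) (b 0) \<in> L2m (2 * r) {t<..<1}"
    by (rule L2m_branch[of _ b])
       (use t' at_within_open_nontrivial[of "{t<..<1}"] in \<open>auto simp: is_interval_oo pw_def\<close>)
  show "(-1) ^ r * nderiv (punctured t) (2 * r) (pw t (a 0) (b 0)) x + l * pw t (a 0) (b 0) x = 0"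
    if "x \<in> punctured t" for x
    using nderiv_pw[of "2 * r" x] chain_ode[of x] that by (simp add: pw_def)
  have lim: "(nderiv (punctured t) s (pw t (a 0) (b 0)) \<longlongrightarrow> y) F"
    if "(pw t (a s) (b s) \<longlongrightarrow> y) F" "\<forall>\<^sub>F x in F. x \<in> punctured t" "s \<le> 2 * r" for s y F
    using that(1)
  proof (rule Lim_transform_eventually)
    show "\<forall>\<^sub>F x in F. pw t (a s) (b s) x = nderiv (punctured t) s (pw t (a 0) (b 0)) x"
      using that(2) by (rule eventually_mono) (use nderiv_pw that(3) in simp)
  qed
  note ev = eventually_punctured[OF t]
  have pwl: "(pw t (a s) (b s) \<longlongrightarrow> a s (-1)) (at_right (-1))" "(pw t (a s) (b s) \<longlongrightarrow> b s 1) (at_left 1)"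
    "(pw t (a s) (b s) \<longlongrightarrow> b s t) (at_right t)" "(pw t (a s) (b s) \<longlongrightarrow> a s t) (at_left t)" if "s \<le> 2 * r" for s
    using pw_tendsto[OF chain_continuous[OF that] t'] by auto
  show "(nderiv (punctured t) s (pw t (a 0) (b 0)) \<longlongrightarrow> 0) (at_right (-1))"
       "(nderiv (punctured t) s (pw t (a 0) (b 0)) \<longlongrightarrow> 0) (at_left 1)" if "s \<le> r - 1" for s
    using lim[OF _ ev(1), of s 0] lim[OF _ ev(2), of s 0] pwl(1,2)[of s] chain_ends[of s] that r by auto
  show "\<exists>p q. (nderiv (punctured t) s (pw t (a 0) (b 0)) \<longlongrightarrow> p) (at_right t) \<and>
        (nderiv (punctured t) s (pw t (a 0) (b 0)) \<longlongrightarrow> q) (at_left t) \<and>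
        p - q = (-1) powi (int k - 1) * of_bool (r - k - 1 = s)" if "s \<le> 2 * r - 1" for s
  proof (intro exI conjI)
    have s: "s < 2 * r" using that r by simp
    show "(nderiv (punctured t) s (pw t (a 0) (b 0)) \<longlongrightarrow> b s t) (at_right t)"
      using s by (intro lim[OF _ ev(3)] pwl(3)) auto
    show "(nderiv (punctured t) s (pw t (a 0) (b 0)) \<longlongrightarrow> a s t) (at_left t)"
      using s by (intro lim[OF _ ev(4)[OF t'(1)]] pwl(4)) auto
    show "b s t - a s t = (-1) powi (int k - 1) * of_bool (r - k - 1 = s)" by (rule chain_jump[OF s])
  qed
qed

text \<open>The explicit branch shows that SOME picks a solution, and uniqueness identifies the two
  on the open interval. The endpoints are invisible to the norms.\<close>

lemma u_end_chain:
  assumes t1: "t = -1" and x: "x \<in> {-1<..<1}"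
  shows "u_end r k l x = b 0 x" "nderiv II r (u_end r k l) x = b r x"
proof -
  have p: "u_problem r k l (u_end r k l)"
    unfolding u_end_def by (rule someI[of "u_problem r k l"]) (rule u_problem_chain[OF t1])
  have eq: "u_end r k l y = b 0 y" if "y \<in> {-1<..<1}" for y
    by (rule u_problem_unique[OF r l p u_problem_chain[OF t1] that])
  then show "u_end r k l x = b 0 x" using x .
  have "nderiv {-1<..<1} r (u_end r k l) x = nderiv II r (u_end r k l) x"
    using x by (intro nderiv_open_subset) auto
  moreover have "nderiv {-1<..<1} r (u_end r k l) x = nderiv II r (b 0) x"
    using x eq by (intro nderiv_open_subset) auto
  ultimately show "nderiv II r (u_end r k l) x = b r x"
    using nderiv_right_branch[of r x] x by simp
qed

lemma u_sol_deriv_chain: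
  assumes x: "x \<in> punctured t"
  shows "u_sol_deriv r k l t x = pw t (a r) (b r) x"
proof (cases "t = -1")
  case True
  have eq: "u_end r k l y = b 0 y" if "y \<in> punctured t" for y
    using u_end_chain(1)[OF True] that True by auto
  have "nderiv (punctured t) r (u_end r k l) x = nderiv II r (b 0) x"
    using x eq t by (intro nderiv_open_subset) auto
  also have "\<dots> = b r x" using nderiv_right_branch[of r x] x t by auto
  finally show ?thesis using True x by (auto simp: u_sol_deriv_def u_sol_def pw_def)
next
  case False
  have t': "-1 < t" "t < 1" using t False by auto
  define u where "u = (SOME u. ut_problem r k l t u)"
  have p: "ut_problem r k l t u"
    unfolding u_def by (rule someI[of "ut_problem r k l t"]) (rule ut_problem_chain[OF False])
  have "u_sol_deriv r k l t x = nderiv (punctured t) r u x"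
    using False t' by (simp add: u_sol_deriv_def u_sol_def u_def)
  also have "\<dots> = nderiv (punctured t) r (pw t (a 0) (b 0)) x"
    using x ut_problem_unique[OF r l t' p ut_problem_chain[OF False]] by (intro nderiv_open_subset) auto
  also have "\<dots> = pw t (a r) (b r) x" using x by (intro nderiv_pw) auto
  finally show ?thesis .
qed

text \<open>The solution at 1 is a reflection of the one at -1: derivatives change only by signs,
  and reflection of [-1, 1] preserves the norm.\<close>

lemma norm2_u_sol_deriv_right:
  assumes t1: "t = -1"
  shows "norm2 (u_sol_deriv r k l 1) = norm2 (pw t (a r) (b r))"
proof -
  define F where "F j x = (-1) ^ (r - k) * ((-1) ^ j * b j (- x))" for j x
  have p: "punctured 1 = {-1<..<1}" by auto
  have d: "(F j has_real_derivative F (Suc j) x) (at x)" if "j < 2 * r" for j x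
  proof -
    have "(uminus has_real_derivative -1) (at x)" by (auto intro!: derivative_eq_intros)
    from DERIV_cmult[OF DERIV_cmult[OF DERIV_chain2[OF chain_derivs(2)[OF that] this]]]
    show ?thesis unfolding F_def by simp
  qed
  have eq: "u_sol_deriv r k l 1 x = F r x" if "x \<in> {-1<..<1}" for x
    unfolding u_sol_deriv_def p
  proof (rule nderiv_chain[of _ "2 * r"])
    show "u_sol r k l 1 x = F 0 x" if "x \<in> {-1<..<1}" for x
      using u_end_chain(1)[OF t1, of "- x"] that by (simp add: u_sol_def F_def)
    show "(F j has_real_derivative F (Suc j) x) (at x within {-1<..<1})" if "j < 2 * r" for j x
      by (rule has_field_derivative_at_within[OF d[OF that]])
  qed (use that at_within_open_nontrivial[of "{-1<..<1}"] in auto)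
  have eqF: "u_sol_deriv r k l 1 x = F r x" if "x \<in> II - {-1, 1}" for x
    using that by (intro eq) auto
  have cb: "continuous_on S (b r)" for S
    using chain_continuous(2)[of r] by (auto intro: continuous_on_subset)
  have cF: "continuous_on II (F r)"
    unfolding F_def by (intro continuous_intros continuous_on_compose2[OF cb[of UNIV]]) auto
  have "norm2 (u_sol_deriv r k l 1) = norm2 (F r)"
    by (intro norm2_cong_AE L2_finite_change[OF L2_continuous_on[OF cF], of "{-1, 1}"] L2_continuous_on[OF cF]
        AE_II_except_finite[of "{-1, 1}"] eqF) auto
  also have "\<dots> = norm2 (\<lambda>x. b r (- x))"
    unfolding F_def norm2_cmult by (simp add: power_abs)
  also have "\<dots> = norm2 (b r)" by (rule norm2_reflect)
  also have "\<dots> = norm2 (pw t (a r) (b r))"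
  proof (rule norm2_cong_on)
    \<comment> \<open>The only jump has order below \<open>r\<close>, so the value that
      \<open>pw\<close> takes from the left branch at -1 agrees with the right branch.\<close>
    have "r - k - 1 < r" using r by simp
    then have "b r t = a r t" using chain_jump[of r] by simp
    then show "b r x = pw t (a r) (b r) x" if "x \<in> II" for x using that t1 by (auto simp: pw_def)
  qed
  finally show ?thesis .
qed

end

text \<open>Explicit branches for all parameters and points determine \<open>U\<close> and
  \<open>V\<close>; the general analytic assumptions of \<open>kernel_family\<close> follow from the
  chain conditions alone, uniformly in the three cases.\<close>

locale branch_family =
  fixes r k :: nat and a b :: "real \<Rightarrow> real \<Rightarrow> nat \<Rightarrow> real \<Rightarrow> real"
  assumes rk: "(r = 1 \<and> k = 0) \<or> (r = 2 \<and> k \<in> {0, 1})"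
    and chain: "\<And>l t. 0 \<le> l \<Longrightarrow> t \<in> {-1..<1} \<Longrightarrow> solution_chain r k l t (a l t) (b l t)"
begin

definition \<sigma> :: real where "\<sigma> = - ((-1) ^ r)"
definition U :: "real \<Rightarrow> real \<Rightarrow> real \<Rightarrow> real" where "U l t = pw t (a l t 0) (b l t 0)"
definition V :: "real \<Rightarrow> real \<Rightarrow> real \<Rightarrow> real" where "V l t = pw t (a l t r) (b l t r)"

lemma r1: "1 \<le> r" using rk by auto

lemma derivs:
  assumes "0 \<le> l" "t \<in> {-1..<1}" "j < 2 * r"
  shows "(a l t j has_real_derivative a l t (Suc j) x) (at x)" "(b l t j has_real_derivative b l t (Suc j) x) (at x)"
  by (rule chain_derivs[OF r1 assms(1,2) chain[OF assms(1,2)] assms(3)])+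

lemma conts:
  assumes "0 \<le> l" "t \<in> {-1..<1}" "j \<le> 2 * r"
  shows "continuous_on UNIV (a l t j)" "continuous_on UNIV (b l t j)"
  by (rule chain_continuous[OF r1 assms(1,2) chain[OF assms(1,2)] assms(3)])+

lemma jump:
  assumes "0 \<le> l" "t \<in> {-1..<1}" "s < 2 * r"
  shows "b l t s t - a l t s t = (-1) powi (int k - 1) * of_bool (r - k - 1 = s)"
  by (rule chain_jump[OF r1 assms(1,2) chain[OF assms(1,2)] assms(3)])

lemma ends:
  assumes "0 \<le> l" "t \<in> {-1..<1}" "s < r"
  shows "a l t s (-1) = 0" "b l t s 1 = 0"
  by (rule chain_ends[OF r1 assms(1,2) chain[OF assms(1,2)] assms(3)])+

text \<open>The jump has order \<open>r - k - 1\<close>, which is below \<open>r\<close>. Hence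
  \<open>V\<close> and its derivatives below order \<open>r\<close> are continuous across
  \<open>t\<close>, which is what puts \<open>V\<close> into \<open>L2m r II\<close>.\<close>

lemma matching:
  assumes "0 \<le> l" "t \<in> {-1..<1}" "r \<le> s" "s < 2 * r"
  shows "a l t s t = b l t s t"
proof -
  have "r - k - 1 < r" using r1 by simp
  then have "r - k - 1 \<noteq> s" using assms(3) by simp
  then show ?thesis using jump[OF assms(1,2,4)] by simp
qed

lemma top_eq:
  assumes "0 \<le> l" "t \<in> {-1..<1}"
  shows "pw t (a l t (2 * r)) (b l t (2 * r)) x = \<sigma> * l * U l t x"
  using chain[OF assms] by (simp add: solution_chain_def pw_def U_def \<sigma>_def)

lemma U_L2: "0 \<le> l \<Longrightarrow> t \<in> {-1..<1} \<Longrightarrow> U l t \<in> L2 II"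
  unfolding U_def by (intro L2_pw conts) auto

lemma cmult_derivs:
  assumes "0 \<le> l" "t \<in> {-1..<1}" "j < 2 * r"
  shows "((\<lambda>x. c * a l t j x) has_real_derivative c * a l t (Suc j) x) (at x)"
    "((\<lambda>x. c * b l t j x) has_real_derivative c * b l t (Suc j) x) (at x)"
  using derivs[OF assms] by (auto intro: DERIV_cmult)

lemma scaled_V:
  assumes l: "0 \<le> l" and t: "t \<in> {-1..<1}"
  shows "(\<lambda>x. c * V l t x) \<in> L2m r II"
    "AE x in lebesgue_on II. nderiv II r (\<lambda>x. c * V l t x) x = c * (\<sigma> * l * U l t x)"
    "x \<in> II \<Longrightarrow> nderiv II k (\<lambda>x. c * V l t x) x = c * pw t (a l t (r + k)) (b l t (r + k)) x"
    "r = 2 \<Longrightarrow> x \<in> II \<Longrightarrow> nderiv II 1 (V l t) x = pw t (a l t 3) (b l t 3) x"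
proof -
  note d = cmult_derivs[OF l t]
  note m = matching[OF l t]
  have cont: "continuous_on UNIV (\<lambda>x. c * a l t (2 * r) x)" "continuous_on UNIV (\<lambda>x. c * b l t (2 * r) x)" for c
    using conts[OF l t, of "2 * r"] by (auto intro!: continuous_intros)
  have eq: "(\<lambda>x. c * V l t x) = pw t (\<lambda>x. c * a l t r x) (\<lambda>x. c * b l t r x)" for c
    unfolding V_def by (rule pw_cmult)
  have top: "pw t (\<lambda>x. c * a l t (2 * r) x) (\<lambda>x. c * b l t (2 * r) x) x = c * (\<sigma> * l * U l t x)" for c x
    using top_eq[OF l t, of x] by (simp add: pw_cmult[symmetric])
  have res: "(\<lambda>x. c * V l t x) \<in> L2m r II \<and>
     (\<forall>x\<in>II - {t}. nderiv II r (\<lambda>x. c * V l t x) x = c * (\<sigma> * l * U l t x)) \<and>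
     (r = 2 \<longrightarrow> (\<forall>x\<in>II. nderiv II 1 (\<lambda>x. c * V l t x) x = c * pw t (a l t 3) (b l t 3) x))" for c
    using rk
  proof
    assume rk1: "r = 1 \<and> k = 0"
    then have s: "Suc r = 2 * r" by simp
    have *: "(\<lambda>x. c * a l t r x) t = (\<lambda>x. c * b l t r x) t" using m[of r] r1 by simp
    note D = d[of r, unfolded s]
    show ?thesis
      using L2m_1_pw[OF D cont *] rk1 top[of c] unfolding eq by auto
  next
    assume rk2: "r = 2 \<and> k \<in> {0, 1}"
    then have s: "Suc r = 3" "Suc 3 = 2 * r" "r < 2 * r" "3 < 2 * r" by auto
    have *: "(\<lambda>x. c * a l t r x) t = (\<lambda>x. c * b l t r x) t" "(\<lambda>x. c * a l t 3 x) t = (\<lambda>x. c * b l t 3 x) t"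
      using m[of r] m[of 3] rk2 by auto
    note D1 = d[of r, unfolded s(1), OF s(3)] and D2 = d[of 3, unfolded s(2), OF s(4)]
    show ?thesis
      using L2m_2_pw[OF D1(1) D2(1) D1(2) D2(2) cont *] rk2 top[of c] unfolding eq pw_cmult[symmetric] by auto
  qed
  show "(\<lambda>x. c * V l t x) \<in> L2m r II" using res by blast
  show "AE x in lebesgue_on II. nderiv II r (\<lambda>x. c * V l t x) x = c * (\<sigma> * l * U l t x)"
    by (rule AE_II_except_finite[of "{t}"]) (use res in auto)
  have two: "nderiv II 1 (\<lambda>x. c * V l t x) x = c * pw t (a l t 3) (b l t 3) x" if "r = 2" "x \<in> II" for c x
    using res[of c] that by blast
  show "r = 2 \<Longrightarrow> x \<in> II \<Longrightarrow> nderiv II 1 (V l t) x = pw t (a l t 3) (b l t 3) x"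
    using two[of x 1] by simp
  show "nderiv II k (\<lambda>x. c * V l t x) x = c * pw t (a l t (r + k)) (b l t (r + k)) x" if x: "x \<in> II"
  proof (cases "k = 0")
    case True
    then show ?thesis by (simp add: V_def)
  next
    case False
    then have "r = 2" "k = 1" using rk by auto
    then show ?thesis using two[of x c] x by (simp del: One_nat_def)
  qed
qed

lemma nderiv_V:
  assumes "0 \<le> l" "t \<in> {-1..<1}" "x \<in> II"
  shows "nderiv II k (V l t) x = pw t (a l t (r + k)) (b l t (r + k)) x"
  using scaled_V(3)[OF assms, of 1] by simp

lemma G_eq: "0 \<le> l \<Longrightarrow> t \<in> {-1..<1} \<Longrightarrow> nderiv II k (V l t) t = a l t (r + k) t"
  using nderiv_V[of l t t] by (simp add: pw_def)

lemma V_L2: "0 \<le> l \<Longrightarrow> t \<in> {-1..<1} \<Longrightarrow> V l t \<in> L2 II"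
  unfolding V_def using r1 by (intro L2_pw conts) auto

text \<open>Integrate by parts \<open>r\<close> times. The boundary terms at -1 and 1 vanish because
  the kernel is clamped there, and the single jump, of order \<open>r - k - 1\<close>, meets exactly
  the derivative of order \<open>k\<close> of \<open>f\<close>.\<close>

lemma representation:
  assumes l: "0 \<le> l" and t: "t \<in> {-1..<1}" and f: "f \<in> L2m r II"
  shows "nderiv II k f t = ip (V l t) f + \<sigma> * ip (U l t) (nderiv II r f)"
proof -
  have t': "-1 \<le> t" "t \<le> 1" using t by auto
  have parts: "ip (pw t (a l t j) (b l t j)) dh + ip (pw t (a l t (Suc j)) (b l t (Suc j))) h =
      - ((-1) powi (int k - 1) * of_bool (r - k - 1 = j)) * h t"
    if "j < r" "abs_cont_on II h" "dh \<in> L2 II" "\<And>x. x \<in> {-1<..<1} \<Longrightarrow> dh x = vector_derivative h (at x)" for j h dh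
  proof -
    have j: "j < 2 * r" "Suc j \<le> 2 * r" using that(1) by auto
    show ?thesis
      using ip_pw_by_parts[OF t' that(2-4) derivs[OF l t j(1)] conts[OF l t j(2)]]
        ends[OF l t that(1)] jump[OF l t j(1)] by (simp add: algebra_simps)
  qed
  show ?thesis using rk
  proof
    assume "r = 1 \<and> k = 0"
    then have r: "r = 1" and k: "k = 0" by auto
    have f: "f \<in> L2m 1 II" using f r by simp
    show ?thesis
      using parts[of 0, OF _ L2m_1D(1,2,5)[OF f]] unfolding U_def V_def \<sigma>_def by (simp add: r k)
  next
    assume rk2: "r = 2 \<and> k \<in> {0, 1}"
    then have r: "r = 2" by simp
    have f: "f \<in> L2m 2 II" using f r by simp
    have p0: "ip (pw t (a l t 0) (b l t 0)) (nderiv II 2 f) + ip (pw t (a l t 1) (b l t 1)) (nderiv II 1 f) =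
      - ((-1) powi (int k - 1) * of_bool (r - k - 1 = 0)) * nderiv II 1 f t"
      using parts[of 0, OF _ L2m_2D(1,2,9)[OF f]] r by simp
    have p1: "ip (pw t (a l t 1) (b l t 1)) (nderiv II 1 f) + ip (pw t (a l t 2) (b l t 2)) f =
      - ((-1) powi (int k - 1) * of_bool (r - k - 1 = 1)) * f t"
      using parts[of 1, OF _ L2m_2D(8,7,10)[OF f]] r by (simp add: numeral_2_eq_2)
    from rk2 have "k = 0 \<or> k = 1" by auto
    then show ?thesis
      using p0 p1 unfolding U_def V_def \<sigma>_def by (auto simp: r)
  qed
qed

text \<open>Two solutions at the same \<open>t\<close> have the same jumps, so their difference is
  continuous in each order and vanishes at -1. The Poincare inequality, applied \<open>r\<close>
  times with constant 2, gives at most 4.\<close>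

lemma difference_bound:
  assumes lm: "0 \<le> l" "0 \<le> m" and t: "t \<in> {-1..<1}"
  shows "norm2 (\<lambda>x. U l t x - U m t x) \<le> 4 * norm2 (\<lambda>x. V l t x - V m t x)"
proof -
  define W where "W s x = pw t (a l t s) (b l t s) x - pw t (a m t s) (b m t s) x" for s x
  have step: "norm2 (W s) \<le> 2 * norm2 (W (Suc s))" if s: "s < r" for s
  proof -
    have s': "s < 2 * r" "s \<le> 2 * r" "Suc s \<le> 2 * r" using s by auto
    have eq: "W j = pw t (\<lambda>x. a l t j x - a m t j x) (\<lambda>x. b l t j x - b m t j x)" for j
      unfolding W_def by (rule pw_diff)
    have D: "((\<lambda>x. a l t s x - a m t s x) has_real_derivative a l t (Suc s) x - a m t (Suc s) x) (at x)"
            "((\<lambda>x. b l t s x - b m t s x) has_real_derivative b l t (Suc s) x - b m t (Suc s) x) (at x)" for x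
      using derivs[OF lm(1) t s'(1)] derivs[OF lm(2) t s'(1)] by (auto intro: DERIV_diff)
    have C: "continuous_on UNIV (\<lambda>x. a l t j x - a m t j x)" "continuous_on UNIV (\<lambda>x. b l t j x - b m t j x)"
      if "j \<le> 2 * r" for j
      using conts[OF lm(1) t that] conts[OF lm(2) t that] by (auto intro!: continuous_intros)
    have "(\<lambda>x. a l t s x - a m t s x) t = (\<lambda>x. b l t s x - b m t s x) t"
      using jump[OF lm(1) t s'(1)] jump[OF lm(2) t s'(1)] by simp
    then show ?thesis
      unfolding eq
    proof (intro norm2_le_norm2_derivative[of _ _ t] continuous_on_pw C L2_pw pw_derivative_off D)
      show "pw t (\<lambda>x. a l t s x - a m t s x) (\<lambda>x. b l t s x - b m t s x) (-1) = 0"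
        using ends(1)[OF lm(1) t s] ends(1)[OF lm(2) t s] t by (simp add: pw_def)
    qed (use s' in auto)
  qed
  have UV: "(\<lambda>x. U l t x - U m t x) = W 0" "(\<lambda>x. V l t x - V m t x) = W r"
    by (auto simp: U_def V_def W_def)
  show ?thesis unfolding UV
    using rk step[of 0] step[of 1] norm2_nonneg[of "W r"] by (auto simp: numeral_2_eq_2)
qed

text \<open>What remains for a concrete family is the size of G, its comparison with the endpoint,
  the next derivative, and the polynomial form at parameter 0.\<close>

lemma kernel_familyI:
  assumes G_le: "\<And>l t. 0 < l \<Longrightarrow> t \<in> {-1..<1} \<Longrightarrow> a l t (r + k) t \<le> a l (-1) (r + k) (-1)"
    and G_at_top: "\<And>t. t \<in> {-1..<1} \<Longrightarrow> filterlim (\<lambda>l. a l t (r + k) t) at_top at_top"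
    and G_sublinear: "((\<lambda>l. a l (-1) (r + k) (-1) / l) \<longlongrightarrow> 0) at_top"
    and V_next: "\<And>l. 0 \<le> l \<Longrightarrow> Suc k < r \<Longrightarrow> \<exists>C. \<forall>s\<in>{-1<..<1}. \<forall>t\<in>{-1<..<1}.
      (norm2 (\<lambda>x. nderiv II (Suc k) (V l t) x - nderiv II (Suc k) (V l s) x))\<^sup>2 \<le>
      C * ((norm2 (\<lambda>x. V l t x - V l s x))\<^sup>2 + l * (norm2 (\<lambda>x. U l t x - U l s x))\<^sup>2)"
    and V_poly: "\<exists>Q. degree Q \<le> r - 1 \<and> (\<forall>x\<in>II. poly Q x = V 0 (-1) x)"
  shows "kernel_family r k \<sigma> U V"
proof
  show "\<sigma> * \<sigma> = 1" unfolding \<sigma>_def by (simp flip: power_mult_distrib)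
  show "nderiv II k (\<lambda>x. c * V l t x) x = c * nderiv II k (V l t) x" if "0 \<le> l" "t \<in> {-1..<1}" "x \<in> II" for l t c x
    using scaled_V(3)[OF that] nderiv_V[OF that] by simp
  show "nderiv II k (V l t) t \<le> nderiv II k (V l (-1)) (-1)" if "0 < l" "t \<in> {-1..<1}" for l t
    using G_le[OF that] that G_eq[of l t] G_eq[of l "-1"] by simp
  show "filterlim (\<lambda>l. nderiv II k (V l t) t) at_top at_top" if "t \<in> {-1..<1}" for t
    using G_at_top[OF that]
    by (rule filterlim_at_top_mono) (use eventually_ge_at_top[of 0] in \<open>eventually_elim, simp add: G_eq that del: atLeastLessThan_iff\<close>)
  show "((\<lambda>l. nderiv II k (V l (-1)) (-1) / l) \<longlongrightarrow> 0) at_top"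
    using G_sublinear
    by (rule Lim_transform_eventually) (use eventually_ge_at_top[of 0] in \<open>eventually_elim, simp add: G_eq\<close>)
  show "u_sol_deriv r k l t x = V l t x" if "0 \<le> l" "t \<in> {-1..<1}" "x \<in> punctured t" for l t x
    unfolding V_def by (rule u_sol_deriv_chain[OF r1 that(1,2) chain[OF that(1,2)] that(3)])
  show "norm2 (u_sol_deriv r k l 1) = norm2 (V l (-1))" if "0 \<le> l" for l
    unfolding V_def by (rule norm2_u_sol_deriv_right[OF r1 that _ chain[OF that]]) auto
  show "u_end r k l x = U l (-1) x" "nderiv II r (u_end r k l) x = V l (-1) x"
    if "0 \<le> l" "x \<in> {-1<..<1}" for l x
    using u_end_chain[OF r1 that(1) _ chain[OF that(1)] _ that(2), of "-1"] that(2) by (auto simp: U_def V_def pw_def)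
qed (rule rk U_L2 scaled_V(1,2) representation difference_bound V_next V_poly; assumption)+

end

section \<open>First order\<close>

definition ch1 :: "real \<Rightarrow> real \<Rightarrow> real" where
  "ch1 l z = cosh (sqrt l * z)"

text \<open>The removable singularity at \<open>l = 0\<close> is filled in, so that the branches
  also cover parameter 0.\<close>

definition sh1 :: "real \<Rightarrow> real \<Rightarrow> real" where
  "sh1 l z = (if l = 0 then z else sinh (sqrt l * z) / sqrt l)"

lemma ch1_sh1_derivs:
  assumes "0 \<le> l"
  shows "(sh1 l has_real_derivative ch1 l z) (at z)" "(ch1 l has_real_derivative l * sh1 l z) (at z)"
proof -
  show "(sh1 l has_real_derivative ch1 l z) (at z)"
  proof (cases "l = 0")
    case True
    then show ?thesis by (simp add: sh1_def[abs_def] ch1_def)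
  next
    case False
    have "((\<lambda>z. sinh (sqrt l * z)) has_real_derivative sqrt l * cosh (sqrt l * z)) (at z)"
      by (auto intro!: derivative_eq_intros)
    from DERIV_cdivide[OF this, of "sqrt l"] show ?thesis
      using False by (simp add: sh1_def[abs_def] ch1_def)
  qed
  have "((\<lambda>z. cosh (sqrt l * z)) has_real_derivative sqrt l * sinh (sqrt l * z)) (at z)"
    by (auto intro!: derivative_eq_intros)
  moreover have "sqrt l * sinh (sqrt l * z) = l * sh1 l z"
    using assms by (simp add: sh1_def real_div_sqrt flip: times_divide_eq_left)
  ultimately show "(ch1 l has_real_derivative l * sh1 l z) (at z)"
    by (simp add: ch1_def[abs_def])
qed

lemma sh1_add: "sh1 l (p + q) = sh1 l p * ch1 l q + ch1 l p * sh1 l q"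
  by (simp add: sh1_def ch1_def sinh_add distrib_left add_divide_distrib)

lemma sh1_pos: "0 \<le> l \<Longrightarrow> 0 < sh1 l 2"
  by (simp add: sh1_def)

text \<open>Form of a Green's function: each branch vanishes at its own endpoint, the two prefactors
  make the first derivatives agree at \<open>t\<close>, and the addition formula for
  \<open>sh1 l 2\<close> makes the jump equal to -1.\<close>

definition left1 :: "real \<Rightarrow> real \<Rightarrow> nat \<Rightarrow> real \<Rightarrow> real" where
  "left1 l t j x = ch1 l (1 - t) / sh1 l 2 *
     (if j = 0 then sh1 l (1 + x) else if j = 1 then ch1 l (1 + x) else l * sh1 l (1 + x))"

definition right1 :: "real \<Rightarrow> real \<Rightarrow> nat \<Rightarrow> real \<Rightarrow> real" where
  "right1 l t j x = ch1 l (1 + t) / sh1 l 2 *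
     (if j = 0 then - sh1 l (1 - x) else if j = 1 then ch1 l (1 - x) else - (l * sh1 l (1 - x)))"

lemma shifted_derivs:
  assumes "\<And>z. (f has_real_derivative f' z) (at z)"
  shows "((\<lambda>x. f (1 + x)) has_real_derivative f' (1 + x)) (at x)"
    "((\<lambda>x. f (1 - x)) has_real_derivative - f' (1 - x)) (at x)"
proof -
  have "((\<lambda>x. 1 + x) has_real_derivative 1) (at x)" by (auto intro!: derivative_eq_intros)
  from DERIV_chain2[OF assms this] show "((\<lambda>x. f (1 + x)) has_real_derivative f' (1 + x)) (at x)" by simp
  have "((\<lambda>x. 1 - x) has_real_derivative -1) (at x)" by (auto intro!: derivative_eq_intros)
  from DERIV_chain2[OF assms this] show "((\<lambda>x. f (1 - x)) has_real_derivative - f' (1 - x)) (at x)" by simp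
qed

lemma solution_chain_1:
  assumes l: "0 \<le> l" and t: "t \<in> {-1..<1}"
  shows "solution_chain 1 0 l t (left1 l t) (right1 l t)"
proof -
  note d = ch1_sh1_derivs[OF l]
  note sd = shifted_derivs[of "sh1 l" "ch1 l", OF d(1)] shifted_derivs[of "ch1 l" "\<lambda>z. l * sh1 l z", OF d(2)]
  have "(left1 l t j has_real_derivative left1 l t (Suc j) x) (at x)" if "j < 2" for j x
  proof -
    have "j = 0 \<or> j = 1" using that by auto
    then show ?thesis
    proof
      assume j: "j = 0"
      from DERIV_cmult[OF sd(1), of "ch1 l (1 - t) / sh1 l 2" x] show ?thesis by (simp add: j left1_def[abs_def])
    next
      assume j: "j = 1"
      from DERIV_cmult[OF sd(3), of "ch1 l (1 - t) / sh1 l 2" x] show ?thesis by (simp add: j left1_def[abs_def])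
    qed
  qed
  moreover have "(right1 l t j has_real_derivative right1 l t (Suc j) x) (at x)" if "j < 2" for j x
  proof -
    have "j = 0 \<or> j = 1" using that by auto
    then show ?thesis
    proof
      assume j: "j = 0"
      from DERIV_cmult[OF DERIV_minus[OF sd(2)], of "ch1 l (1 + t) / sh1 l 2" x] show ?thesis by (simp add: j right1_def[abs_def])
    next
      assume j: "j = 1"
      from DERIV_cmult[OF sd(4), of "ch1 l (1 + t) / sh1 l 2" x] show ?thesis by (simp add: j right1_def[abs_def])
    qed
  qed
  moreover have "right1 l t s t - left1 l t s t = (-1) powi (int 0 - 1) * of_bool (1 - 0 - 1 = s)" if "s < 2" for s
  proof -
    have "s = 0 \<or> s = 1" using that by auto
    moreover have "sh1 l 2 = sh1 l (1 + t) * ch1 l (1 - t) + ch1 l (1 + t) * sh1 l (1 - t)"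
      using sh1_add[of l "1 + t" "1 - t"] by simp
    ultimately show ?thesis
      using sh1_pos[OF l] by (auto simp: left1_def right1_def divide_simps)
  qed
  moreover have "sh1 l 0 = 0" by (simp add: sh1_def)
  ultimately show ?thesis
    unfolding solution_chain_def by (auto simp: left1_def right1_def)
qed

interpretation family1: branch_family 1 0 left1 right1
proof
  show "(1::nat) = 1 \<and> (0::nat) = 0 \<or> (1::nat) = 2 \<and> (0::nat) \<in> {0, 1}" by simp
qed (rule solution_chain_1)

lemma G1_eq: "0 < l \<Longrightarrow> left1 l t 1 t = sqrt l * (cosh (sqrt l * (1 - t)) * cosh (sqrt l * (1 + t)) / sinh (sqrt l * 2))"
  by (simp add: left1_def ch1_def sh1_def)

lemma kernel_family_1: "kernel_family 1 0 family1.\<sigma> family1.U family1.V"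
proof (rule family1.kernel_familyI)
  fix l t :: real assume l: "0 < l" and t: "t \<in> {-1..<1}"
  have s: "0 < sinh (sqrt l * 2)" using l by simp
  \<comment> \<open>In the addition formula for cosh the product of the two sinh terms is
    nonnegative.\<close>
  have "cosh (sqrt l * (1 - t)) * cosh (sqrt l * (1 + t)) \<le> cosh (sqrt l * (1 - t) + sqrt l * (1 + t))"
    unfolding cosh_add using l t by (simp add: mult_nonneg_nonneg)
  also have "sqrt l * (1 - t) + sqrt l * (1 + t) = sqrt l * 2" by (simp add: algebra_simps)
  finally have "cosh (sqrt l * (1 - t)) * cosh (sqrt l * (1 + t)) / sinh (sqrt l * 2) \<le> cosh (sqrt l * 2) / sinh (sqrt l * 2)"
    using s by (intro divide_right_mono) auto
  then have "sqrt l * (cosh (sqrt l * (1 - t)) * cosh (sqrt l * (1 + t)) / sinh (sqrt l * 2)) \<le>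
      sqrt l * (cosh (sqrt l * 2) / sinh (sqrt l * 2))"
    using l by (intro mult_left_mono) auto
  also have "\<dots> = left1 l (-1) 1 (-1)" unfolding G1_eq[OF l] by simp
  finally have "left1 l t 1 t \<le> left1 l (-1) 1 (-1)" unfolding G1_eq[OF l, of t] .
  then show "left1 l t (1 + 0) t \<le> left1 l (-1) (1 + 0) (-1)" by simp
next
  fix t :: real assume t: "t \<in> {-1..<1}"
  \<comment> \<open>The factor 1/2 comes from sinh (p + q) being at most 2 cosh p cosh q.\<close>
  have "filterlim (\<lambda>l::real. sqrt l * (1 / 2)) at_top at_top"
    by (intro filterlim_tendsto_pos_mult_at_top[where c = "1 / 2"] sqrt_at_top tendsto_const filterlim_at_top_mult_tendsto_pos) auto
  then have "filterlim (\<lambda>l. left1 l t 1 t) at_top at_top"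
  proof (rule filterlim_at_top_mono)
    show "\<forall>\<^sub>F l in at_top. sqrt l * (1 / 2) \<le> left1 l t 1 t"
      using eventually_gt_at_top[of 0]
    proof eventually_elim
      case (elim l)
      let ?p = "sqrt l * (1 - t)" and ?q = "sqrt l * (1 + t)"
      have s: "0 < sinh (sqrt l * 2)" using elim by simp
      have "sinh (sqrt l * 2) = sinh (?p + ?q)" by (simp add: algebra_simps)
      also have "\<dots> = sinh ?p * cosh ?q + cosh ?p * sinh ?q" by (rule sinh_add)
      also have "\<dots> \<le> cosh ?p * cosh ?q + cosh ?p * cosh ?q"
        by (intro add_mono mult_left_mono mult_right_mono) (simp_all add: sinh_le_cosh_real)
      finally have "1 / 2 \<le> cosh ?p * cosh ?q / sinh (sqrt l * 2)" using s by (simp add: field_simps)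
      then show ?case unfolding G1_eq[OF elim] using elim by (intro mult_left_mono) auto
    qed
  qed
  then show "filterlim (\<lambda>l. left1 l t (1 + 0) t) at_top at_top" by simp
next
  have "((\<lambda>l. left1 l (-1) 1 (-1) / l) \<longlongrightarrow> 0) at_top"
  proof (rule Lim_null_comparison)
    show "((\<lambda>l::real. 2 / sqrt l) \<longlongrightarrow> 0) at_top"
      by (intro tendsto_divide_0[OF tendsto_const] filterlim_at_top_imp_at_infinity sqrt_at_top)
    show "\<forall>\<^sub>F l in at_top. norm (left1 l (-1) 1 (-1) / l) \<le> 2 / sqrt l"
      using eventually_ge_at_top[of 1]
    proof eventually_elim
      case (elim l)
      let ?x = "sqrt l * 2"
      have x: "2 \<le> ?x" "0 < l" using elim by auto
      have "1 + ?x \<le> exp ?x" by (rule exp_ge_add_one_self)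
      moreover have "exp (- ?x) \<le> 1" using x by simp
      \<comment> \<open>Written with exponentials, this is cosh at most twice sinh.\<close>
      ultimately have "3 * exp (- ?x) \<le> exp ?x" using x by linarith
      then have "cosh ?x \<le> 2 * sinh ?x" by (simp add: cosh_field_def sinh_field_def field_simps)
      then have c: "cosh ?x / sinh ?x \<le> 2" using x by (simp add: field_simps)
      have "left1 l (-1) 1 (-1) / l = (cosh ?x / sinh ?x) / sqrt l"
        unfolding G1_eq[OF x(2)] using x by (simp add: field_simps)
      moreover have "(cosh ?x / sinh ?x) / sqrt l \<le> 2 / sqrt l"
        using c x by (intro divide_right_mono) auto
      moreover have "0 \<le> (cosh ?x / sinh ?x) / sqrt l" using x by simp
      ultimately show ?case by simp
    qed
  qed
  then show "((\<lambda>l. left1 l (-1) (1 + 0) (-1) / l) \<longlongrightarrow> 0) at_top" by simp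
next
  \<comment> \<open>Evaluation of constants on an interval of length 2 is represented by the
    constant 1/2.\<close>
  show "\<exists>Q. degree Q \<le> 1 - 1 \<and> (\<forall>x\<in>II. poly Q x = family1.V 0 (-1) x)"
    unfolding family1.V_def
    by (intro exI[of _ "[:1 / 2:]"]) (auto simp: pw_def left1_def right1_def ch1_def sh1_def)
qed simp

text \<open>The functions \<open>k0\<close> to \<open>k3\<close> are the sums of the terms x^n / n!
  of the exponential series with n congruent to 0, 1, 2, 3 modulo 4. They solve f'''' = f and are
  permuted cyclically by differentiation.\<close>

definition k0 :: "real \<Rightarrow> real" where "k0 x = (cosh x + cos x) / 2"
definition k1 :: "real \<Rightarrow> real" where "k1 x = (sinh x + sin x) / 2"
definition k2 :: "real \<Rightarrow> real" where "k2 x = (cosh x - cos x) / 2"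
definition k3 :: "real \<Rightarrow> real" where "k3 x = (sinh x - sin x) / 2"

lemma k_derivs:
  "(k0 has_real_derivative k3 x) (at x)" "(k1 has_real_derivative k0 x) (at x)"
  "(k2 has_real_derivative k1 x) (at x)" "(k3 has_real_derivative k2 x) (at x)"
  unfolding k0_def[abs_def] k1_def[abs_def] k2_def[abs_def] k3_def[abs_def]
  by (auto intro!: derivative_eq_intros)

lemma nonneg_if_derivative_nonneg:
  fixes f f' :: "real \<Rightarrow> real"
  assumes "\<And>x. (f has_real_derivative f' x) (at x)" "\<And>x. 0 \<le> x \<Longrightarrow> 0 \<le> f' x" "0 \<le> x"
  shows "f 0 \<le> f x"
  using assms by (intro DERIV_nonneg_imp_nondecreasing[of 0 x f]) auto

text \<open>Start with \<open>k2\<close>, as cos is at most 1 and cosh at least 1, and integrate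
  along the cycle: \<open>k3\<close> has derivative \<open>k2\<close>, \<open>k0\<close> has
  \<open>k3\<close>, and \<open>k1\<close> has \<open>k0\<close>.\<close>

lemma k_nonneg:
  assumes "0 \<le> x"
  shows "1 \<le> k0 x" "0 \<le> k1 x" "0 \<le> k2 x" "0 \<le> k3 x"
proof -
  have z: "k0 0 = 1" "k1 0 = 0" "k2 0 = 0" "k3 0 = 0" by (simp_all add: k0_def k1_def k2_def k3_def)
  have 2: "0 \<le> k2 y" for y
    unfolding k2_def using order_trans[OF cos_le_one cosh_real_ge_1] by simp
  have 3: "0 \<le> k3 y" if "0 \<le> y" for y
    using nonneg_if_derivative_nonneg[OF k_derivs(4) 2 that] z by simp
  have 0: "1 \<le> k0 y" if "0 \<le> y" for y
    using nonneg_if_derivative_nonneg[OF k_derivs(1) 3 that] z by simp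
  have "0 \<le> k0 y" if "0 \<le> y" for y using 0[OF that] by simp
  from nonneg_if_derivative_nonneg[OF k_derivs(2) this] have 1: "0 \<le> k1 y" if "0 \<le> y" for y using z that by simp
  show "1 \<le> k0 x" "0 \<le> k1 x" "0 \<le> k2 x" "0 \<le> k3 x" using 0 1 2 3 assms by auto
qed

lemma k_add:
  "k0 (x + y) = k0 x * k0 y + k1 x * k3 y + k2 x * k2 y + k3 x * k1 y"
  "k1 (x + y) = k0 x * k1 y + k1 x * k0 y + k2 x * k3 y + k3 x * k2 y"
  "k3 (x + y) = k0 x * k3 y + k1 x * k2 y + k2 x * k1 y + k3 x * k0 y"
  unfolding k0_def k1_def k2_def k3_def cosh_add sinh_add cos_add sin_add by (simp_all add: field_simps)

text \<open>A consequence of the quadratic identities for cosh, sinh and for cos, sin. It collapses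
  the unmixed terms of the determinant of the jump conditions.\<close>

lemma k_square: "2 * k1 x * k3 x - (k2 x)\<^sup>2 = (k0 x)\<^sup>2 - 1"
proof -
  have "2 * ((S + s) / 2) * ((S - s) / 2) - ((C - c) / 2)\<^sup>2 = ((C + c) / 2)\<^sup>2 - 1"
    if "C\<^sup>2 = S\<^sup>2 + 1" "s\<^sup>2 = 1 - c\<^sup>2" for C S c s :: real
    using that by (simp add: power2_eq_square field_simps)
  from this[OF cosh_square_eq sin_squared_eq] show ?thesis
    unfolding k0_def k1_def k2_def k3_def .
qed

text \<open>This is the reason why the representers are largest at the endpoints.\<close>
lemma k_add_le:
  assumes "0 \<le> x" "0 \<le> y"
  shows "k3 x * (1 + k0 y) + k3 y * (1 + k0 x) \<le> 2 * k3 (x + y)"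
    "k1 x * (1 + k0 y) + k1 y * (1 + k0 x) \<le> 2 * k1 (x + y)"
proof -
  note n = k_nonneg[OF assms(1)] k_nonneg[OF assms(2)]
  have p: "0 \<le> k1 x * k2 y" "0 \<le> k2 x * k1 y" "0 \<le> k2 x * k3 y" "0 \<le> k3 x * k2 y"
    using n by (auto intro: mult_nonneg_nonneg)
  have "k3 x * 1 \<le> k3 x * k0 y" "k3 y * 1 \<le> k3 y * k0 x" "k1 x * 1 \<le> k1 x * k0 y" "k1 y * 1 \<le> k1 y * k0 x"
    using n by (intro mult_left_mono; simp)+
  then show "k3 x * (1 + k0 y) + k3 y * (1 + k0 x) \<le> 2 * k3 (x + y)"
    "k1 x * (1 + k0 y) + k1 y * (1 + k0 x) \<le> 2 * k1 (x + y)"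
    unfolding k_add using p by (simp_all add: algebra_simps)
qed

text \<open>For y at least 5 the exponential is large enough to absorb the bounded terms sin, cos
  and exp(-y). The constants are generous, as they serve only growth estimates.\<close>

lemma k_bounds:
  assumes x: "0 \<le> x" "5 \<le> y"
  shows "exp y / 8 \<le> k1 y" "exp y / 8 \<le> k3 y" "exp x / 4 \<le> 1 + k0 x" "k0 x - 1 \<le> exp x / 2"
    "k1 y \<le> exp y / 2" "k3 y \<le> exp y / 2" "exp y / 64 \<le> k0 y - 1"
proof -
  have gen: "E / 8 \<le> ((E - i) / 2 + s) / 2" "E / 8 \<le> ((E - i) / 2 - s) / 2"
    "((E - i) / 2 + s) / 2 \<le> E / 2" "((E - i) / 2 - s) / 2 \<le> E / 2" "E / 64 \<le> ((E + i) / 2 + s) / 2 - 1"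
    if "12 \<le> E" "0 \<le> i" "i \<le> 1" "-1 \<le> s" "s \<le> 1" for E i s :: real
    using that by (simp_all add: field_simps)
  have gen': "E / 4 \<le> 1 + ((E + i) / 2 + s) / 2" "((E + i) / 2 + s) / 2 - 1 \<le> E / 2"
    if "1 \<le> E" "0 \<le> i" "i \<le> 1" "-1 \<le> s" "s \<le> 1" for E i s :: real
    using that by (simp_all add: field_simps)
  \<comment> \<open>Squaring gives 49/4, hence \<open>exp y\<close> is at least 12.\<close>
  have "1 + 5 / 2 \<le> exp (5 / 2 :: real)" by (rule exp_ge_add_one_self)
  then have "(7 / 2) * (7 / 2) \<le> exp (5 / 2 :: real) * exp (5 / 2)" by (intro mult_mono) auto
  also have "\<dots> = exp (5 :: real)" by (simp add: exp_add[symmetric])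
  also have "\<dots> \<le> exp y" using x by simp
  finally have e: "12 \<le> exp y" by simp
  have ey: "0 \<le> exp (- y)" "exp (- y) \<le> 1" "0 \<le> exp (- x)" "exp (- x) \<le> 1" "1 \<le> exp x" using x by auto
  have s: "sinh y = (exp y - exp (- y)) / 2" "cosh y = (exp y + exp (- y)) / 2" "cosh x = (exp x + exp (- x)) / 2"
    by (simp_all add: sinh_field_def cosh_field_def)
  show "exp y / 8 \<le> k1 y" "exp y / 8 \<le> k3 y" "k1 y \<le> exp y / 2" "k3 y \<le> exp y / 2"
    unfolding k1_def k3_def s by (rule gen[OF e ey(1,2) sin_ge_minus_one sin_le_one])+
  show "exp y / 64 \<le> k0 y - 1"
    unfolding k0_def s by (rule gen(5)[OF e ey(1,2) cos_ge_minus_one cos_le_one])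
  show "exp x / 4 \<le> 1 + k0 x" "k0 x - 1 \<le> exp x / 2"
    unfolding k0_def s by (rule gen'[OF ey(5,3,4) cos_ge_minus_one cos_le_one])+
qed

section \<open>Second order\<close>

text \<open>Strict version of the same integration along the cycle; it makes the determinant of the
  jump conditions nonzero.\<close>

lemma k0_gt_1:
  assumes "0 < x"
  shows "1 < k0 x"
proof -
  have 2: "0 < k2 y" if "0 < y" for y
  proof -
    have "1 < cosh y" using cosh_real_ge_1[of y] cosh_real_one_iff[of y] that by linarith
    then have "cos y < cosh y" using cos_le_one[of y] by (rule le_less_trans[rotated])
    then show ?thesis by (simp add: k2_def)
  qed
  have c: "continuous_on {0..y} k0" "continuous_on {0..y} k3" for y
    by (rule DERIV_continuous_on[OF has_field_derivative_at_within[OF k_derivs(1)]]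
             DERIV_continuous_on[OF has_field_derivative_at_within[OF k_derivs(4)]])+
  have 3: "0 < k3 y" if "0 < y" for y
    using DERIV_pos_imp_increasing_open[OF that _ c(2)] k_derivs(4) 2 by (force simp: k3_def)
  show ?thesis
    using DERIV_pos_imp_increasing_open[OF assms _ c(1)] k_derivs(1) 3 by (force simp: k0_def)
qed

text \<open>The solutions of $f'''' + \lambda f = 0$ normalised at the origin, where $\lambda = 4\omega^4$.\<close>

definition freq :: "real \<Rightarrow> real" where "freq l = sqrt (sqrt (l / 4))"

definition e0 :: "real \<Rightarrow> real \<Rightarrow> real" where
  "e0 l z = cosh (freq l * z) * cos (freq l * z)"
definition e1 :: "real \<Rightarrow> real \<Rightarrow> real" where
  "e1 l z = (if l = 0 then z
     else (cosh (freq l * z) * sin (freq l * z) + sinh (freq l * z) * cos (freq l * z)) / (2 * freq l))"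
definition e2 :: "real \<Rightarrow> real \<Rightarrow> real" where
  "e2 l z = (if l = 0 then z\<^sup>2 / 2 else sinh (freq l * z) * sin (freq l * z) / (2 * (freq l)\<^sup>2))"
definition e3 :: "real \<Rightarrow> real \<Rightarrow> real" where
  "e3 l z = (if l = 0 then z ^ 3 / 6
     else (cosh (freq l * z) * sin (freq l * z) - sinh (freq l * z) * cos (freq l * z)) / (4 * (freq l) ^ 3))"

lemma freq_pos: "0 < l \<Longrightarrow> 0 < freq l"
  by (simp add: freq_def)

lemma freq_power: "0 \<le> l \<Longrightarrow> 4 * (freq l) ^ 4 = l"
proof -
  assume l: "0 \<le> l"
  have "(freq l) ^ 4 = ((freq l)\<^sup>2)\<^sup>2" by (simp flip: power_mult)
  then show ?thesis using l by (simp add: freq_def)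
qed

lemma e_zero [simp]: "e0 0 z = 1" "e1 0 z = z" "e2 0 z = z\<^sup>2 / 2" "e3 0 z = z ^ 3 / 6"
  by (simp_all add: e0_def e1_def e2_def e3_def freq_def)

lemma e_at_0 [simp]: "e0 l 0 = 1" "e1 l 0 = 0" "e2 l 0 = 0" "e3 l 0 = 0"
  by (simp_all add: e0_def e1_def e2_def e3_def)

lemma e_derivs:
  assumes l: "0 \<le> l"
  shows "(e1 l has_real_derivative e0 l z) (at z)" "(e2 l has_real_derivative e1 l z) (at z)"
    "(e3 l has_real_derivative e2 l z) (at z)" "(e0 l has_real_derivative - (l * e3 l z)) (at z)"
proof -
  have "(e1 l has_real_derivative e0 l z) (at z) \<and> (e2 l has_real_derivative e1 l z) (at z) \<and>
    (e3 l has_real_derivative e2 l z) (at z) \<and> (e0 l has_real_derivative - (l * e3 l z)) (at z)"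
  proof (cases "l = 0")
    case True
    have e: "e0 0 = (\<lambda>z. 1)" "e1 0 = (\<lambda>z. z)" "e2 0 = (\<lambda>z. z\<^sup>2 / 2)" "e3 0 = (\<lambda>z. z ^ 3 / 6)"
      by (simp_all add: fun_eq_iff)
    show ?thesis
      unfolding True e by (auto intro!: derivative_eq_intros)
  next
    case False
    define w where "w = freq l"
    have w: "w \<noteq> 0" "l = 4 * w ^ 4" using False l freq_pos[of l] freq_power[of l] by (auto simp: w_def)
    let ?C = "cosh (w * z)" and ?S = "sinh (w * z)" and ?c = "cos (w * z)" and ?s = "sin (w * z)"
    have d: "((\<lambda>z. cosh (w * z)) has_real_derivative w * ?S) (at z)" "((\<lambda>z. sinh (w * z)) has_real_derivative w * ?C) (at z)"
       "((\<lambda>z. cos (w * z)) has_real_derivative - w * ?s) (at z)" "((\<lambda>z. sin (w * z)) has_real_derivative w * ?c) (at z)"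
      by (auto intro!: derivative_eq_intros)
    have e: "e0 l = (\<lambda>z. cosh (w * z) * cos (w * z))"
      "e1 l = (\<lambda>z. (cosh (w * z) * sin (w * z) + sinh (w * z) * cos (w * z)) / (2 * w))"
      "e2 l = (\<lambda>z. sinh (w * z) * sin (w * z) / (2 * w\<^sup>2))"
      "e3 l = (\<lambda>z. (cosh (w * z) * sin (w * z) - sinh (w * z) * cos (w * z)) / (4 * w ^ 3))"
      using False by (auto simp: fun_eq_iff e0_def e1_def e2_def e3_def w_def)
    have "((\<lambda>z. (cosh (w * z) * sin (w * z) + sinh (w * z) * cos (w * z)) / (2 * w)) has_real_derivative
        ((w * ?S * ?s + w * ?c * ?C) + (w * ?C * ?c + - w * ?s * ?S)) / (2 * w)) (at z)"
      by (intro DERIV_cdivide DERIV_add DERIV_mult d)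
    moreover have "((w * ?S * ?s + w * ?c * ?C) + (w * ?C * ?c + - w * ?s * ?S)) / (2 * w) = ?C * ?c"
      using w(1) by (simp add: field_simps)
    ultimately have d1: "(e1 l has_real_derivative e0 l z) (at z)" unfolding e by simp
    have "((\<lambda>z. sinh (w * z) * sin (w * z) / (2 * w\<^sup>2)) has_real_derivative
        (w * ?C * ?s + w * ?c * ?S) / (2 * w\<^sup>2)) (at z)"
      by (intro DERIV_cdivide DERIV_add DERIV_mult d)
    moreover have "(w * ?C * ?s + w * ?c * ?S) / (2 * w\<^sup>2) = (?C * ?s + ?S * ?c) / (2 * w)"
      using w(1) by (simp add: field_simps power2_eq_square)
    ultimately have d2: "(e2 l has_real_derivative e1 l z) (at z)" unfolding e by simp
    have "((\<lambda>z. (cosh (w * z) * sin (w * z) - sinh (w * z) * cos (w * z)) / (4 * w ^ 3)) has_real_derivative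
        ((w * ?S * ?s + w * ?c * ?C) - (w * ?C * ?c + - w * ?s * ?S)) / (4 * w ^ 3)) (at z)"
      by (intro DERIV_cdivide DERIV_diff DERIV_mult d)
    moreover have "((w * ?S * ?s + w * ?c * ?C) - (w * ?C * ?c + - w * ?s * ?S)) / (4 * w ^ 3) = ?S * ?s / (2 * w\<^sup>2)"
      using w(1) by (simp add: field_simps power2_eq_square power3_eq_cube)
    ultimately have d3: "(e3 l has_real_derivative e2 l z) (at z)" unfolding e by simp
    have "((\<lambda>z. cosh (w * z) * cos (w * z)) has_real_derivative w * ?S * ?c + - w * ?s * ?C) (at z)"
      by (intro DERIV_mult d)
    moreover have "w * ?S * ?c + - w * ?s * ?C = - (4 * w ^ 4 * ((?C * ?s - ?S * ?c) / (4 * w ^ 3)))"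
      using w(1) by (simp add: field_simps power3_eq_cube power4_eq_xxxx)
    ultimately have d0: "(e0 l has_real_derivative - (l * e3 l z)) (at z)" unfolding e unfolding w(2) by simp
    show ?thesis using d1 d2 d3 d0 by blast
  qed
  then show "(e1 l has_real_derivative e0 l z) (at z)" "(e2 l has_real_derivative e1 l z) (at z)"
    "(e3 l has_real_derivative e2 l z) (at z)" "(e0 l has_real_derivative - (l * e3 l z)) (at z)" by blast+
qed

text \<open>A first integral: the derivative cancels identically and the value at 0 is 0. It is the
  reason why the matrix formed by \<open>ll\<close>, \<open>mm\<close> and \<open>cc\<close> is
  symmetric.\<close>

lemma e_invariant: 
  assumes "0 \<le> l"
  shows "2 * e0 l z * e2 l z - (e1 l z)\<^sup>2 + l * (e3 l z)\<^sup>2 = 0"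
proof -
  note d = e_derivs[OF assms]
  have "((\<lambda>z. 2 * e0 l z * e2 l z - (e1 l z)\<^sup>2 + l * (e3 l z)\<^sup>2) has_real_derivative 0) (at x)" for x
    unfolding power2_eq_square
    by (rule DERIV_cong[OF DERIV_add[OF DERIV_diff[OF DERIV_mult[OF DERIV_cmult[OF d(4)] d(2)] DERIV_mult[OF d(1) d(1)]]
           DERIV_cmult[OF DERIV_mult[OF d(3) d(3)]]]])
       (simp add: algebra_simps)
  from DERIV_isconst_all[of "\<lambda>z. 2 * e0 l z * e2 l z - (e1 l z)\<^sup>2 + l * (e3 l z)\<^sup>2", OF allI[OF this], of z 0]
  show ?thesis by simp
qed

text \<open>Compliance of a clamped beam. On a piece of length \<open>z\<close> with u = u' = 0 at
  the far end, u'' and u''' at the near end determine the solution; \<open>dd\<close> is the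
  determinant of that system. Up to signs, \<open>ll\<close>, \<open>mm\<close> and
  \<open>cc\<close> are the coefficients that express u and u' at the near end through u'' and
  u'''.\<close>

definition dd :: "real \<Rightarrow> real \<Rightarrow> real" where "dd l z = (e0 l z)\<^sup>2 + l * e1 l z * e3 l z"
definition ll :: "real \<Rightarrow> real \<Rightarrow> real" where "ll l z = (e0 l z * e1 l z + l * e2 l z * e3 l z) / dd l z"
definition mm :: "real \<Rightarrow> real \<Rightarrow> real" where "mm l z = (e0 l z * e2 l z + l * (e3 l z)\<^sup>2) / dd l z"
definition cc :: "real \<Rightarrow> real \<Rightarrow> real" where "cc l z = (e1 l z * e2 l z - e0 l z * e3 l z) / dd l z"

text \<open>Products of hyperbolic and trigonometric functions of w z become single functions of 2 w
  z. The arguments for the two pieces then add up to 4 w, so the addition formulas for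
  \<open>k0\<close>, \<open>k1\<close>, \<open>k3\<close> can remove \<open>t\<close>.\<close>

lemma double_angle:
  assumes l: "0 < l" and w: "w = freq l"
  shows "dd l z = (1 + k0 (2 * w * z)) / 2"
    "e0 l z * e1 l z + l * e2 l z * e3 l z = k1 (2 * w * z) / (2 * w)"
    "e0 l z * e2 l z + l * (e3 l z)\<^sup>2 = k2 (2 * w * z) / (4 * w\<^sup>2)"
    "e1 l z * e2 l z - e0 l z * e3 l z = k3 (2 * w * z) / (4 * w ^ 3)"
proof -
  have w0: "w \<noteq> 0" and l4: "l = 4 * w ^ 4" and l0: "4 * w ^ 4 \<noteq> 0"
    using l freq_pos[of l] freq_power[of l] w by auto
  define C S c s where "C = cosh (w * z)" and "S = sinh (w * z)" and "c = cos (w * z)" and "s = sin (w * z)"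
  have h: "C\<^sup>2 = S\<^sup>2 + 1" "s\<^sup>2 = 1 - c\<^sup>2"
    unfolding C_def S_def c_def s_def by (rule cosh_square_eq, rule sin_squared_eq)
  have e: "e0 l z = C * c" "e1 l z = (C * s + S * c) / (2 * w)" "e2 l z = S * s / (2 * w\<^sup>2)" "e3 l z = (C * s - S * c) / (4 * w ^ 3)"
    using l by (auto simp: e0_def e1_def e2_def e3_def C_def S_def c_def s_def w)
  have 2: "2 * w * z = 2 * (w * z)" by simp
  have k: "k0 (2 * w * z) = (C\<^sup>2 + S\<^sup>2 + c\<^sup>2 - s\<^sup>2) / 2" "k1 (2 * w * z) = S * C + s * c"
    "k2 (2 * w * z) = (C\<^sup>2 + S\<^sup>2 - c\<^sup>2 + s\<^sup>2) / 2" "k3 (2 * w * z) = S * C - s * c"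
    unfolding k0_def k1_def k2_def k3_def 2 cosh_double sinh_double cos_double sin_double C_def S_def c_def s_def
    by (simp_all add: field_simps)
  have "dd l z = C\<^sup>2 * c\<^sup>2 + (C\<^sup>2 * s\<^sup>2 - S\<^sup>2 * c\<^sup>2) / 2"
    unfolding dd_def e unfolding l4 using w0 by (simp add: field_simps power2_eq_square power3_eq_cube power4_eq_xxxx)
  also have "\<dots> = (1 + k0 (2 * w * z)) / 2"
    unfolding k h by (simp add: field_simps)
  finally show "dd l z = (1 + k0 (2 * w * z)) / 2" .
  have "e0 l z * e1 l z + l * e2 l z * e3 l z = (C\<^sup>2 * (c * s) + C * S * c\<^sup>2 + S * C * s\<^sup>2 - S\<^sup>2 * (s * c)) / (2 * w)"
    unfolding e unfolding l4 using w0 by (simp add: field_simps power2_eq_square power3_eq_cube power4_eq_xxxx)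
  also have "\<dots> = k1 (2 * w * z) / (2 * w)"
    unfolding k h by (simp add: algebra_simps)
  finally show "e0 l z * e1 l z + l * e2 l z * e3 l z = k1 (2 * w * z) / (2 * w)" .
  have "e0 l z * e2 l z + l * (e3 l z)\<^sup>2 = (C\<^sup>2 * s\<^sup>2 + S\<^sup>2 * c\<^sup>2) / (4 * w\<^sup>2)"
    unfolding e unfolding l4 using w0 by (simp add: field_simps power2_eq_square power3_eq_cube power4_eq_xxxx)
  also have "\<dots> = k2 (2 * w * z) / (4 * w\<^sup>2)"
    unfolding k h using w0 by (simp add: field_simps)
  finally show "e0 l z * e2 l z + l * (e3 l z)\<^sup>2 = k2 (2 * w * z) / (4 * w\<^sup>2)" .
  have "e1 l z * e2 l z - e0 l z * e3 l z = (C * S * s\<^sup>2 + S\<^sup>2 * (s * c) - C\<^sup>2 * (c * s) + C * S * c\<^sup>2) / (4 * w ^ 3)"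
    unfolding e using w0 by (simp add: field_simps power2_eq_square power3_eq_cube)
  also have "\<dots> = k3 (2 * w * z) / (4 * w ^ 3)"
    unfolding k h by (simp add: algebra_simps)
  finally show "e1 l z * e2 l z - e0 l z * e3 l z = k3 (2 * w * z) / (4 * w ^ 3)" .
qed

lemma dd_pos:
  assumes "0 \<le> l" "0 \<le> z"
  shows "0 < dd l z"
proof (cases "l = 0")
  case False
  then have l: "0 < l" using assms by simp
  have "1 \<le> k0 (2 * freq l * z)" using freq_pos[OF l] assms by (intro k_nonneg) simp
  then show ?thesis by (simp add: double_angle(1)[OF l refl])
qed (simp add: dd_def)

lemma coefficients:
  assumes l: "0 < l" and z: "0 \<le> z" and w: "w = freq l"
  shows "ll l z = k1 (2 * w * z) / (w * (1 + k0 (2 * w * z)))"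
    "mm l z = k2 (2 * w * z) / (2 * w\<^sup>2 * (1 + k0 (2 * w * z)))"
    "cc l z = k3 (2 * w * z) / (2 * w ^ 3 * (1 + k0 (2 * w * z)))"
proof -
  have w0: "0 < w" using freq_pos[OF l] w by simp
  have k: "1 + k0 (2 * w * z) > 0" using k_nonneg(1)[of "2 * w * z"] w0 z by simp
  show "ll l z = k1 (2 * w * z) / (w * (1 + k0 (2 * w * z)))"
    "mm l z = k2 (2 * w * z) / (2 * w\<^sup>2 * (1 + k0 (2 * w * z)))"
    "cc l z = k3 (2 * w * z) / (2 * w ^ 3 * (1 + k0 (2 * w * z)))"
    unfolding ll_def mm_def cc_def double_angle[OF l w] using w0 k by (simp_all add: divide_simps)
qed

text \<open>The jumps of u and u' at \<open>t\<close> are linear in the common values of u'' and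
  u''' there, and this is the determinant of that linear system.\<close>

definition det2 :: "real \<Rightarrow> real \<Rightarrow> real" where
  "det2 l t = (ll l (1 + t) + ll l (1 - t)) * (cc l (1 + t) + cc l (1 - t)) - (mm l (1 + t) - mm l (1 - t))\<^sup>2"

text \<open>After clearing denominators the unmixed terms collapse by \<open>k_square\<close>, and
  the mixed ones are those of the addition formula for \<open>k0\<close>. The numerator is therefore
  independent of \<open>t\<close>.\<close>

lemma det2_eq:
  assumes l: "0 < l" and t: "-1 \<le> t" "t \<le> 1" and w: "w = freq l"
  defines "x \<equiv> 2 * w * (1 + t)" and "y \<equiv> 2 * w * (1 - t)"
  shows "det2 l t = (k0 (4 * w) - 1) / (2 * w ^ 4 * (1 + k0 x) * (1 + k0 y))"
proof -
  have w0: "0 < w" using freq_pos[OF l] w by simp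
  have xy: "0 \<le> x" "0 \<le> y" "x + y = 4 * w"
    using w0 t by (simp_all add: x_def y_def) (simp add: algebra_simps)
  define X Y where "X = 1 + k0 x" and "Y = 1 + k0 y"
  have XY: "0 < X" "0 < Y" using k_nonneg(1)[OF xy(1)] k_nonneg(1)[OF xy(2)] by (auto simp: X_def Y_def)
  have poly: "2 * (k1 x * Y + k1 y * X) * (k3 x * Y + k3 y * X) - (k2 x * Y - k2 y * X)\<^sup>2 = 2 * X * Y * (k0 (4 * w) - 1)"
  proof -
    have "2 * (k1 x * Y + k1 y * X) * (k3 x * Y + k3 y * X) - (k2 x * Y - k2 y * X)\<^sup>2 =
      (2 * k1 x * k3 x - (k2 x)\<^sup>2) * Y\<^sup>2 + (2 * k1 y * k3 y - (k2 y)\<^sup>2) * X\<^sup>2 +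
      2 * X * Y * (k1 x * k3 y + k3 x * k1 y + k2 x * k2 y)"
      by (simp add: power2_eq_square algebra_simps)
    also have "\<dots> = 2 * X * Y * (k0 (x + y) - 1)"
      unfolding k_square k_add by (simp add: X_def Y_def power2_eq_square algebra_simps)
    finally show ?thesis by (simp add: xy(3))
  qed
  have "det2 l t = (k1 x / (w * X) + k1 y / (w * Y)) * (k3 x / (2 * w ^ 3 * X) + k3 y / (2 * w ^ 3 * Y)) -
      (k2 x / (2 * w\<^sup>2 * X) - k2 y / (2 * w\<^sup>2 * Y))\<^sup>2"
    using t unfolding det2_def x_def y_def X_def Y_def
    by (simp add: coefficients[OF l _ w])
  also have "\<dots> = (2 * (k1 x * Y + k1 y * X) * (k3 x * Y + k3 y * X) - (k2 x * Y - k2 y * X)\<^sup>2) / (4 * w ^ 4 * (X * Y)\<^sup>2)"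
    using w0 XY by (simp add: divide_simps) (simp add: power2_eq_square power3_eq_cube power4_eq_xxxx algebra_simps)
  also have "\<dots> = (k0 (4 * w) - 1) / (2 * w ^ 4 * X * Y)"
    unfolding poly using w0 XY by (simp add: divide_simps power2_eq_square)
  finally show ?thesis by (simp add: X_def Y_def)
qed

lemma det2_pos:
  assumes "0 \<le> l" "-1 \<le> t" "t \<le> 1"
  shows "0 < det2 l t"
proof (cases "l = 0")
  case True
  \<comment> \<open>For \<open>l = 0\<close> the coefficients of a piece of length z are z, z^2 / 2
    and z^3 / 3.\<close>
  have "det2 0 t = 4 / 3"
    by (simp add: det2_def ll_def mm_def cc_def dd_def) (simp add: power2_eq_square power3_eq_cube field_simps)
  then show ?thesis using True by simp
next
  case False
  then have l: "0 < l" using assms by simp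
  have w: "0 < freq l" by (rule freq_pos[OF l])
  have "1 \<le> k0 (2 * freq l * (1 + t))" "1 \<le> k0 (2 * freq l * (1 - t))" using w assms by (auto intro!: k_nonneg)
  moreover have "1 < k0 (4 * freq l)" using w by (intro k0_gt_1) simp
  ultimately show ?thesis unfolding det2_eq[OF l assms(2,3) refl] using w by simp
qed


text \<open>The value and the derivative at \<open>t\<close> of $u_{\lambda,t}''$, by Cramer's rule from the jump conditions.\<close>
definition val :: "nat \<Rightarrow> real \<Rightarrow> real \<Rightarrow> real" where
  "val k l t = (if k = 0 then cc l (1 + t) + cc l (1 - t) else mm l (1 + t) - mm l (1 - t)) / det2 l t"
definition slope :: "nat \<Rightarrow> real \<Rightarrow> real \<Rightarrow> real" where
  "slope k l t = (if k = 0 then mm l (1 + t) - mm l (1 - t) else ll l (1 + t) + ll l (1 - t)) / det2 l t"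

text \<open>Clamping at -1 leaves only \<open>e2\<close> and \<open>e3\<close>. The coefficients
  \<alpha> and \<beta> are Cramer's solution, with determinant \<open>dd\<close>, for given u'' and
  u''' at \<open>t\<close>. The right branch is the same with \<open>1 - x\<close>, up to the signs
  of the odd derivatives.\<close>

definition left2 :: "nat \<Rightarrow> real \<Rightarrow> real \<Rightarrow> nat \<Rightarrow> real \<Rightarrow> real" where
  "left2 k l t j x = (let p = 1 + t; z = 1 + x;
     \<alpha> = (e0 l p * val k l t - e1 l p * slope k l t) / dd l p;
     \<beta> = (l * e3 l p * val k l t + e0 l p * slope k l t) / dd l p in
     if j = 0 then \<alpha> * e2 l z + \<beta> * e3 l z
     else if j = 1 then \<alpha> * e1 l z + \<beta> * e2 l z
     else if j = 2 then \<alpha> * e0 l z + \<beta> * e1 l z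
     else if j = 3 then \<alpha> * - (l * e3 l z) + \<beta> * e0 l z
     else - l * (\<alpha> * e2 l z + \<beta> * e3 l z))"

definition right2 :: "nat \<Rightarrow> real \<Rightarrow> real \<Rightarrow> nat \<Rightarrow> real \<Rightarrow> real" where
  "right2 k l t j x = (let q = 1 - t; z = 1 - x;
     \<gamma> = (e0 l q * val k l t + e1 l q * slope k l t) / dd l q;
     \<delta> = (l * e3 l q * val k l t - e0 l q * slope k l t) / dd l q in
     if j = 0 then \<gamma> * e2 l z + \<delta> * e3 l z
     else if j = 1 then \<gamma> * - e1 l z + \<delta> * - e2 l z
     else if j = 2 then \<gamma> * e0 l z + \<delta> * e1 l z
     else if j = 3 then \<gamma> * (l * e3 l z) + \<delta> * - e0 l z
     else - l * (\<gamma> * e2 l z + \<delta> * e3 l z))"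

lemma branch_values:
  assumes l: "0 \<le> l" and t: "-1 \<le> t" "t \<le> 1"
  shows "left2 k l t 0 t = val k l t * mm l (1 + t) - slope k l t * cc l (1 + t)"
    "left2 k l t 1 t = val k l t * ll l (1 + t) - slope k l t * mm l (1 + t)"
    "left2 k l t 2 t = val k l t" "left2 k l t 3 t = slope k l t"
    "right2 k l t 0 t = val k l t * mm l (1 - t) + slope k l t * cc l (1 - t)"
    "right2 k l t 1 t = - val k l t * ll l (1 - t) - slope k l t * mm l (1 - t)"
    "right2 k l t 2 t = val k l t" "right2 k l t 3 t = slope k l t"
proof -
  have alg: "(p0 * A - p1 * D) / d * p2 + (l * p3 * A + p0 * D) / d * p3 = A * ((p0 * p2 + l * p3\<^sup>2) / d) - D * ((p1 * p2 - p0 * p3) / d)"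
    "(p0 * A - p1 * D) / d * p1 + (l * p3 * A + p0 * D) / d * p2 = A * ((p0 * p1 + l * p2 * p3) / d) - D * ((p0 * p2 + l * p3\<^sup>2) / d)"
    "(p0 * A - p1 * D) / d * p0 + (l * p3 * A + p0 * D) / d * p1 = A"
    "(p0 * A - p1 * D) / d * - (l * p3) + (l * p3 * A + p0 * D) / d * p0 = D"
    "(p0 * A + p1 * D) / d * p2 + (l * p3 * A - p0 * D) / d * p3 = A * ((p0 * p2 + l * p3\<^sup>2) / d) + D * ((p1 * p2 - p0 * p3) / d)"
    "(p0 * A + p1 * D) / d * - p1 + (l * p3 * A - p0 * D) / d * - p2 = - A * ((p0 * p1 + l * p2 * p3) / d) - D * ((p0 * p2 + l * p3\<^sup>2) / d)"
    "(p0 * A + p1 * D) / d * p0 + (l * p3 * A - p0 * D) / d * p1 = A"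
    "(p0 * A + p1 * D) / d * (l * p3) + (l * p3 * A - p0 * D) / d * - p0 = D"
    if "d = p0\<^sup>2 + l * p1 * p3" "d \<noteq> 0" "2 * p0 * p2 - p1\<^sup>2 + l * p3\<^sup>2 = 0" for A D d p0 p1 p2 p3
  proof -
    \<comment> \<open>The invariant turns p1^2 - p0 * p2 into the numerator of \<open>mm\<close>, so
      u and u' at \<open>t\<close> share that coefficient.\<close>
    have inv: "p1\<^sup>2 = 2 * p0 * p2 + l * p3\<^sup>2" using that(3) by simp
    have dA: "(p0\<^sup>2 + l * p1 * p3) * A / d = A" "(p0\<^sup>2 + l * p1 * p3) * D / d = D" using that(1,2) by auto
    show "(p0 * A - p1 * D) / d * p2 + (l * p3 * A + p0 * D) / d * p3 = A * ((p0 * p2 + l * p3\<^sup>2) / d) - D * ((p1 * p2 - p0 * p3) / d)"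
      "(p0 * A + p1 * D) / d * p2 + (l * p3 * A - p0 * D) / d * p3 = A * ((p0 * p2 + l * p3\<^sup>2) / d) + D * ((p1 * p2 - p0 * p3) / d)"
      using that(2) by (simp_all add: field_simps power2_eq_square)
    have "(p0 * A - p1 * D) / d * p1 + (l * p3 * A + p0 * D) / d * p2 = A * ((p0 * p1 + l * p2 * p3) / d) - D * ((p1\<^sup>2 - p0 * p2) / d)"
      "(p0 * A + p1 * D) / d * - p1 + (l * p3 * A - p0 * D) / d * - p2 = - A * ((p0 * p1 + l * p2 * p3) / d) - D * ((p1\<^sup>2 - p0 * p2) / d)"
      using that(2) by (simp_all add: field_simps power2_eq_square)
    then show "(p0 * A - p1 * D) / d * p1 + (l * p3 * A + p0 * D) / d * p2 = A * ((p0 * p1 + l * p2 * p3) / d) - D * ((p0 * p2 + l * p3\<^sup>2) / d)"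
      "(p0 * A + p1 * D) / d * - p1 + (l * p3 * A - p0 * D) / d * - p2 = - A * ((p0 * p1 + l * p2 * p3) / d) - D * ((p0 * p2 + l * p3\<^sup>2) / d)"
      unfolding inv by simp_all
    have "(p0 * A - p1 * D) / d * p0 + (l * p3 * A + p0 * D) / d * p1 = (p0\<^sup>2 + l * p1 * p3) * A / d"
      "(p0 * A - p1 * D) / d * - (l * p3) + (l * p3 * A + p0 * D) / d * p0 = (p0\<^sup>2 + l * p1 * p3) * D / d"
      "(p0 * A + p1 * D) / d * p0 + (l * p3 * A - p0 * D) / d * p1 = (p0\<^sup>2 + l * p1 * p3) * A / d"
      "(p0 * A + p1 * D) / d * (l * p3) + (l * p3 * A - p0 * D) / d * - p0 = (p0\<^sup>2 + l * p1 * p3) * D / d"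
      using that(2) by (simp_all add: field_simps power2_eq_square)
    then show "(p0 * A - p1 * D) / d * p0 + (l * p3 * A + p0 * D) / d * p1 = A"
      "(p0 * A - p1 * D) / d * - (l * p3) + (l * p3 * A + p0 * D) / d * p0 = D"
      "(p0 * A + p1 * D) / d * p0 + (l * p3 * A - p0 * D) / d * p1 = A"
      "(p0 * A + p1 * D) / d * (l * p3) + (l * p3 * A - p0 * D) / d * - p0 = D"
      unfolding dA by simp_all
  qed
  have p: "dd l (1 + t) \<noteq> 0" "dd l (1 - t) \<noteq> 0" using dd_pos[of l "1 + t"] dd_pos[of l "1 - t"] l t by auto
  note L = alg(1-4)[OF dd_def p(1) e_invariant[OF l]] and R = alg(5-8)[OF dd_def p(2) e_invariant[OF l]]
  show "left2 k l t 0 t = val k l t * mm l (1 + t) - slope k l t * cc l (1 + t)"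
    "left2 k l t 1 t = val k l t * ll l (1 + t) - slope k l t * mm l (1 + t)"
    "left2 k l t 2 t = val k l t" "left2 k l t 3 t = slope k l t"
    unfolding left2_def Let_def mm_def cc_def ll_def using L[of "val k l t" "slope k l t"] by simp_all
  show "right2 k l t 0 t = val k l t * mm l (1 - t) + slope k l t * cc l (1 - t)"
    "right2 k l t 1 t = - val k l t * ll l (1 - t) - slope k l t * mm l (1 - t)"
    "right2 k l t 2 t = val k l t" "right2 k l t 3 t = slope k l t"
    unfolding right2_def Let_def mm_def cc_def ll_def using R[of "val k l t" "slope k l t"] by simp_all
qed

lemma less_4_cases: "(j::nat) < 4 \<Longrightarrow> j = 0 \<or> j = 1 \<or> j = 2 \<or> j = 3"
  by auto

lemma solution_chain_2:
  assumes l: "0 \<le> l" and t: "t \<in> {-1..<1}" and k: "k \<in> {0, 1}"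
  shows "solution_chain 2 k l t (left2 k l t) (right2 k l t)"
proof -
  have t': "-1 \<le> t" "t \<le> 1" using t by auto
  note d = e_derivs[OF l]
  note s1 = shifted_derivs[of "e1 l" "e0 l", OF d(1)] and s2 = shifted_derivs[of "e2 l" "e1 l", OF d(2)]
    and s3 = shifted_derivs[of "e3 l" "e2 l", OF d(3)] and s0 = shifted_derivs[of "e0 l" "\<lambda>z. - (l * e3 l z)", OF d(4)]
  have D: "((\<lambda>x. \<alpha> * f x + \<beta> * g x) has_real_derivative \<alpha> * f' + \<beta> * g') (at x)"
    if "(f has_real_derivative f') (at x)" "(g has_real_derivative g') (at x)" for \<alpha> \<beta> f f' g g' and x :: real
    using that by (intro DERIV_add DERIV_cmult)
  obtain \<alpha> \<beta> where La: "\<And>j. left2 k l t j = (\<lambda>x. if j = 0 then \<alpha> * e2 l (1 + x) + \<beta> * e3 l (1 + x)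
     else if j = 1 then \<alpha> * e1 l (1 + x) + \<beta> * e2 l (1 + x)
     else if j = 2 then \<alpha> * e0 l (1 + x) + \<beta> * e1 l (1 + x)
     else if j = 3 then \<alpha> * - (l * e3 l (1 + x)) + \<beta> * e0 l (1 + x)
     else - l * (\<alpha> * e2 l (1 + x) + \<beta> * e3 l (1 + x)))"
    unfolding left2_def[abs_def] Let_def by blast
  obtain \<gamma> \<delta> where Ra: "\<And>j. right2 k l t j = (\<lambda>x. if j = 0 then \<gamma> * e2 l (1 - x) + \<delta> * e3 l (1 - x)
     else if j = 1 then \<gamma> * - e1 l (1 - x) + \<delta> * - e2 l (1 - x)
     else if j = 2 then \<gamma> * e0 l (1 - x) + \<delta> * e1 l (1 - x)
     else if j = 3 then \<gamma> * (l * e3 l (1 - x)) + \<delta> * - e0 l (1 - x)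
     else - l * (\<gamma> * e2 l (1 - x) + \<delta> * e3 l (1 - x)))"
    unfolding right2_def[abs_def] Let_def by blast
  have "(left2 k l t j has_real_derivative left2 k l t (Suc j) x) (at x)" if "j < 4" for j x
    using less_4_cases[OF that]
  proof (elim disjE)
    assume j: "j = 0"
    show ?thesis unfolding La j using D[OF s2(1) s3(1), of \<alpha> \<beta>] by simp
  next
    assume j: "j = 1"
    show ?thesis unfolding La j using D[OF s1(1) s2(1), of \<alpha> \<beta>] by simp
  next
    assume j: "j = 2"
    show ?thesis unfolding La j using D[OF s0(1) s1(1), of \<alpha> \<beta>] by simp
  next
    assume j: "j = 3"
    have "((\<lambda>x. - (l * e3 l (1 + x))) has_real_derivative - (l * e2 l (1 + x))) (at x)"
      by (intro DERIV_minus DERIV_cmult s3)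
    from D[OF this s0(1), of \<alpha> \<beta>] show ?thesis unfolding La j by (simp add: algebra_simps)
  qed
  moreover have "(right2 k l t j has_real_derivative right2 k l t (Suc j) x) (at x)" if "j < 4" for j x
    using less_4_cases[OF that]
  proof (elim disjE)
    assume j: "j = 0"
    show ?thesis unfolding Ra j using D[OF s2(2) s3(2), of \<gamma> \<delta>] by simp
  next
    assume j: "j = 1"
    show ?thesis unfolding Ra j using D[OF DERIV_minus[OF s1(2)] DERIV_minus[OF s2(2)], of \<gamma> \<delta>] by simp
  next
    assume j: "j = 2"
    show ?thesis unfolding Ra j using D[OF s0(2) s1(2), of \<gamma> \<delta>] by simp
  next
    assume j: "j = 3"
    have "((\<lambda>x. l * e3 l (1 - x)) has_real_derivative l * - e2 l (1 - x)) (at x)"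
      by (intro DERIV_cmult s3)
    from D[OF this DERIV_minus[OF s0(2)], of \<gamma> \<delta>] show ?thesis unfolding Ra j by (simp add: algebra_simps)
  qed
  moreover have "right2 k l t s t - left2 k l t s t = (-1) powi (int k - 1) * of_bool (2 - k - 1 = s)" if "s < 4" for s
  proof -
    let ?A = "val k l t" and ?D = "slope k l t" and ?L = "ll l (1 + t) + ll l (1 - t)"
      and ?M = "mm l (1 + t) - mm l (1 - t)" and ?C = "cc l (1 + t) + cc l (1 - t)"
    note bv = branch_values[OF l t', of k]
    have det: "det2 l t \<noteq> 0" "det2 l t = ?L * ?C - ?M\<^sup>2" using det2_pos[OF l t'] by (auto simp: det2_def)
    \<comment> \<open>The jumps of (u, u') have to be (0, -1) for \<open>k = 0\<close> and (1, 0)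
      for \<open>k = 1\<close>; \<open>val\<close> and \<open>slope\<close> solve the system for
      these right sides.\<close>
    have cramer: "(c / d) * - m + (m / d) * c = 0" "- (c / d) * L + (m / d) * m = -1"
      "(m / d) * - m + (L / d) * c = 1" "- (m / d) * L + (L / d) * m = 0"
      if "d = L * c - m\<^sup>2" "d \<noteq> 0" for c d L m :: real
      using that by (simp_all add: field_simps power2_eq_square)
    note cr = cramer[OF det(2,1)]
    have r0: "right2 k l t 0 t - left2 k l t 0 t = ?A * - ?M + ?D * ?C"
      unfolding bv by (simp add: algebra_simps)
    have r1: "right2 k l t 1 t - left2 k l t 1 t = - ?A * ?L + ?D * ?M"
      unfolding bv by (simp add: algebra_simps)
    have "right2 k l t 0 t - left2 k l t 0 t = of_bool (k = 1)"
      unfolding r0 val_def slope_def using k cr(1,3) by auto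
    moreover have "right2 k l t 1 t - left2 k l t 1 t = - of_bool (k = 0)"
      unfolding r1 val_def slope_def using k cr(2,4) by auto
    moreover have "right2 k l t 2 t - left2 k l t 2 t = 0" "right2 k l t 3 t - left2 k l t 3 t = 0"
      unfolding bv by simp_all
    ultimately show ?thesis using less_4_cases[OF that] k by (elim disjE) auto
  qed
  moreover have "left2 k l t 4 x = - l * left2 k l t 0 x" "right2 k l t 4 x = - l * right2 k l t 0 x" for x
    by (simp_all add: left2_def right2_def Let_def)
  moreover have "left2 k l t s (-1) = 0" "right2 k l t s 1 = 0" if "s < 2" for s
    using that by (auto simp: left2_def right2_def Let_def less_2_cases_iff)
  ultimately show ?thesis
    unfolding solution_chain_def by simp
qed

text \<open>Dividing by \<open>det2\<close> cancels the factors 1 + \<open>k0\<close> of the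
  denominators. What remains is a numerator close to an addition formula, over a denominator free of
  \<open>t\<close>.\<close>

lemma G2_eq:
  assumes l: "0 < l" and t: "-1 \<le> t" "t \<le> 1" and w: "w = freq l"
  defines "x \<equiv> 2 * w * (1 + t)" and "y \<equiv> 2 * w * (1 - t)"
  shows "left2 0 l t 2 t = w * ((k3 x * (1 + k0 y) + k3 y * (1 + k0 x)) / (k0 (4 * w) - 1))"
    "left2 1 l t 3 t = 2 * w ^ 3 * ((k1 x * (1 + k0 y) + k1 y * (1 + k0 x)) / (k0 (4 * w) - 1))"
proof -
  have w0: "0 < w" using freq_pos[OF l] w by simp
  have xy: "0 \<le> x" "0 \<le> y" using w0 t by (simp_all add: x_def y_def)
  define X Y K where "X = 1 + k0 x" and "Y = 1 + k0 y" and "K = k0 (4 * w) - 1"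
  have XY: "0 < X" "0 < Y" using k_nonneg(1)[OF xy(1)] k_nonneg(1)[OF xy(2)] by (auto simp: X_def Y_def)
  have K: "0 < K" using k0_gt_1[of "4 * w"] w0 by (simp add: K_def)
  have det: "det2 l t = K / (2 * w ^ 4 * X * Y)"
    unfolding det2_eq[OF l t w] by (simp add: K_def X_def Y_def x_def y_def)
  have co: "cc l (1 + t) = k3 x / (2 * w ^ 3 * X)" "cc l (1 - t) = k3 y / (2 * w ^ 3 * Y)"
    "ll l (1 + t) = k1 x / (w * X)" "ll l (1 - t) = k1 y / (w * Y)"
    using coefficients[OF l _ w, of "1 + t"] coefficients[OF l _ w, of "1 - t"] t
    by (auto simp: X_def Y_def x_def y_def)
  note bv = branch_values[OF less_imp_le[OF l] t]
  have "left2 0 l t 2 t = (k3 x / (2 * w ^ 3 * X) + k3 y / (2 * w ^ 3 * Y)) / (K / (2 * w ^ 4 * X * Y))"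
    unfolding bv val_def det co by simp
  also have "\<dots> = w * ((k3 x * Y + k3 y * X) / K)"
    using w0 XY K by (simp add: divide_simps) (simp add: power3_eq_cube power4_eq_xxxx algebra_simps)
  finally show "left2 0 l t 2 t = w * ((k3 x * (1 + k0 y) + k3 y * (1 + k0 x)) / (k0 (4 * w) - 1))"
    by (simp add: X_def Y_def K_def)
  have "left2 1 l t 3 t = (k1 x / (w * X) + k1 y / (w * Y)) / (K / (2 * w ^ 4 * X * Y))"
    unfolding bv slope_def det co by simp
  also have "\<dots> = 2 * w ^ 3 * ((k1 x * Y + k1 y * X) / K)"
    using w0 XY K by (simp add: divide_simps) (simp add: power3_eq_cube power4_eq_xxxx algebra_simps)
  finally show "left2 1 l t 3 t = 2 * w ^ 3 * ((k1 x * (1 + k0 y) + k1 y * (1 + k0 x)) / (k0 (4 * w) - 1))"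
    by (simp add: X_def Y_def K_def)
qed

lemma two_plus_cases:
  assumes "k \<in> {0, 1::nat}" "P 0 2" "P 1 3"
  shows "P k (2 + k)"
  using assms by (auto simp: numeral_2_eq_2 numeral_3_eq_3)

lemma G2_le:
  assumes l: "0 < l" and t: "t \<in> {-1..<1}" and k: "k \<in> {0, 1}"
  shows "left2 k l t (2 + k) t \<le> left2 k l (-1) (2 + k) (-1)"
proof -
  define w where "w = freq l"
  have w0: "0 < w" using freq_pos[OF l] by (simp add: w_def)
  define x y where "x = 2 * w * (1 + t)" and "y = 2 * w * (1 - t)"
  have xy: "0 \<le> x" "0 \<le> y" using w0 t by (simp_all add: x_def y_def)
  \<comment> \<open>At \<open>t = -1\<close> the arguments are 0 and 4 w, and the numerator there is
    twice \<open>k3\<close> or \<open>k1\<close> at 4 w. By this sum, \<open>k_add_le\<close> bounds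
    the numerator at \<open>t\<close> by the same number.\<close>
  have s: "x + y = 4 * w" by (simp add: x_def y_def algebra_simps)
  have K: "0 < k0 (4 * w) - 1" using k0_gt_1[of "4 * w"] w0 by simp
  have z: "k3 0 = 0" "k1 0 = 0" "k0 0 = 1" by (simp_all add: k0_def k1_def k3_def)
  have t': "-1 \<le> t" "t \<le> 1" "(-1::real) \<le> -1" "(-1::real) \<le> 1" using t by auto
  note e = G2_eq[OF l t'(1,2) w_def, folded x_def y_def] G2_eq[OF l t'(3,4) w_def]
  have "left2 0 l t 2 t \<le> left2 0 l (-1) 2 (-1)"
    unfolding e using k_add_le(1)[OF xy] w0 K
    by (intro mult_left_mono divide_right_mono) (auto simp: z s)
  moreover have "left2 1 l t 3 t \<le> left2 1 l (-1) 3 (-1)"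
    unfolding e using k_add_le(2)[OF xy] w0 K
    by (intro mult_left_mono divide_right_mono) (auto simp: z s)
  ultimately show ?thesis
    by (rule two_plus_cases[OF k, where P = "\<lambda>k j. left2 k l t j t \<le> left2 k l (-1) j (-1)"])
qed

lemma freq_at_top: "filterlim freq at_top at_top"
proof -
  have "filterlim (\<lambda>l::real. l / 4) at_top at_top"
    using filterlim_tendsto_pos_mult_at_top[OF tendsto_const[of "1 / 4"] _ filterlim_ident[of at_top]] by simp
  then show ?thesis
    unfolding freq_def[abs_def] by (intro filterlim_compose[OF sqrt_at_top])
qed

lemma G2_at_top:
  assumes t: "t \<in> {-1..<1}" and k: "k \<in> {0, 1}"
  shows "filterlim (\<lambda>l. left2 k l t (2 + k) t) at_top at_top"
proof (rule filterlim_at_top_mono)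
  have "filterlim (\<lambda>l. (1 / 16) * freq l) at_top at_top"
    by (rule filterlim_tendsto_pos_mult_at_top[OF tendsto_const _ freq_at_top]) simp
  then show "filterlim (\<lambda>l. freq l * (1 / 16)) at_top at_top" by (simp add: mult.commute)
  \<comment> \<open>This bound on the frequency makes \<open>y\<close> at least 5; here
    \<open>t < 1\<close> enters. The bound 1 makes w at most 2 w^3 for the case
    \<open>k = 1\<close>.\<close>
  have "eventually (\<lambda>l. max 1 (5 / (2 * (1 - t))) \<le> freq l) at_top"
    using freq_at_top unfolding filterlim_at_top by blast
  then show "eventually (\<lambda>l. freq l * (1 / 16) \<le> left2 k l t (2 + k) t) at_top"
    using eventually_gt_at_top[of 0]
  proof eventually_elim
    case (elim l)
    define w where "w = freq l"
    have w1: "1 \<le> w" and w5: "5 / (2 * (1 - t)) \<le> w" using elim by (auto simp: w_def)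
    define x y where "x = 2 * w * (1 + t)" and "y = 2 * w * (1 - t)"
    have x: "0 \<le> x" using w1 t by (simp add: x_def)
    have y: "5 \<le> y" using w5 t by (simp add: y_def field_simps)
    have s: "x + y = 4 * w" by (simp add: x_def y_def algebra_simps)
    have K: "0 < k0 (4 * w) - 1" using k0_gt_1[of "4 * w"] w1 by simp
    note b = k_bounds[OF x y]
    have Ku: "k0 (4 * w) - 1 \<le> exp (4 * w) / 2" using k_bounds(4)[of "4 * w" 5] w1 by simp
    have ex: "exp (4 * w) = exp x * exp y" by (simp add: exp_add[symmetric] s)
    \<comment> \<open>The numerator is at least exp y / 8 times exp x / 4 and the denominator at
      most exp (x + y) / 2, whence 1/16.\<close>
    have low: "1 / 16 \<le> (f x * (1 + k0 y) + f y * (1 + k0 x)) / (k0 (4 * w) - 1)"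
      if f: "0 \<le> f x" "exp y / 8 \<le> f y" for f :: "real \<Rightarrow> real"
    proof -
      have fy: "0 \<le> f y" by (rule order_trans[OF _ f(2)]) simp
      have "(k0 (4 * w) - 1) / 16 \<le> (exp (4 * w) / 2) / 16" using Ku by (intro divide_right_mono) auto
      also have "\<dots> = exp y / 8 * (exp x / 4)" unfolding ex by simp
      also have "exp y / 8 * (exp x / 4) \<le> f y * (1 + k0 x)"
        using f(2) b(3) fy by (intro mult_mono) auto
      also have "\<dots> \<le> f x * (1 + k0 y) + f y * (1 + k0 x)"
        using f(1) k_nonneg(1)[of y] y by simp
      finally show ?thesis using K by (simp add: field_simps)
    qed
    have t': "-1 \<le> t" "t \<le> 1" using t by auto
    note e = G2_eq[OF elim(2) t' w_def, folded x_def y_def]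
    have "w * (1 / 16) \<le> left2 0 l t 2 t"
      unfolding e using w1 low[of k3] k_nonneg(4)[OF x] b(2) by (intro mult_left_mono) auto
    moreover have "w * (1 / 16) \<le> left2 1 l t 3 t"
    proof -
      have "w * 1 \<le> w * (2 * w\<^sup>2)" using w1 one_le_power[OF w1, of 2] by (intro mult_left_mono) linarith+
      then have "w \<le> 2 * w ^ 3" by (simp add: power2_eq_square power3_eq_cube)
      then show ?thesis
        unfolding e using w1 low[of k1] k_nonneg(2)[OF x] b(1) by (intro mult_mono) auto
    qed
    ultimately show ?case
      unfolding w_def by (rule two_plus_cases[OF k, where P = "\<lambda>k j. freq l * (1 / 16) \<le> left2 k l t j t"])
  qed
qed

text \<open>The endpoint value grows at most like 128 w^3, while l = 4 w^4.\<close>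

lemma G2_sublinear:
  assumes k: "k \<in> {0, 1}"
  shows "((\<lambda>l. left2 k l (-1) (2 + k) (-1) / l) \<longlongrightarrow> 0) at_top"
proof (rule Lim_null_comparison)
  show "((\<lambda>l. 32 / freq l) \<longlongrightarrow> 0) at_top"
    by (intro tendsto_divide_0[OF tendsto_const] filterlim_at_top_imp_at_infinity freq_at_top)
  have "eventually (\<lambda>l. 2 \<le> freq l) at_top"
    using freq_at_top unfolding filterlim_at_top by blast
  then show "eventually (\<lambda>l. norm (left2 k l (-1) (2 + k) (-1) / l) \<le> 32 / freq l) at_top"
    using eventually_gt_at_top[of 0]
  proof eventually_elim
    case (elim l)
    define w where "w = freq l"
    have w2: "2 \<le> w" using elim by (simp add: w_def)
    define y where "y = 4 * w"
    have y: "5 \<le> y" "0 \<le> y" using w2 by (auto simp: y_def)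
    have l4: "l = 4 * w ^ 4" using freq_power[of l] elim by (simp add: w_def)
    have K: "0 < k0 y - 1" using k0_gt_1[of y] y by simp
    note b = k_bounds[OF y(2,1)]
    have z: "k3 0 = 0" "k1 0 = 0" "k0 0 = 1" by (simp_all add: k0_def k1_def k3_def)
    have up: "0 \<le> 2 * f / (k0 y - 1)" "2 * f / (k0 y - 1) \<le> 64" if "0 \<le> f" "f \<le> exp y / 2" for f
    proof -
      have "2 * f \<le> exp y" using that(2) by simp
      also have "\<dots> \<le> 64 * (k0 y - 1)" using b(7) by simp
      finally have "2 * f \<le> 64 * (k0 y - 1)" .
      then show "2 * f / (k0 y - 1) \<le> 64" using K by (simp add: field_simps)
      show "0 \<le> 2 * f / (k0 y - 1)" using K that by simp
    qed
    have t': "(-1::real) \<le> -1" "(-1::real) \<le> 1" by auto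
    note e = G2_eq[OF elim(2) t' w_def]
    have e': "left2 0 l (-1) 2 (-1) = w * (2 * k3 y / (k0 y - 1))" "left2 1 l (-1) 3 (-1) = 2 * w ^ 3 * (2 * k1 y / (k0 y - 1))"
      unfolding e by (simp_all add: z y_def)
    have w3: "w \<le> w ^ 3" using w2 self_le_power[of w 3] by simp
    have "0 \<le> left2 0 l (-1) 2 (-1) \<and> left2 0 l (-1) 2 (-1) \<le> 128 * w ^ 3"
    proof -
      have "left2 0 l (-1) 2 (-1) \<le> w * 64"
        unfolding e' using up[OF k_nonneg(4)[OF y(2)] b(6)] w2 by (intro mult_left_mono) auto
      also have "\<dots> \<le> 128 * w ^ 3" using w3 w2 by linarith
      finally show ?thesis unfolding e' using up[OF k_nonneg(4)[OF y(2)] b(6)] w2 by (simp del: times_divide_eq_right)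
    qed
    moreover have "0 \<le> left2 1 l (-1) 3 (-1) \<and> left2 1 l (-1) 3 (-1) \<le> 128 * w ^ 3"
    proof -
      have "2 * w ^ 3 * (2 * k1 y / (k0 y - 1)) \<le> 2 * w ^ 3 * 64"
        using up[OF k_nonneg(2)[OF y(2)] b(5)] w2 by (intro mult_left_mono) auto
      then show ?thesis unfolding e' using up[OF k_nonneg(2)[OF y(2)] b(5)] w2 by (simp del: times_divide_eq_right)
    qed
    ultimately have "0 \<le> left2 k l (-1) (2 + k) (-1) \<and> left2 k l (-1) (2 + k) (-1) \<le> 128 * w ^ 3"
      by (rule two_plus_cases[OF k, where P = "\<lambda>k j. 0 \<le> left2 k l (-1) j (-1) \<and> left2 k l (-1) j (-1) \<le> 128 * w ^ 3"])
    then have g: "0 \<le> left2 k l (-1) (2 + k) (-1)" "left2 k l (-1) (2 + k) (-1) \<le> 128 * w ^ 3" by auto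
    have "left2 k l (-1) (2 + k) (-1) / l \<le> 128 * w ^ 3 / l" using g(2) elim by (intro divide_right_mono) auto
    also have "\<dots> = 32 / w" unfolding l4 using w2 by (simp add: power3_eq_cube power4_eq_xxxx)
    finally show ?case using g(1) elim by (simp add: w_def)
  qed
qed

text \<open>The case \<open>k = 1\<close> precedes \<open>k = 0\<close>, because its kernel is used
  there to estimate a first derivative.\<close>

interpretation family21: branch_family 2 1 "left2 1" "right2 1"
proof
  show "(2::nat) = 1 \<and> (1::nat) = 0 \<or> (2::nat) = 2 \<and> (1::nat) \<in> {0, 1}" by simp
  show "solution_chain 2 1 l t (left2 1 l t) (right2 1 l t)" if "0 \<le> l" "t \<in> {-1..<1}" for l t
    using that by (rule solution_chain_2) simp
qed

interpretation family20: branch_family 2 0 "left2 0" "right2 0"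
proof
  show "(2::nat) = 1 \<and> (0::nat) = 0 \<or> (2::nat) = 2 \<and> (0::nat) \<in> {0, 1}" by simp
  show "solution_chain 2 0 l t (left2 0 l t) (right2 0 l t)" if "0 \<le> l" "t \<in> {-1..<1}" for l t
    using that by (rule solution_chain_2) simp
qed

text \<open>At parameter 0 the functions \<open>e0\<close> and \<open>e1\<close> are 1 and the
  identity, so the second derivative of the right branch is affine; for \<open>t = -1\<close> that
  branch fills the interval.\<close>

lemma V2_poly:
  assumes k: "k \<in> {0, 1}"
  shows "\<exists>Q. degree Q \<le> 2 - 1 \<and> (\<forall>x\<in>II. poly Q x = pw (-1) (left2 k 0 (-1) 2) (right2 k 0 (-1) 2) x)"
proof -
  have m: "left2 k 0 (-1) 2 (-1) = right2 k 0 (-1) 2 (-1)"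
    using branch_values(3,7)[of 0 "-1" k] by simp
  define c where "c = (e0 0 2 * val k 0 (-1) + e1 0 2 * slope k 0 (-1)) / dd 0 2"
  define d where "d = (0 * e3 0 2 * val k 0 (-1) - e0 0 2 * slope k 0 (-1)) / dd 0 2"
  have r: "right2 k 0 (-1) 2 x = c * e0 0 (1 - x) + d * e1 0 (1 - x)" for x
    by (simp add: right2_def Let_def c_def d_def)
  show ?thesis
  proof (intro exI[of _ "[:c + d, - d:]"] conjI ballI)
    fix x :: real assume "x \<in> II"
    then have "pw (-1) (left2 k 0 (-1) 2) (right2 k 0 (-1) 2) x = right2 k 0 (-1) 2 x"
      using m by (auto simp: pw_def)
    then show "poly [:c + d, - d:] x = pw (-1) (left2 k 0 (-1) 2) (right2 k 0 (-1) 2) x"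
      by (simp add: r algebra_simps)
  qed simp
qed

lemma kernel_family_21: "kernel_family 2 1 family21.\<sigma> family21.U family21.V"
proof (rule family21.kernel_familyI)
  show "\<exists>Q. degree Q \<le> 2 - 1 \<and> (\<forall>x\<in>II. poly Q x = family21.V 0 (-1) x)"
    unfolding family21.V_def by (rule V2_poly) simp
  show "left2 1 l t (2 + 1) t \<le> left2 1 l (-1) (2 + 1) (-1)" if "0 < l" "t \<in> {-1..<1}" for l t
    using that by (rule G2_le) simp
  show "filterlim (\<lambda>l. left2 1 l t (2 + 1) t) at_top at_top" if "t \<in> {-1..<1}" for t
    using that by (rule G2_at_top) simp
  show "((\<lambda>l. left2 1 l (-1) (2 + 1) (-1) / l) \<longlongrightarrow> 0) at_top"
    by (rule G2_sublinear) simp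
qed simp

text \<open>The representation of \<open>f'\<close> from the case \<open>k = 1\<close> with \<open>\<lambda> = 0\<close> bounds \<open>f'\<close> by \<open>f\<close> and \<open>f''\<close>.\<close>
lemma V20_next:
  assumes l: "0 \<le> l"
  shows "\<exists>C. \<forall>s\<in>{-1<..<1}. \<forall>t\<in>{-1<..<1}.
      (norm2 (\<lambda>x. nderiv II (Suc 0) (family20.V l t) x - nderiv II (Suc 0) (family20.V l s) x))\<^sup>2 \<le>
      C * ((norm2 (\<lambda>x. family20.V l t x - family20.V l s x))\<^sup>2 + l * (norm2 (\<lambda>x. family20.U l t x - family20.U l s x))\<^sup>2)"
proof -
  interpret K: kernel_family 2 1 family21.\<sigma> family21.U family21.V by (rule kernel_family_21)
  let ?V = family20.V and ?U = family20.U
  obtain B where B: "\<And>x. x \<in> {-1..<1} \<Longrightarrow> norm2 (family21.U 0 x) \<le> B" using K.nU_0_bounded by blast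
  \<comment> \<open>\<open>b\<close> bounds both parts of the representer of f' at every point of
    [-1, 1): \<open>K.M0\<close> bounds the norms of \<open>family21.V 0 x\<close>, and
    \<open>B\<close> those of \<open>family21.U 0 x\<close>.\<close>
  define b where "b = \<bar>B\<bar> + \<bar>K.M0\<bar>"
  show ?thesis
  proof (intro exI[of _ "4 * b\<^sup>2 * (1 + l)"] ballI)
    fix s t :: real assume "s \<in> {-1<..<1}" "t \<in> {-1<..<1}"
    then have st: "s \<in> {-1..<1}" "t \<in> {-1..<1}" by auto
    have Vm: "?V l s \<in> L2m 2 II" "?V l t \<in> L2m 2 II"
      using family20.scaled_V(1)[OF l st(1), of 1] family20.scaled_V(1)[OF l st(2), of 1] by auto
    have VL: "?V l s \<in> L2 II" "?V l t \<in> L2 II" "?U l s \<in> L2 II" "?U l t \<in> L2 II"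
      using family20.V_L2[OF l] family20.U_L2[OF l] st by auto
    have top: "ip g (nderiv II 2 (?V l u)) = family20.\<sigma> * l * ip g (?U l u)" if "g \<in> L2 II" "u \<in> {-1..<1}" "?V l u \<in> L2m 2 II" for g u
    proof -
      have "ip g (nderiv II 2 (?V l u)) = ip g (\<lambda>x. family20.\<sigma> * l * ?U l u x)"
        using family20.scaled_V(2)[OF l that(2), of 1] that(1) L2m_2D(2)[OF that(3)] family20.U_L2[OF l that(2)]
        by (intro ip_cong_AE L2_cmult) auto
      then show ?thesis by (simp add: ip_cmult_right)
    qed
    define p q where "p = norm2 (\<lambda>x. ?V l t x - ?V l s x)" and "q = norm2 (\<lambda>x. ?U l t x - ?U l s x)"
    have pq: "0 \<le> p" "0 \<le> q" by (auto simp: p_def q_def norm2_nonneg)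
    let ?f = "\<lambda>x. nderiv II 1 (?V l t) x - nderiv II 1 (?V l s) x"
    have fc: "continuous_on II ?f"
      using L2m_2D(5)[OF Vm(1)] L2m_2D(5)[OF Vm(2)] by (intro continuous_on_diff)
    have bound: "\<bar>?f x\<bar> \<le> b * (p + l * q)" if x: "x \<in> II - {1}" for x
    proof -
      have x': "x \<in> {-1..<1}" using x by auto
      have L: "family21.V 0 x \<in> L2 II" "family21.U 0 x \<in> L2 II"
        using family21.V_L2[OF _ x'] family21.U_L2[OF _ x'] by auto
      have sg: "\<bar>family21.\<sigma>\<bar> = 1" "\<bar>family20.\<sigma>\<bar> = 1"
        unfolding family21.\<sigma>_def family20.\<sigma>_def by simp_all
      have "?f x = ip (family21.V 0 x) (\<lambda>x. ?V l t x - ?V l s x) +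
          family21.\<sigma> * (family20.\<sigma> * l * ip (family21.U 0 x) (\<lambda>x. ?U l t x - ?U l s x))"
        using family21.representation[OF order_refl x' Vm(1)] family21.representation[OF order_refl x' Vm(2)]
        by (simp add: top[OF L(2) st(1) Vm(1)] top[OF L(2) st(2) Vm(2)] ip_diff_right L VL right_diff_distrib
            del: One_nat_def)
      then have "\<bar>?f x\<bar> \<le> \<bar>ip (family21.V 0 x) (\<lambda>x. ?V l t x - ?V l s x)\<bar> +
          \<bar>family21.\<sigma> * (family20.\<sigma> * l * ip (family21.U 0 x) (\<lambda>x. ?U l t x - ?U l s x))\<bar>"
        by linarith
      also have "\<dots> = \<bar>ip (family21.V 0 x) (\<lambda>x. ?V l t x - ?V l s x)\<bar> + l * \<bar>ip (family21.U 0 x) (\<lambda>x. ?U l t x - ?U l s x)\<bar>"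
        using sg l by (simp add: abs_mult)
      also have "\<dots> \<le> norm2 (family21.V 0 x) * p + l * (norm2 (family21.U 0 x) * q)"
        unfolding p_def q_def using l by (intro add_mono mult_left_mono ip_Cauchy_Schwarz L L2_diff VL)
      also have "\<dots> \<le> b * p + l * (b * q)"
        using K.nV_0_le[OF x'] B[OF x'] pq l unfolding b_def by (intro add_mono mult_left_mono mult_right_mono) auto
      finally show ?thesis by (simp add: algebra_simps)
    qed
    have "\<bar>?f x\<bar> \<le> b * (p + l * q)" if "x \<in> II" for x
      by (rule AE_bound_continuous[OF fc AE_II_except_finite[of "{1}"] that]) (use bound in auto)
    then have "norm2 ?f \<le> sqrt 2 * (b * (p + l * q))"
      by (intro norm2_bounded L2_continuous_on fc)
    then have "(norm2 ?f)\<^sup>2 \<le> (sqrt 2 * (b * (p + l * q)))\<^sup>2"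
      using norm2_nonneg by (rule power_mono)
    also have "\<dots> = 2 * b\<^sup>2 * (p + l * q)\<^sup>2" by (simp add: power_mult_distrib)
    also have "\<dots> \<le> 2 * b\<^sup>2 * (2 * (p\<^sup>2 + (l * q)\<^sup>2))"
    proof (intro mult_left_mono)
      have "0 \<le> (p - l * q)\<^sup>2" by simp
      then show "(p + l * q)\<^sup>2 \<le> 2 * (p\<^sup>2 + (l * q)\<^sup>2)" by (simp add: power2_sum power2_diff)
    qed simp
    also have "\<dots> = 4 * b\<^sup>2 * (p\<^sup>2 + l * (l * q\<^sup>2))" by (simp add: power_mult_distrib power2_eq_square[of l])
    also have "\<dots> \<le> 4 * b\<^sup>2 * ((1 + l) * (p\<^sup>2 + l * q\<^sup>2))"
      using l by (intro mult_left_mono) (auto simp: algebra_simps)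
    finally show "(norm2 (\<lambda>x. nderiv II (Suc 0) (?V l t) x - nderiv II (Suc 0) (?V l s) x))\<^sup>2 \<le>
      4 * b\<^sup>2 * (1 + l) * ((norm2 (\<lambda>x. ?V l t x - ?V l s x))\<^sup>2 + l * (norm2 (\<lambda>x. ?U l t x - ?U l s x))\<^sup>2)"
      by (simp add: p_def q_def mult.assoc)
  qed
qed

lemma kernel_family_20: "kernel_family 2 0 family20.\<sigma> family20.U family20.V"
proof (rule family20.kernel_familyI)
  show "\<exists>Q. degree Q \<le> 2 - 1 \<and> (\<forall>x\<in>II. poly Q x = family20.V 0 (-1) x)"
    unfolding family20.V_def by (rule V2_poly) simp
  show "left2 0 l t (2 + 0) t \<le> left2 0 l (-1) (2 + 0) (-1)" if "0 < l" "t \<in> {-1..<1}" for l t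
    using that by (rule G2_le) simp
  show "filterlim (\<lambda>l. left2 0 l t (2 + 0) t) at_top at_top" if "t \<in> {-1..<1}" for t
    using that by (rule G2_at_top) simp
  show "((\<lambda>l. left2 0 l (-1) (2 + 0) (-1) / l) \<longlongrightarrow> 0) at_top"
    by (rule G2_sublinear) simp
qed (rule V20_next)

theorem theorem9:
  fixes r k :: nat
  assumes "(r = 1 \<and> k = 0) \<or> (r = 2 \<and> k \<in> {0, 1})"
  shows "(\<forall>N. 0 < N \<and> N < M_const r k \<longrightarrow> E_best r k N = \<infinity>) \<and>
         M_const r k = M_end r k \<and>
         (\<forall>N\<ge>M_const r k.
            (\<forall>t\<in>{-1..1}. \<exists>!l. 0 \<le> l \<and> norm2 (u_sol_deriv r k l t) = N) \<and>
            lam r k N (-1) = lam_end r k N \<and>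
            lam r k N 1 = lam_end r k N \<and>
            linear_operator (S_op r k N) \<and>
            E_best r k N = U_dev r k (S_op r k N) \<and>
            U_dev r k (S_op r k N) = ereal (norm2 (u_end r k (lam_end r k N))) \<and>
            ereal (norm2 (u_end r k (lam_end r k N))) = E_best_end r k N)"
proof -
  from assms consider "r = 1" "k = 0" | "r = 2" "k = 0" | "r = 2" "k = 1" by auto
  then show ?thesis
  proof cases
    case 1
    show ?thesis unfolding 1 by (rule kernel_family.stechkin_problem[OF kernel_family_1])
  next
    case 2
    show ?thesis unfolding 2 by (rule kernel_family.stechkin_problem[OF kernel_family_20])
  next
    case 3
    show ?thesis unfolding 3 by (rule kernel_family.stechkin_problem[OF kernel_family_21])
  qed
qed

end
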